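(* For every integer $k$ with $0\leq k\leq 9$, there exist collections $\mathcal{C}_\mu$ and $\overline{\mathcal{C}}_\mu$ of partitions, one pair for each $\mu\in\mathrm{Par}(k)$ (possibly $\mathcal{C}_\mu=\overline{\mathcal{C}}_\mu$), satisfying: (1) the sets $\mathcal{C}_\mu$ ($\mu\in\mathrm{Par}(k)$) are pairwise disjoint, and the sets $\overline{\mathcal{C}}_\mu$ are pairwise disjoint; (2) $\mathrm{DP}_{*,k}=\bigcup_{\mu\in\mathrm{Par}(k)}\mathcal{C}_\mu=\bigcup_{\mu\in\mathrm{Par}(k)}\overline{\mathcal{C}}_\mu$; (3) for all $m\geq0$, $\nu^m(\gamma_\mu)\in\mathcal{C}_\mu$; (4) for each $\mu\in\mathrm{Par}(k)$ there is a unique $\mu^*\in\mathrm{Par}(k)$ with $\mathcal{C}_\mu=\overline{\mathcal{C}}_{\mu^*}$ and $\mathcal{C}_{\mu^*}=\overline{\mathcal{C}}_\mu$; (5) for all $\mu\in\mathrm{Par}(k)$ and all $i\geq\ell(\mu^* )$ there is a unique partition $C_{\mu,i}\in\mathcal{C}_\mu$ with $\mathrm{dinv}(C_{\mu,i})=i$; moreover there is an increasing integer sequence $i_1<i_2<\cdots$ such that $\mathcal{C}_\mu=\bigcup_{j\geq1}R(C_{\mu,i_j})$ and, for some $t\geq1$, the map $j\mapsto\Delta(C_{\mu,i_j})$ is weakly decreasing on $\{1,\ldots,t\}$ and weakly increasing on $\{t,t+1,\ldots\}$; (6) for all $n\geq\max(\zeta(\mu)+2,\zeta(\mu^* )+2)$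 and all integers $i$: $\ell(\mu^* )\leq i\leq\binom{n}{2}-k-\ell(\mu)$ holds if and only if there exists a (unique) $\gamma\in\mathcal{C}_\mu$ with $\Delta(\gamma)\leq n$ and $\mathrm{dinv}(\gamma)=i$; (7) if $\gamma\in\mathcal{C}_\mu$ and $\nu(\gamma)$ is defined, then $\nu(\gamma)\in\mathcal{C}_\mu$; (8) if $\mathrm{dp}_n(\mathrm{dyck}(\lambda))\in\mathcal{C}_\mu$ for some $\lambda\in\mathrm{Par}(n)$, then $\mathrm{dp}_n(\mathrm{dyck}(\lambda'))\in\overline{\mathcal{C}}_\mu$, where $\lambda'$ is the conjugate of $\lambda$; (9) for all $n\geq0$, $\mathcal{C}_\mu\cap\mathrm{DP}_n$ and $\overline{\mathcal{C}}_\mu\cap\mathrm{DP}_n$ are $n$-opposite to each other.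
   Context: $\mathrm{Par}(k)$ is the set of partitions of $k$; partitions are identified up to trailing zeros; $\ell(\gamma)$ is the number of nonzero parts, $|\gamma|$ the sum of parts; the diagram of $\gamma$ is $\{(i,j):1\leq i\leq\ell(\gamma),1\leq j\leq\gamma_i\}$. For a cell $c=(i,j)$, $\mathrm{arm}(c)=\gamma_i-j$, $\mathrm{leg}(c)=\gamma'_j-i$ ($\gamma'$ the conjugate). $\mathrm{dinv}(\gamma)$ is the number of cells with $\mathrm{arm}(c)-\mathrm{leg}(c)\in\{0,1\}$; $\mathrm{def}(\gamma)=|\gamma|-\mathrm{dinv}(\gamma)$; $\mathrm{DP}_{*,k}$ is the set of all partitions $\gamma$ with $\mathrm{def}(\gamma)=k$. $\gamma\in\mathrm{DP}_n$ means the diagram of $\gamma$ is contained in that of $(n-1,n-2,\ldots,1,0)$; $\Delta(\gamma)$ is the least such $n$; for $\gamma\in\mathrm{DP}_n$, $\mathrm{area}_n(\gamma)=\binom{n}{2}-|\gamma|$. Subsets $B,C\subseteq\mathrm{DP}_n$ are $n$-opposite if there is a unique bijection $g:B\to C$ with $\mathrm{area}_n(\gamma)=\mathrm{dinv}(g(\gamma))$ and $\mathrm{dinv}(\gamma)=\mathrm{area}_n(g(\gamma))$ for all $\gamma\in B$. If $\gamma_1\leq\ell(\gamma)+2$, $\nu(\gamma)=(\ell(\gamma)+1,\gamma_1-1,\ldots,\gamma_{\ell(\gamma)}-1)$ (otherwise undefined); $\nu^m$ is the $m$-fold iterate. For a partition $\gamma=(\gamma_1,\ldots,\gamma_v)$,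 let $H_\gamma=\{j:\gamma_j=\gamma_{j+1}=\gamma_{j+2}>0\}$ and set $\rho(\gamma)=\gamma_{\max H_\gamma}$ if $\nu(\gamma)$ is defined and $H_\gamma\neq\emptyset$; $\rho(\gamma)=\gamma_1$ if $\nu(\gamma)$ is defined and $H_\gamma=\emptyset$; $\rho(\gamma)=0$ if $\nu(\gamma)$ is undefined; and $R(\gamma)=\{\nu^m(\gamma):0\leq m\leq\rho(\gamma)\}$. For a Dyck vector $v=(v_1,\ldots,v_n)$ ($v_1=0$, $v_i\geq0$, $v_{i+1}\leq v_i+1$), $\mathrm{dp}_n(v)=(n-1-v_n,n-2-v_{n-1},\ldots,1-v_2,0-v_1)$. For $\lambda\in\mathrm{Par}(n)$, $\mathrm{dyck}(\lambda)$ is the length-$n$ sequence of $\lambda_1$ zeros, followed by $\lambda_2$ ones, $\lambda_3$ twos, etc. For a nonzero partition $\mu$, $\zeta(\mu)=\mu_1+\ell(\mu)$, $e_j$ is the number of parts equal to $j$, and $\gamma_\mu=\mathrm{dp}_{\zeta(\mu)+1}(0,0,\underline{1}^{e_1},0,\underline{1}^{e_2},\ldots,0,\underline{1}^{e_{\mu_1}})$ ($\underline{1}^e$ denotes $e$ ones); for $\mu=(0)$, $\zeta(\mu)=0$ and $\gamma_\mu=(0)$. *)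

theory Defs
  imports Complex_Main "HOL-Library.FuncSet" "HOL-Library.Disjoint_Sets"
begin

text \<open>
  Since partitions are identified up to trailing zeros, a partition is represented by the list of
  its nonzero parts in weakly decreasing order; the zero partition is the empty list.
\<close>

definition is_partition :: "nat list \<Rightarrow> bool" where
  "is_partition \<gamma> \<longleftrightarrow> sorted_wrt (\<ge>) \<gamma> \<and> (\<forall>x\<in>set \<gamma>. 0 < x)"

definition Par :: "nat \<Rightarrow> nat list set" where
  "Par k = {\<gamma>. is_partition \<gamma> \<and> sum_list \<gamma> = k}"

text \<open>Parts are numbered from 1, and all parts beyond the last nonzero one are 0.\<close>

definition part :: "nat list \<Rightarrow> nat \<Rightarrow> nat" where
  "part \<gamma> i = (if 1 \<le> i \<and> i \<le> length \<gamma> then \<gamma> ! (i - 1) else 0)"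

definition drop_zeros :: "nat list \<Rightarrow> nat list" where
  "drop_zeros xs = filter (\<lambda>x. x \<noteq> 0) xs"

definition conjugate :: "nat list \<Rightarrow> nat list" where
  "conjugate \<gamma> = map (\<lambda>j. card {i. 1 \<le> i \<and> i \<le> length \<gamma> \<and> j \<le> part \<gamma> i}) [1..<Suc (part \<gamma> 1)]"

definition diagram :: "nat list \<Rightarrow> (nat \<times> nat) set" where
  "diagram \<gamma> = {(i, j). 1 \<le> i \<and> i \<le> length \<gamma> \<and> 1 \<le> j \<and> j \<le> part \<gamma> i}"

definition arm :: "nat list \<Rightarrow> nat \<times> nat \<Rightarrow> int" where
  "arm \<gamma> c = int (part \<gamma> (fst c)) - int (snd c)"

definition leg :: "nat list \<Rightarrow> nat \<times> nat \<Rightarrow> int" where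
  "leg \<gamma> c = int (part (conjugate \<gamma>) (snd c)) - int (fst c)"

definition dinv :: "nat list \<Rightarrow> nat" where
  "dinv \<gamma> = card {c \<in> diagram \<gamma>. arm \<gamma> c - leg \<gamma> c \<in> {0, 1}}"

definition deficit :: "nat list \<Rightarrow> int" where
  "deficit \<gamma> = int (sum_list \<gamma>) - int (dinv \<gamma>)"

definition DP_deficit :: "nat \<Rightarrow> nat list set" where
  "DP_deficit k = {\<gamma>. is_partition \<gamma> \<and> deficit \<gamma> = int k}"

definition staircase :: "nat \<Rightarrow> nat list" where
  "staircase n = rev [1..<n]"

definition DP :: "nat \<Rightarrow> nat list set" where
  "DP n = {\<gamma>. is_partition \<gamma> \<and> diagram \<gamma> \<subseteq> diagram (staircase n)}"

definition Delta :: "nat list \<Rightarrow> nat" where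
  "Delta \<gamma> = (LEAST n. \<gamma> \<in> DP n)"

definition area :: "nat \<Rightarrow> nat list \<Rightarrow> int" where
  "area n \<gamma> = int (n choose 2) - int (sum_list \<gamma>)"

text \<open>
  The function space \<open>\<rightarrow>\<^sub>E\<close> makes uniqueness a statement about the values of \<open>g\<close> on \<open>B\<close> only.
\<close>

definition opposite :: "nat \<Rightarrow> nat list set \<Rightarrow> nat list set \<Rightarrow> bool" where
  "opposite n B C \<longleftrightarrow> B \<subseteq> DP n \<and> C \<subseteq> DP n \<and>
     (\<exists>!g. g \<in> B \<rightarrow>\<^sub>E C \<and> bij_betw g B C \<and>
        (\<forall>\<gamma>\<in>B. area n \<gamma> = int (dinv (g \<gamma>)) \<and> int (dinv \<gamma>) = area n (g \<gamma>)))"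

text \<open>The partial map \<open>\<nu>\<close>, with \<open>None\<close> for undefined.\<close>

definition nu :: "nat list \<Rightarrow> nat list option" where
  "nu \<gamma> = (if part \<gamma> 1 \<le> length \<gamma> + 2
     then Some (drop_zeros ((length \<gamma> + 1) # map (\<lambda>x. x - 1) \<gamma>)) else None)"

primrec nu_pow :: "nat \<Rightarrow> nat list \<Rightarrow> nat list option" where
  "nu_pow 0 \<gamma> = Some \<gamma>"
| "nu_pow (Suc m) \<gamma> = Option.bind (nu_pow m \<gamma>) nu"

definition H_set :: "nat list \<Rightarrow> nat set" where
  "H_set \<gamma> = {j. 1 \<le> j \<and> part \<gamma> j = part \<gamma> (j + 1) \<and> part \<gamma> (j + 1) = part \<gamma> (j + 2) \<and>
     0 < part \<gamma> (j + 2)}"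

definition rho :: "nat list \<Rightarrow> nat" where
  "rho \<gamma> = (if nu \<gamma> = None then 0
     else if H_set \<gamma> = {} then part \<gamma> 1
     else part \<gamma> (Max (H_set \<gamma>)))"

definition R_set :: "nat list \<Rightarrow> nat list set" where
  "R_set \<gamma> = {\<delta>. \<exists>m\<le>rho \<gamma>. nu_pow m \<gamma> = Some \<delta>}"

text \<open>
  \<open>dp n v\<close> is meant for Dyck vectors \<open>v\<close> of length \<open>n\<close>, written as lists \<open>[v\<^sub>1, \<dots>, v\<^sub>n]\<close>. Its
  \<open>i\<close>-th entry is \<open>n - i - v\<^sub>n\<^sub>+\<^sub>1\<^sub>-\<^sub>i\<close>; the subtraction never truncates as \<open>v\<^sub>i \<le> i - 1\<close> for Dyck vectors.
\<close>

definition dp :: "nat \<Rightarrow> nat list \<Rightarrow> nat list" where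
  "dp n v = drop_zeros (map (\<lambda>i. n - i - v ! (n - i)) [1..<Suc n])"

definition dyck :: "nat list \<Rightarrow> nat list" where
  "dyck \<alpha> = concat (map (\<lambda>i. replicate (part \<alpha> i) (i - 1)) [1..<Suc (length \<alpha>)])"

definition zeta :: "nat list \<Rightarrow> nat" where
  "zeta \<mu> = part \<mu> 1 + length \<mu>"

definition gamma_mu :: "nat list \<Rightarrow> nat list" where
  "gamma_mu \<mu> = (if \<mu> = [] then []
     else dp (zeta \<mu> + 1)
       (0 # concat (map (\<lambda>j. 0 # replicate (count_list \<mu> j) 1) [1..<Suc (part \<mu> 1)])))"

text \<open>The element \<open>C\<^sub>\<mu>\<^sub>,\<^sub>i\<close> of the collection \<open>S = \<C>\<^sub>\<mu>\<close>; meaningful only where it exists uniquely.\<close>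

definition chain_elem :: "nat list set \<Rightarrow> nat \<Rightarrow> nat list" where
  "chain_elem S i = (THE \<gamma>. \<gamma> \<in> S \<and> dinv \<gamma> = i)"

end

theory Submission
  imports Defs
begin

text \<open>
  The map \<open>\<nu>\<close> is injective, preserves the deficit and adds one cell, so the partitions of deficit
  \<open>k\<close> split into \<open>\<nu>\<close>-orbits, each starting at an initial partition, that is, one outside the
  image of \<open>\<nu>\<close>. A nonempty initial partition of deficit \<open>k\<close> satisfies \<open>\<gamma>\<^sub>1 < \<ell>(\<gamma>) \<le> k + 1\<close>, so there
  are finitely many of them and they can be enumerated row by row. The orbits of the partitions
  \<open>\<gamma>\<^sub>\<mu>\<close> are infinite, with \<open>\<Delta>\<close> determined by the number of cells; all other orbits occurring here are finite.
  A chain \<open>\<C>\<^sub>\<mu>\<close> is the orbit of \<open>\<gamma>\<^sub>\<mu>\<close> preceded by suitable finite orbits. As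
  \<open>dinv(\<gamma>) = |\<gamma>| - k\<close> on the partitions of deficit \<open>k\<close>, every condition on the chains becomes a finite
  check on sizes and values of \<open>\<Delta>\<close>, which is evaluated for explicitly given chains.
\<close>

section \<open>Diagrams\<close>

text \<open>Opposition concerns all \<open>n\<close> and infinite chains; what makes it finite is
  the rule for the tails. On deficit \<open>k\<close>, two partitions exchange dinv and area exactly
  when their sizes add up to \<open>(n choose 2) + k\<close>, so opposition of two chains means that
  the sizes occurring in \<open>DP n\<close> are reflected. On the orbit of
  \<open>gamma_mu \<mu>\<close>, lying in \<open>DP n\<close> amounts to size at most
  \<open>(n choose 2) - length \<mu>\<close>. Reflection of this upper bound is the lower bound
  \<open>length \<mu> + k\<close> for the partner chain. Hence the finite orbits put before
  \<open>gamma_mu \<mu>\<close> must fill the sizes from \<open>length (star \<mu>) + k\<close> on,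
  without gap or repetition. Once \<open>n\<close> reaches
  \<open>max (zeta \<mu> + 2) (zeta (star \<mu>) + 2)\<close>, the finite orbits of both chains lie
  in \<open>DP n\<close> and reflection is automatic; only smaller \<open>n\<close> are tested. The
  barred collections are the same chains, reindexed by the involution \<open>star\<close>. The
  condition on conjugates is finite too: unless \<lambda> is a row or a column,
  \<open>dp n (dyck \<lambda>)\<close> is initial with \<open>n - 1\<close> rows, so deficit
  \<open>k\<close> forces \<open>n \<le> k + 2\<close>.\<close>

lemma is_partition_Nil [simp]: "is_partition []"
  by (simp add: is_partition_def)

lemma is_partition_Cons [simp]:
  "is_partition (r # g) \<longleftrightarrow> 0 < r \<and> (\<forall>x\<in>set g. x \<le> r) \<and> is_partition g"
  by (auto simp: is_partition_def)

lemma part_Nil [simp]: "part [] i = 0"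
  by (simp add: part_def)

lemma part_0 [simp]: "part \<gamma> 0 = 0"
  by (simp add: part_def)

lemma part_Cons: "part (r # g) (Suc i) = (if i = 0 then r else part g i)"
  by (cases i) (auto simp: part_def)

lemma part_eq_0: "length \<gamma> < i \<Longrightarrow> part \<gamma> i = 0"
  by (simp add: part_def)

lemma part_pos: "is_partition \<gamma> \<Longrightarrow> 1 \<le> i \<Longrightarrow> i \<le> length \<gamma> \<Longrightarrow> 0 < part \<gamma> i"
  by (auto simp: part_def is_partition_def)

lemma part_le_bound: "\<forall>x\<in>set \<gamma>. x \<le> b \<Longrightarrow> part \<gamma> i \<le> b"
  by (auto simp: part_def)

lemma part_le_first:
  assumes "is_partition \<gamma>"
  shows "part \<gamma> i \<le> part \<gamma> 1"
proof (cases \<gamma>)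
  case (Cons r g)
  then have "part \<gamma> i \<le> r"
    using assms by (intro part_le_bound) auto
  then show ?thesis
    by (simp add: Cons part_Cons)
qed auto

lemma set_le_first: "is_partition \<gamma> \<Longrightarrow> x \<in> set \<gamma> \<Longrightarrow> x \<le> part \<gamma> 1"
  by (cases \<gamma>) (auto simp: part_Cons)

lemma partition_eqI:
  assumes "length \<gamma> = length \<delta>" "\<And>i. part \<gamma> i = part \<delta> i"
  shows "\<gamma> = \<delta>"
proof (rule nth_equalityI)
  fix i
  assume "i < length \<gamma>"
  then show "\<gamma> ! i = \<delta> ! i"
    using assms(1) assms(2)[of "Suc i"] by (simp add: part_def)
qed fact

text \<open>Agrees with the conjugate at every \<open>j \<ge> 1\<close>, with value 0 beyond the
  first part, but recurses along the list of rows, which suits adding a row or deleting a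
  column.\<close>

definition col :: "nat list \<Rightarrow> nat \<Rightarrow> nat" where
  "col \<gamma> j = length (filter (\<lambda>r. j \<le> r) \<gamma>)"

lemma col_Nil [simp]: "col [] j = 0"
  by (simp add: col_def)

lemma col_Cons: "col (r # g) j = (if j \<le> r then Suc (col g j) else col g j)"
  by (simp add: col_def)

lemma col_le_length: "col \<gamma> j \<le> length \<gamma>"
  by (simp add: col_def)

lemma col_1: "is_partition \<gamma> \<Longrightarrow> col \<gamma> (Suc 0) = length \<gamma>"
  by (auto simp: col_def is_partition_def Suc_le_eq)

lemma col_eq_0: "\<forall>x\<in>set \<gamma>. x < j \<Longrightarrow> col \<gamma> j = 0"
  by (auto simp: col_def filter_empty_conv)

text \<open>Both sides say that \<open>(i, j)\<close> is a cell, seen once from its row and once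
  from its column. In \<open>hook_count\<close> this turns a sum over rows into a sum over
  columns.\<close>

lemma le_part_iff_le_col:
  assumes "is_partition \<gamma>" "1 \<le> i" "1 \<le> j"
  shows "j \<le> part \<gamma> i \<longleftrightarrow> i \<le> col \<gamma> j"
  using assms
proof (induction \<gamma> arbitrary: i)
  case Nil
  then show ?case by simp
next
  case (Cons r g)
  obtain i' where i: "i = Suc i'"
    using Cons.prems by (cases i) auto
  show ?case
  proof (cases "j \<le> r")
    case True
    then show ?thesis
      using Cons.IH[of i'] Cons.prems by (cases i') (auto simp: i part_Cons col_Cons)
  next
    case False
    then have "col (r # g) j = 0"
      using Cons.prems by (intro col_eq_0) auto
    moreover have "part (r # g) i \<le> r"
      using Cons.prems by (intro part_le_bound) auto
    ultimately show ?thesis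
      using False Cons.prems by auto
  qed
qed

lemma conjugate_eq_map_col:
  assumes "is_partition \<gamma>"
  shows "conjugate \<gamma> = map (col \<gamma>) [1..<Suc (part \<gamma> 1)]"
proof -
  have "card {i. 1 \<le> i \<and> i \<le> length \<gamma> \<and> j \<le> part \<gamma> i} = col \<gamma> j" if "1 \<le> j" for j
  proof -
    have "{i. 1 \<le> i \<and> i \<le> length \<gamma> \<and> j \<le> part \<gamma> i} = {1..col \<gamma> j}"
      using le_part_iff_le_col[OF assms _ that] col_le_length[of \<gamma> j] by auto
    then show ?thesis
      by simp
  qed
  then show ?thesis
    unfolding conjugate_def by (intro map_cong refl) (simp del: upt_Suc)
qed

lemma part_conjugate:
  assumes "is_partition \<gamma>" "1 \<le> j"
  shows "part (conjugate \<gamma>) j = col \<gamma> j"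
proof -
  have "col \<gamma> j = 0" if "part \<gamma> 1 < j"
    using that le_part_iff_le_col[OF assms(1), of 1 j] assms(2) by auto
  then show ?thesis
    using assms(2) unfolding conjugate_eq_map_col[OF assms(1)] part_def[of "map _ _"]
    by (auto simp del: upt_Suc)
qed

lemma sum_list_eq_sum_part: "sum_list \<gamma> = (\<Sum>i=1..length \<gamma>. part \<gamma> i)"
proof -
  have "sum_list \<gamma> = (\<Sum>i<length \<gamma>. part \<gamma> (Suc i))"
    by (simp add: sum_list_sum_nth part_def atLeast0LessThan)
  also have "\<dots> = (\<Sum>i=1..length \<gamma>. part \<gamma> i)"
    by (simp add: sum.atLeast1_atMost_eq)
  finally show ?thesis .
qed

section \<open>The deficit\<close>

text \<open>Arm minus leg equals \<open>(part \<gamma> i + i) - (j + col \<gamma> j)\<close>, a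
  number of the row minus a number of the column. The bad cells are those that dinv leaves out, so
  their number is the deficit.\<close>

definition bad_cells :: "nat list \<Rightarrow> (nat \<times> nat) set" where
  "bad_cells \<gamma> = {(i, j). 1 \<le> i \<and> 1 \<le> j \<and> j \<le> part \<gamma> i \<and>
     part \<gamma> i + i \<noteq> j + col \<gamma> j \<and> part \<gamma> i + i \<noteq> Suc (j + col \<gamma> j)}"

lemma diagram_eq: "diagram \<gamma> = (SIGMA i:{1..length \<gamma>}. {1..part \<gamma> i})"
  by (auto simp: diagram_def)

lemma finite_diagram [simp]: "finite (diagram \<gamma>)"
  by (simp add: diagram_eq)

lemma card_diagram: "card (diagram \<gamma>) = sum_list \<gamma>"
  by (simp add: diagram_eq sum_list_eq_sum_part)

lemma bad_cells_subset: "bad_cells \<gamma> \<subseteq> diagram \<gamma>"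
  by (auto simp: bad_cells_def diagram_def part_def split: if_splits)

lemma finite_bad_cells [simp]: "finite (bad_cells \<gamma>)"
  using bad_cells_subset finite_diagram by (rule finite_subset)

lemma deficit_eq_card:
  assumes "is_partition \<gamma>"
  shows "deficit \<gamma> = int (card (bad_cells \<gamma>))"
proof -
  let ?good = "{c \<in> diagram \<gamma>. arm \<gamma> c - leg \<gamma> c \<in> {0, 1}}"
  have "?good = diagram \<gamma> - bad_cells \<gamma>"
    using part_conjugate[OF assms]
    by (auto simp: diagram_def bad_cells_def arm_def leg_def)
  then have "card ?good = card (diagram \<gamma>) - card (bad_cells \<gamma>)"
    by (simp add: card_Diff_subset bad_cells_subset)
  moreover have "card (bad_cells \<gamma>) \<le> card (diagram \<gamma>)"
    by (intro card_mono bad_cells_subset) simp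
  ultimately show ?thesis
    by (simp add: deficit_def dinv_def card_diagram)
qed

text \<open>A new longest row on top raises the row index and the column height of every old cell by
  one. Arms and legs of old cells stay the same, and only the new row contributes further bad
  cells.\<close>

lemma card_bad_cells_Cons:
  assumes "is_partition (r # g)"
  shows "card (bad_cells (r # g)) =
    card {j\<in>{1..r}. r \<noteq> j + col g j \<and> r \<noteq> Suc (j + col g j)} + card (bad_cells g)"
proof -
  let ?A = "{j\<in>{1..r}. r \<noteq> j + col g j \<and> r \<noteq> Suc (j + col g j)}"
  have le: "part g i \<le> r" for i
    using assms by (intro part_le_bound) auto
  have "bad_cells (r # g) = Pair 1 ` ?A \<union> (\<lambda>(i, j). (Suc i, j)) ` bad_cells g"
  proof (intro set_eqI iffI)
    fix x
    assume x: "x \<in> bad_cells (r # g)"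
    obtain i j where ij: "x = (Suc i, j)"
      using x by (cases x; cases "fst x") (auto simp: bad_cells_def)
    show "x \<in> Pair 1 ` ?A \<union> (\<lambda>(i, j). (Suc i, j)) ` bad_cells g"
    proof (cases "i = 0")
      case True
      then show ?thesis
        using x ij by (auto simp: bad_cells_def part_Cons col_Cons)
    next
      case False
      then have "(i, j) \<in> bad_cells g"
        using x ij le[of i] by (auto simp: bad_cells_def part_Cons col_Cons)
      then show ?thesis
        using ij by force
    qed
  next
    fix x
    assume x: "x \<in> Pair 1 ` ?A \<union> (\<lambda>(i, j). (Suc i, j)) ` bad_cells g"
    then show "x \<in> bad_cells (r # g)"
    proof
      assume "x \<in> Pair 1 ` ?A"
      then show ?thesis
        by (auto simp: bad_cells_def part_Cons col_Cons)
    next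
      assume "x \<in> (\<lambda>(i, j). (Suc i, j)) ` bad_cells g"
      then obtain i j where "x = (Suc i, j)" "(i, j) \<in> bad_cells g"
        by auto
      then show ?thesis
        using le[of i] by (auto simp: bad_cells_def part_Cons col_Cons)
    qed
  qed
  moreover have "Pair 1 ` ?A \<inter> (\<lambda>(i, j). (Suc i, j)) ` bad_cells g = {}"
    by (auto simp: bad_cells_def)
  ultimately have "card (bad_cells (r # g)) = card (Pair (1::nat) ` ?A) + card ((\<lambda>(i, j). (Suc i, j)) ` bad_cells g)"
    by (simp add: card_Un_disjoint)
  also have "card (Pair (1::nat) ` ?A) = card ?A"
    by (intro card_image) (auto simp: inj_on_def)
  also have "card ((\<lambda>(i, j). (Suc i, j)) ` bad_cells g) = card (bad_cells g)"
    by (intro card_image) (auto simp: inj_on_def)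
  finally show ?thesis .
qed

text \<open>The diagram without its first column. \<open>nu\<close> puts that column back as a top
  row with one extra cell.\<close>

definition strip :: "nat list \<Rightarrow> nat list" where
  "strip \<gamma> = drop_zeros (map (\<lambda>x. x - 1) \<gamma>)"

lemma strip_Nil [simp]: "strip [] = []"
  by (simp add: strip_def drop_zeros_def)

lemma strip_Cons: "strip (r # g) = (if r \<le> 1 then strip g else (r - 1) # strip g)"
  by (auto simp: strip_def drop_zeros_def)

lemma strip_eq_Nil: "\<forall>x\<in>set \<gamma>. x \<le> 1 \<Longrightarrow> strip \<gamma> = []"
  by (auto simp: strip_def drop_zeros_def filter_empty_conv)

lemma set_strip: "x \<in> set (strip \<gamma>) \<Longrightarrow> 0 < x \<and> Suc x \<in> set \<gamma>"
  by (auto simp: strip_def drop_zeros_def)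

lemma length_strip: "length (strip \<gamma>) \<le> length \<gamma>"
  by (auto simp: strip_def drop_zeros_def intro: order_trans[OF length_filter_le])

lemma is_partition_strip: "is_partition \<gamma> \<Longrightarrow> is_partition (strip \<gamma>)"
  by (induction \<gamma>) (auto simp: strip_Cons dest!: set_strip)

lemma part_strip: "is_partition \<gamma> \<Longrightarrow> part (strip \<gamma>) i = part \<gamma> i - 1"
proof (induction \<gamma> arbitrary: i)
  case (Cons r g)
  show ?case
  proof (cases "r \<le> 1")
    case True
    then have "strip (r # g) = []" "part (r # g) i \<le> 1"
      using Cons.prems by (force intro!: strip_eq_Nil part_le_bound)+
    then show ?thesis
      by simp
  next
    case False
    then show ?thesis
      using Cons by (cases i) (auto simp: strip_Cons part_Cons)
  qed
qed simp

lemma col_strip: "is_partition \<gamma> \<Longrightarrow> 1 \<le> j \<Longrightarrow> col (strip \<gamma>) j = col \<gamma> (Suc j)"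
  by (induction \<gamma>) (auto simp: strip_Cons col_Cons)

lemma sum_list_strip: "is_partition \<gamma> \<Longrightarrow> sum_list (strip \<gamma>) + length \<gamma> = sum_list \<gamma>"
  by (induction \<gamma>) (auto simp: strip_Cons)

text \<open>Deleting the first column preserves arms and legs of all other cells. A cell of the
  first column has \<open>j + col \<gamma> j = Suc (length \<gamma>)\<close>, whence the two
  excluded values.\<close>

lemma card_bad_cells_strip:
  assumes "is_partition \<gamma>"
  shows "card (bad_cells \<gamma>) =
    card {i\<in>{1..length \<gamma>}. part \<gamma> i + i \<noteq> Suc (length \<gamma>) \<and> part \<gamma> i + i \<noteq> Suc (Suc (length \<gamma>))} +
    card (bad_cells (strip \<gamma>))"
proof -
  let ?A = "{i\<in>{1..length \<gamma>}. part \<gamma> i + i \<noteq> Suc (length \<gamma>) \<and> part \<gamma> i + i \<noteq> Suc (Suc (length \<gamma>))}"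
  let ?f = "\<lambda>(i :: nat, j). (i, Suc j)"
  have "bad_cells \<gamma> = (\<lambda>i. (i, 1)) ` ?A \<union> ?f ` bad_cells (strip \<gamma>)"
  proof (intro set_eqI iffI)
    fix x
    assume x: "x \<in> bad_cells \<gamma>"
    obtain i j where ij: "x = (i, Suc j)"
      using x by (cases x; cases "snd x") (auto simp: bad_cells_def)
    show "x \<in> (\<lambda>i. (i, 1)) ` ?A \<union> ?f ` bad_cells (strip \<gamma>)"
    proof (cases "j = 0")
      case True
      then have "i \<le> length \<gamma>"
        using x ij part_eq_0[of \<gamma> i] by (force simp: bad_cells_def)
      then have "i \<in> ?A"
        using x ij True by (auto simp: bad_cells_def col_1[OF assms])
      then show ?thesis
        using ij True by auto
    next
      case False
      then have "(i, j) \<in> bad_cells (strip \<gamma>)"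
        using x ij by (auto simp: bad_cells_def part_strip col_strip assms)
      then show ?thesis
        using ij by force
    qed
  next
    fix x
    assume x: "x \<in> (\<lambda>i. (i, 1)) ` ?A \<union> ?f ` bad_cells (strip \<gamma>)"
    then show "x \<in> bad_cells \<gamma>"
    proof
      assume "x \<in> (\<lambda>i. (i, 1)) ` ?A"
      then show ?thesis
        using part_pos[OF assms] by (auto simp: bad_cells_def col_1[OF assms] Suc_le_eq)
    next
      assume "x \<in> ?f ` bad_cells (strip \<gamma>)"
      then show ?thesis
        by (auto simp: bad_cells_def part_strip col_strip assms)
    qed
  qed
  moreover have "(\<lambda>i. (i, 1)) ` ?A \<inter> ?f ` bad_cells (strip \<gamma>) = {}"
    by (auto simp: bad_cells_def)
  ultimately have "card (bad_cells \<gamma>) = card ((\<lambda>i. (i, 1::nat)) ` ?A) + card (?f ` bad_cells (strip \<gamma>))"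
    by (simp add: card_Un_disjoint)
  also have "card ((\<lambda>i. (i, 1::nat)) ` ?A) = card ?A"
    by (intro card_image) (auto simp: inj_on_def)
  also have "card (?f ` bad_cells (strip \<gamma>)) = card (bad_cells (strip \<gamma>))"
    by (intro card_image) (auto simp: inj_on_def)
  finally show ?thesis .
qed

text \<open>
  Both sides of \<open>hook_count\<close> arise by summing \<open>[i + j = m] - [i + j = m + 1]\<close> over the cells
  \<open>(i, j)\<close> of the diagram, where the rows, respectively the columns, telescope.
\<close>

lemma telescope_row:
  assumes "p \<le> (b :: nat)"
  shows "(\<Sum>j=1..b. of_bool (j \<le> p) * (of_bool (i + j = m) - of_bool (i + j = Suc m))) =
    (of_bool (p + i = m) - of_bool (i = m) :: int)"
proof -
  have "(\<Sum>j=1..b. of_bool (j \<le> p) * (of_bool (i + j = m) - of_bool (i + j = Suc m))) =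
    (\<Sum>j=1..p. (of_bool (i + j = m) - of_bool (i + j = Suc m) :: int))"
    using assms by (intro sum.mono_neutral_cong_right) auto
  also have "\<dots> = of_bool (p + i = m) - of_bool (i = m)"
    by (induction p) auto
  finally show ?thesis .
qed

lemma int_card_eq_sum: "int (card {i\<in>{1..a :: nat}. P i}) = (\<Sum>i=1..a. of_bool (P i))"
proof -
  have "{i\<in>{1..a}. P i} = {1..a} \<inter> {i. P i}"
    by auto
  then show ?thesis
    by (simp add: of_bool_def sum.If_cases)
qed

lemma hook_count:
  assumes "is_partition \<gamma>" "length \<gamma> \<le> a" "part \<gamma> 1 \<le> b"
  shows "int (card {i\<in>{1..a}. part \<gamma> i + i = m}) - of_bool (1 \<le> m \<and> m \<le> a) =
    int (card {j\<in>{1..b}. col \<gamma> j + j = m}) - of_bool (1 \<le> m \<and> m \<le> b)"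
proof -
  have ends: "(\<Sum>i=1..n. of_bool (i = m)) = (of_bool (1 \<le> m \<and> m \<le> n) :: int)" for n
    by (induction n) auto
  let ?f = "\<lambda>i j. of_bool (i + j = m) - of_bool (i + j = Suc m) :: int"
  have "int (card {i\<in>{1..a}. part \<gamma> i + i = m}) - of_bool (1 \<le> m \<and> m \<le> a) =
    (\<Sum>i=1..a. of_bool (part \<gamma> i + i = m) - of_bool (i = m))"
    unfolding int_card_eq_sum by (simp only: sum_subtractf ends)
  also have "\<dots> = (\<Sum>i=1..a. \<Sum>j=1..b. of_bool (j \<le> part \<gamma> i) * ?f i j)"
    using part_le_first[OF assms(1)] assms(3)
    by (intro sum.cong telescope_row[symmetric] refl) (auto intro: order_trans)
  also have "\<dots> = (\<Sum>i=1..a. \<Sum>j=1..b. of_bool (i \<le> col \<gamma> j) * ?f j i)"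
    using le_part_iff_le_col[OF assms(1)] by (intro sum.cong refl) (auto simp: add.commute)
  also have "\<dots> = (\<Sum>j=1..b. \<Sum>i=1..a. of_bool (i \<le> col \<gamma> j) * ?f j i)"
    by (rule sum.swap)
  also have "\<dots> = (\<Sum>j=1..b. of_bool (col \<gamma> j + j = m) - of_bool (j = m))"
    using assms(2) col_le_length[of \<gamma>]
    by (intro sum.cong telescope_row refl) (auto intro: order_trans)
  also have "\<dots> = int (card {j\<in>{1..b}. col \<gamma> j + j = m}) - of_bool (1 \<le> m \<and> m \<le> b)"
    unfolding int_card_eq_sum by (simp only: sum_subtractf ends)
  finally show ?thesis .
qed

section \<open>The map \<open>\<nu>\<close>\<close>

lemma nu_eq_Some_iff:
  "nu \<gamma> = Some \<delta> \<longleftrightarrow> part \<gamma> 1 \<le> length \<gamma> + 2 \<and> \<delta> = Suc (length \<gamma>) # strip \<gamma>"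
  by (auto simp: nu_def strip_def drop_zeros_def)

lemma nu_eq_None_iff: "nu \<gamma> = None \<longleftrightarrow> length \<gamma> + 2 < part \<gamma> 1"
  by (auto simp: nu_def)

lemma is_partition_nu:
  assumes "is_partition \<gamma>" "nu \<gamma> = Some \<delta>"
  shows "is_partition \<delta>"
proof -
  have "x \<le> Suc (length \<gamma>)" if "x \<in> set (strip \<gamma>)" for x
    using set_strip[OF that] set_le_first[OF assms(1), of "Suc x"] assms(2) nu_eq_Some_iff by force
  then show ?thesis
    using assms by (auto simp: nu_eq_Some_iff is_partition_strip)
qed

lemma sum_list_nu: "is_partition \<gamma> \<Longrightarrow> nu \<gamma> = Some \<delta> \<Longrightarrow> sum_list \<delta> = Suc (sum_list \<gamma>)"
  using sum_list_strip[of \<gamma>] by (auto simp: nu_eq_Some_iff)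

lemma card_avoid_two:
  assumes "u \<noteq> v"
  shows "card {i\<in>{1..n :: nat}. f i \<noteq> u \<and> f i \<noteq> v} =
    n - (card {i\<in>{1..n}. f i = u} + card {i\<in>{1..n}. f i = v})"
proof -
  let ?A = "{i\<in>{1..n}. f i = u}" and ?B = "{i\<in>{1..n}. f i = v}"
  have "card (?A \<union> ?B) = card ?A + card ?B"
    using assms by (intro card_Un_disjoint) auto
  moreover have "card ({1..n} - (?A \<union> ?B)) = card {1..n} - card (?A \<union> ?B)"
    by (intro card_Diff_subset) auto
  moreover have "{i\<in>{1..n}. f i \<noteq> u \<and> f i \<noteq> v} = {1..n} - (?A \<union> ?B)"
    by auto
  ultimately show ?thesis
    by (simp only: card_atLeastAtMost)
qed

text \<open>\<open>\<gamma>\<close> and \<open>\<delta>\<close> share \<open>strip \<gamma>\<close>,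
  so it suffices to compare the first column of \<open>\<gamma>\<close> with the first row of
  \<open>\<delta>\<close>. Over the common index range \<open>{1..N}\<close> both avoid the same two
  values, and \<open>hook_count\<close> says that rows and columns take these values equally
  often.\<close>

lemma deficit_nu:
  assumes \<gamma>: "is_partition \<gamma>" and nu: "nu \<gamma> = Some \<delta>"
  shows "deficit \<delta> = deficit \<gamma>"
proof -
  define l where "l = length \<gamma>"
  define N where "N = l + 2"
  have \<delta>: "\<delta> = Suc l # strip \<gamma>" and N: "part \<gamma> 1 \<le> N"
    using nu by (auto simp: nu_eq_Some_iff l_def N_def)
  \<comment> \<open>The condition \<open>part \<gamma> 1 \<le> length \<gamma> + 2\<close> in
    \<open>nu\<close> is what lets \<open>{1..N}\<close> cover all columns; with equal ranges for
    rows and columns the correction terms of \<open>hook_count\<close> cancel.\<close>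
  have eq: "card {i\<in>{1..N}. part \<gamma> i + i = m} = card {j\<in>{1..N}. col \<gamma> j + j = m}" for m
    using hook_count[OF \<gamma> _ N, of N m] by (auto simp: N_def l_def)
  have split: "card {i\<in>{1..N}. f i \<noteq> Suc l \<and> f i \<noteq> N} =
      N - (card {i\<in>{1..N}. f i = Suc l} + card {i\<in>{1..N}. f i = N})" for f :: "nat \<Rightarrow> nat"
    by (rule card_avoid_two) (simp add: N_def)
  \<comment> \<open>The two additional rows are empty, so they have
    \<open>part \<gamma> i + i = i\<close>, which is \<open>Suc l\<close> or \<open>N\<close> and
    hence excluded.\<close>
  have "{i\<in>{1..l}. part \<gamma> i + i \<noteq> Suc l \<and> part \<gamma> i + i \<noteq> Suc (Suc l)} =
      {i\<in>{1..N}. part \<gamma> i + i \<noteq> Suc l \<and> part \<gamma> i + i \<noteq> N}"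
  proof -
    have "part \<gamma> i = 0" if "l < i" for i
      using that by (simp add: part_eq_0 l_def)
    then show ?thesis
      by (force simp: N_def le_Suc_eq)
  qed
  then have rows: "card (bad_cells \<gamma>) =
      card {i\<in>{1..N}. part \<gamma> i + i \<noteq> Suc l \<and> part \<gamma> i + i \<noteq> N} + card (bad_cells (strip \<gamma>))"
    using card_bad_cells_strip[OF \<gamma>] by (simp add: l_def)
  \<comment> \<open>Column 1 has height \<open>l\<close> and is excluded by the value
    \<open>Suc l\<close>; the other columns are those of \<open>strip \<gamma>\<close>, shifted by
    one.\<close>
  have "{j\<in>{1..N}. col \<gamma> j + j \<noteq> Suc l \<and> col \<gamma> j + j \<noteq> N} =
      Suc ` {j\<in>{1..Suc l}. Suc l \<noteq> j + col (strip \<gamma>) j \<and> Suc l \<noteq> Suc (j + col (strip \<gamma>) j)}"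
    (is "?L = ?R")
  proof (intro set_eqI iffI)
    fix x
    assume x: "x \<in> ?L"
    then have "x \<noteq> Suc 0"
      by (auto simp: col_1[OF \<gamma>] l_def)
    then obtain y where y: "x = Suc y" "1 \<le> y"
      using x by (cases x) auto
    then show "x \<in> ?R"
      using x by (intro image_eqI[of _ _ y]) (auto simp: N_def col_strip[OF \<gamma>])
  next
    fix x
    assume "x \<in> ?R"
    then show "x \<in> ?L"
      by (auto simp: N_def col_strip[OF \<gamma>])
  qed
  then have "card (bad_cells \<delta>) =
      card {j\<in>{1..N}. col \<gamma> j + j \<noteq> Suc l \<and> col \<gamma> j + j \<noteq> N} + card (bad_cells (strip \<gamma>))"
    using is_partition_nu[OF \<gamma> nu] card_bad_cells_Cons[of "Suc l" "strip \<gamma>"]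
    by (simp add: \<delta> card_image)
  then show ?thesis
    using is_partition_nu[OF \<gamma> nu] \<gamma> by (simp only: deficit_eq_card rows split eq)
qed

text \<open>The first part of the image recovers the number of rows, and thereby the rows of length
  1 that vanished with the first column.\<close>

lemma nu_inj:
  assumes "is_partition \<gamma>" "is_partition \<gamma>'" "nu \<gamma> = Some \<delta>" "nu \<gamma>' = Some \<delta>"
  shows "\<gamma> = \<gamma>'"
proof (rule partition_eqI)
  have eq: "length \<gamma> = length \<gamma>'" "strip \<gamma> = strip \<gamma>'"
    using assms(3,4) by (auto simp: nu_eq_Some_iff)
  then show "length \<gamma> = length \<gamma>'"
    by simp
  fix i
  show "part \<gamma> i = part \<gamma>' i"
  proof (cases "1 \<le> i \<and> i \<le> length \<gamma>")
    case True
    then have "part \<gamma> i - 1 = part \<gamma>' i - 1" "0 < part \<gamma> i" "0 < part \<gamma>' i"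
      using eq part_strip assms(1,2) part_pos by metis+
    then show ?thesis
      by linarith
  next
    case False
    then show ?thesis
      using eq by (cases i) (auto simp: part_eq_0)
  qed
qed

text \<open>For partitions this is the complement of the image of \<open>nu\<close>: an image has
  first part \<open>length \<gamma> + 1\<close> and at most that many rows.\<close>

definition initial :: "nat list \<Rightarrow> bool" where
  "initial \<gamma> \<longleftrightarrow> \<gamma> = [] \<or> part \<gamma> 1 < length \<gamma>"

lemma not_initial_nu: "nu \<gamma> = Some \<delta> \<Longrightarrow> \<not> initial \<delta>"
  using length_strip[of \<gamma>] by (auto simp: nu_eq_Some_iff initial_def part_Cons)

lemma not_initialE:
  assumes "is_partition \<delta>" "\<not> initial \<delta>"
  obtains \<gamma> where "is_partition \<gamma>" "nu \<gamma> = Some \<delta>"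
proof -
  obtain d g where \<delta>: "\<delta> = d # g"
    using assms by (cases \<delta>) (auto simp: initial_def)
  have d: "length \<delta> \<le> d"
    using assms by (auto simp: initial_def \<delta> part_Cons)
  \<comment> \<open>The inverse of \<open>nu\<close>: a first part \<open>d\<close> demands
    \<open>d - 1\<close> rows. Each row of \<open>g\<close> regains a cell, and the missing rows are
    single cells; \<open>length \<delta> \<le> d\<close> makes room for them.\<close>
  define \<gamma> where "\<gamma> = map Suc g @ replicate (d - length \<delta>) 1"
  have g: "is_partition g" "\<forall>x\<in>set g. x \<le> d"
    using assms(1) \<delta> by auto
  have "is_partition \<gamma>"
    using g by (auto simp: \<gamma>_def is_partition_def sorted_wrt_append sorted_wrt_map sorted_wrt_iff_nth_less[of _ "replicate _ _"])
  moreover have "length \<gamma> = d - 1"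
    using d by (auto simp: \<gamma>_def \<delta>)
  moreover have "strip \<gamma> = g"
    using g(1) by (simp add: \<gamma>_def strip_def drop_zeros_def is_partition_def comp_def)
  moreover have "part \<gamma> 1 \<le> length \<gamma> + 2"
  proof -
    have "part \<gamma> 1 \<le> Suc d"
      using g by (intro part_le_bound) (auto simp: \<gamma>_def)
    then show ?thesis
      using \<open>length \<gamma> = d - 1\<close> by simp
  qed
  moreover have "0 < d"
    using assms(1) \<delta> by auto
  ultimately show ?thesis
    by (intro that[of \<gamma>]) (auto simp: nu_eq_Some_iff \<delta>)
qed

section \<open>Iterates and orbits of \<open>nu\<close>\<close>

lemma is_partition_nu_pow: "is_partition \<gamma> \<Longrightarrow> nu_pow m \<gamma> = Some \<delta> \<Longrightarrow> is_partition \<delta>"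
  by (induction m arbitrary: \<delta>) (auto simp: bind_eq_Some_conv intro: is_partition_nu)

lemma sum_list_nu_pow:
  "is_partition \<gamma> \<Longrightarrow> nu_pow m \<gamma> = Some \<delta> \<Longrightarrow> sum_list \<delta> = sum_list \<gamma> + m"
  by (induction m arbitrary: \<delta>) (auto simp: bind_eq_Some_conv, metis is_partition_nu_pow sum_list_nu)

lemma deficit_nu_pow: "is_partition \<gamma> \<Longrightarrow> nu_pow m \<gamma> = Some \<delta> \<Longrightarrow> deficit \<delta> = deficit \<gamma>"
  by (induction m arbitrary: \<delta>) (auto simp: bind_eq_Some_conv, metis is_partition_nu_pow deficit_nu)

lemma nu_pow_add: "nu_pow (m + n) \<gamma> = Option.bind (nu_pow m \<gamma>) (nu_pow n)"
  by (induction n) (auto split: option.splits bind_split)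

lemma nu_pow_Suc: "nu_pow (Suc m) \<gamma> = Option.bind (nu \<gamma>) (nu_pow m)"
  using nu_pow_add[of 1 m \<gamma>] by simp

definition orbit :: "nat list \<Rightarrow> nat list set" where
  "orbit \<gamma> = {\<delta>. \<exists>m. nu_pow m \<gamma> = Some \<delta>}"

lemma orbit_self [simp]: "\<gamma> \<in> orbit \<gamma>"
  unfolding orbit_def by (auto intro: exI[of _ 0])

lemma orbit_closed:
  assumes "\<delta> \<in> orbit \<gamma>" "nu \<delta> = Some \<epsilon>"
  shows "\<epsilon> \<in> orbit \<gamma>"
proof -
  obtain m where "nu_pow m \<gamma> = Some \<delta>"
    using assms(1) by (auto simp: orbit_def)
  then have "nu_pow (Suc m) \<gamma> = Some \<epsilon>"
    using assms(2) by simp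
  then show ?thesis
    unfolding orbit_def by blast
qed

lemma initial_in_orbit:
  assumes "\<delta> \<in> orbit \<gamma>" "initial \<delta>"
  shows "\<delta> = \<gamma>"
proof -
  obtain m where "nu_pow m \<gamma> = Some \<delta>"
    using assms(1) by (auto simp: orbit_def)
  then show ?thesis
    using assms(2) not_initial_nu by (cases m) (auto simp: bind_eq_Some_conv)
qed

text \<open>Walking backwards along \<open>nu\<close> removes one cell per step and therefore stops,
  which it can only do at an initial partition.\<close>

lemma ex_initial_orbit: "is_partition \<delta> \<Longrightarrow> \<exists>\<gamma>. is_partition \<gamma> \<and> initial \<gamma> \<and> \<delta> \<in> orbit \<gamma>"
proof (induction "sum_list \<delta>" arbitrary: \<delta> rule: less_induct)
  case less
  show ?case
  proof (cases "initial \<delta>")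
    case True
    then show ?thesis
      using less.prems orbit_self by blast
  next
    case False
    then obtain \<gamma> where \<gamma>: "is_partition \<gamma>" "nu \<gamma> = Some \<delta>"
      using not_initialE less.prems by blast
    then show ?thesis
      using less.hyps[of \<gamma>] sum_list_nu orbit_closed by fastforce
  qed
qed

text \<open>By injectivity of \<open>nu\<close> the two paths into \<open>\<delta>\<close> agree
  when followed backwards. Neither start is an image, so both are reached at the same
  moment.\<close>

lemma orbits_eq:
  assumes "is_partition \<gamma>" "is_partition \<gamma>'" "initial \<gamma>" "initial \<gamma>'" "\<delta> \<in> orbit \<gamma>" "\<delta> \<in> orbit \<gamma>'"
  shows "\<gamma> = \<gamma>'"
proof -
  obtain m m' where "nu_pow m \<gamma> = Some \<delta>" "nu_pow m' \<gamma>' = Some \<delta>"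
    using assms(5,6) by (auto simp: orbit_def)
  then show ?thesis
  proof (induction m arbitrary: m' \<delta>)
    case 0
    then show ?case
      using assms(3) initial_in_orbit[of \<gamma> \<gamma>'] by (auto simp: orbit_def)
  next
    case (Suc m)
    then obtain \<epsilon> where \<epsilon>: "nu_pow m \<gamma> = Some \<epsilon>" "nu \<epsilon> = Some \<delta>"
      by (auto simp: bind_eq_Some_conv)
    obtain n where n: "m' = Suc n"
      using Suc.prems(2) \<epsilon>(2) assms(4) not_initial_nu by (cases m') auto
    then obtain \<epsilon>' where \<epsilon>': "nu_pow n \<gamma>' = Some \<epsilon>'" "nu \<epsilon>' = Some \<delta>"
      using Suc.prems(2) by (auto simp: bind_eq_Some_conv)
    have "\<epsilon> = \<epsilon>'"
      using \<epsilon> \<epsilon>' assms(1,2) is_partition_nu_pow nu_inj by blast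
    then show ?case
      using Suc.IH \<epsilon>(1) \<epsilon>'(1) by blast
  qed
qed

section \<open>Enumeration of the initial partitions\<close>

text \<open>
  The bad cells counted here lie in the first row and in the first column; \<open>hook_count\<close> trades
  the good cells of the first row for rows whose leftmost cell is bad.
\<close>

lemma length_le_deficit:
  assumes \<gamma>: "is_partition \<gamma>" and "part \<gamma> 1 < length \<gamma>"
  shows "int (length \<gamma>) \<le> deficit \<gamma> + 1"
proof -
  define l r where "l = length \<gamma>" and "r = part \<gamma> 1"
  have rl: "r < l" and r: "1 \<le> r"
    using assms part_pos[OF \<gamma>, of 1] by (auto simp: l_def r_def)
  define a where "a m = card {i\<in>{1..l}. part \<gamma> i + i = m}" for m
  define b where "b m = card {j\<in>{1..r}. col \<gamma> j + j = m}" for m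
  have ab: "int (a m) - of_bool (1 \<le> m \<and> m \<le> l) = int (b m) - of_bool (1 \<le> m \<and> m \<le> r)" for m
    using hook_count[OF \<gamma>, of l r m] by (simp add: a_def b_def l_def r_def)
  have b: "int (b r) = a r" "int (b (Suc r)) = int (a (Suc r)) - 1"
    using ab[of r] ab[of "Suc r"] rl r by auto
  define R where "R = {j\<in>{1..r}. col \<gamma> j + j \<noteq> r \<and> col \<gamma> j + j \<noteq> Suc r}"
  define L where "L = {i\<in>{1..l}. part \<gamma> i + i \<le> l}"
  have "card R = r - (b r + b (Suc r))"
    unfolding R_def b_def by (rule card_avoid_two) simp
  then have cardR: "int (card R) \<ge> int r - a r - a (Suc r) + 1"
    using b by linarith
  have cardL: "card L \<ge> a r + a (Suc r) + (l - Suc r)"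
  proof -
    let ?A = "{i\<in>{1..l}. part \<gamma> i + i = r}"
    let ?B = "{i\<in>{1..l}. part \<gamma> i + i = Suc r}"
    let ?C = "{i\<in>{1..l}. part \<gamma> i + i \<in> {Suc (Suc r)..l}}"
    \<comment> \<open>For \<open>r < m \<le> l\<close> the identity \<open>ab\<close> gives
      \<open>a m = b m + 1\<close>, so every such \<open>m\<close> is attained by some row; this
      supplies \<open>l - Suc r\<close> further rows of \<open>L\<close>.\<close>
    have "{Suc (Suc r)..l} \<subseteq> (\<lambda>i. part \<gamma> i + i) ` ?C"
    proof
      fix m
      assume m: "m \<in> {Suc (Suc r)..l}"
      then have "0 < a m"
        using ab[of m] by auto
      then obtain i where "i \<in> {1..l}" "part \<gamma> i + i = m"
        by (auto simp: a_def card_gt_0_iff)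
      then show "m \<in> (\<lambda>i. part \<gamma> i + i) ` ?C"
        using m by (intro image_eqI[of _ _ i]) auto
    qed
    then have "card {Suc (Suc r)..l} \<le> card ?C"
      by (intro surj_card_le) auto
    moreover have "card (?A \<union> ?B \<union> ?C) = card (?A \<union> ?B) + card ?C"
      by (intro card_Un_disjoint) auto
    moreover have "card (?A \<union> ?B) = a r + a (Suc r)"
      unfolding a_def by (intro card_Un_disjoint) auto
    moreover have "card (?A \<union> ?B \<union> ?C) \<le> card L"
      using rl by (intro card_mono) (auto simp: L_def)
    ultimately show ?thesis
      by simp
  qed
  \<comment> \<open>Rows in \<open>L\<close> have negative arm minus leg at their leftmost cell,
    since \<open>part \<gamma> i + i < 1 + l\<close>. Row 1 is removed because the corner cell is
    already counted in \<open>R\<close>. In the total, \<open>a r + a (Suc r)\<close> cancels and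
    \<open>l - 1\<close> remains.\<close>
  have "Pair 1 ` R \<union> (\<lambda>i. (i, 1)) ` (L - {1}) \<subseteq> bad_cells \<gamma>"
    using part_pos[OF \<gamma>] by (auto simp: bad_cells_def R_def L_def r_def l_def col_1[OF \<gamma>] Suc_le_eq)
  then have "card (Pair 1 ` R \<union> (\<lambda>i. (i, 1)) ` (L - {1})) \<le> card (bad_cells \<gamma>)"
    by (intro card_mono) auto
  moreover have "card (Pair 1 ` R \<union> (\<lambda>i. (i, 1)) ` (L - {1})) =
      card (Pair (1::nat) ` R) + card ((\<lambda>i. (i, 1::nat)) ` (L - {1}))"
    by (intro card_Un_disjoint) (auto simp: R_def L_def)
  moreover have "card (Pair (1::nat) ` R) = card R" "card ((\<lambda>i. (i, 1::nat)) ` (L - {1})) = card (L - {1})"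
    by (auto intro!: card_image simp: inj_on_def)
  moreover have "card (L - {1}) = card L - 1" "card L \<ge> 1"
  proof -
    have "1 \<in> L" "finite L"
      using rl by (auto simp: L_def r_def)
    then show "card (L - {1}) = card L - 1" "card L \<ge> 1"
      by (auto simp: Suc_le_eq card_gt_0_iff)
  qed
  ultimately have "int (card (bad_cells \<gamma>)) \<ge> int l - 1"
    using cardR cardL rl by linarith
  then show ?thesis
    by (simp add: deficit_eq_card \<gamma> l_def)
qed

section \<open>The deficit computed from rows and column heights\<close>

fun add_row :: "nat \<Rightarrow> nat list \<Rightarrow> nat list" where
  "add_row 0 c = c"
| "add_row (Suc r) [] = 1 # add_row r []"
| "add_row (Suc r) (h # c) = Suc h # add_row r c"

fun cols :: "nat list \<Rightarrow> nat list" where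
  "cols [] = []"
| "cols (r # g) = add_row r (cols g)"

text \<open>Counts the bad cells of a row of length \<open>p\<close> laid on top of columns of
  heights \<open>c\<close>. Moving to the next column also shortens the remaining row by one, so
  only that length and the current height are compared. Over empty columns all but the last two
  cells are bad.\<close>

fun row_defect :: "nat \<Rightarrow> nat list \<Rightarrow> nat" where
  "row_defect 0 c = 0"
| "row_defect (Suc p) [] = p - 1"
| "row_defect (Suc p) (h # c) =
     (if p = h \<or> p = Suc h then row_defect p c else Suc (row_defect p c))"

fun defect :: "nat list \<Rightarrow> nat" where
  "defect [] = 0"
| "defect (r # g) = row_defect r (cols g) + defect g"

lemma part_add_row: "part (add_row r c) (Suc j) = part c (Suc j) + of_bool (j < r)"
proof (induction r c arbitrary: j rule: add_row.induct)
  case (2 r)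
  then show ?case by (cases j) (auto simp: part_Cons)
next
  case (3 r h c)
  then show ?case by (cases j) (auto simp: part_Cons)
qed auto

lemma part_cols: "part (cols \<gamma>) (Suc j) = col \<gamma> (Suc j)"
  by (induction \<gamma>) (auto simp: part_add_row col_Cons)

lemma row_defect_eq:
  "row_defect p c = card {j. j < p \<and> p \<noteq> Suc j + part c (Suc j) \<and> p \<noteq> Suc (Suc j + part c (Suc j))}"
proof (induction p c rule: row_defect.induct)
  case (2 p)
  have "{j. j < Suc p \<and> Suc p \<noteq> Suc j + part [] (Suc j) \<and> Suc p \<noteq> Suc (Suc j + part [] (Suc j))} = {..<p - 1}"
    by auto
  then show ?case
    by simp
next
  case (3 p h c)
  let ?S = "{j. j < p \<and> p \<noteq> Suc j + part c (Suc j) \<and> p \<noteq> Suc (Suc j + part c (Suc j))}"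
  have "{j. j < Suc p \<and> Suc p \<noteq> Suc j + part (h # c) (Suc j) \<and> Suc p \<noteq> Suc (Suc j + part (h # c) (Suc j))} =
      (if p = h \<or> p = Suc h then {} else {0}) \<union> Suc ` ?S"
  proof (intro set_eqI)
    fix j
    show "j \<in> {j. j < Suc p \<and> Suc p \<noteq> Suc j + part (h # c) (Suc j) \<and> Suc p \<noteq> Suc (Suc j + part (h # c) (Suc j))} \<longleftrightarrow>
      j \<in> (if p = h \<or> p = Suc h then {} else {0}) \<union> Suc ` ?S"
      by (cases j) (auto simp: part_Cons)
  qed
  moreover have "card (Suc ` ?S) = card ?S"
    by (simp add: card_image)
  moreover have "card ({0} \<union> Suc ` ?S) = Suc (card ?S)"
    by (simp add: card_image)
  ultimately show ?case
    using 3 by auto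
qed auto

lemma card_bad_cells_eq_defect: "is_partition \<gamma> \<Longrightarrow> card (bad_cells \<gamma>) = defect \<gamma>"
proof (induction \<gamma>)
  case Nil
  have "bad_cells [] = {}"
    by (auto simp: bad_cells_def)
  then show ?case
    by simp
next
  case (Cons r g)
  have "{j\<in>{1..r}. r \<noteq> j + col g j \<and> r \<noteq> Suc (j + col g j)} =
      Suc ` {j. j < r \<and> r \<noteq> Suc j + col g (Suc j) \<and> r \<noteq> Suc (Suc j + col g (Suc j))}" (is "?L = Suc ` ?R")
  proof (intro set_eqI)
    fix j
    show "j \<in> ?L \<longleftrightarrow> j \<in> Suc ` ?R"
      by (cases j) auto
  qed
  then have "card ?L = row_defect r (cols g)"
    by (simp add: card_image row_defect_eq part_cols)
  then show ?case
    using Cons card_bad_cells_Cons[of r g] by simp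
qed

lemma deficit_eq_defect: "is_partition \<gamma> \<Longrightarrow> deficit \<gamma> = int (defect \<gamma>)"
  by (simp add: deficit_eq_card card_bad_cells_eq_defect)

text \<open>
  \<open>initials m f b g (cols g)\<close> lists the initial partitions with parts at most \<open>m\<close> that arise from
  \<open>g\<close> by adding at most \<open>f\<close> rows on top whose defects sum to \<open>b\<close>.
\<close>

fun initials :: "nat \<Rightarrow> nat \<Rightarrow> nat \<Rightarrow> nat list \<Rightarrow> nat list \<Rightarrow> nat list list" where
  "initials m 0 b g c = []"
| "initials m (Suc f) b g c = concat (map (\<lambda>p. let d = row_defect p c in
     if d \<le> b then (if d = b \<and> p \<le> length g then [p # g] else []) @
       initials m f (b - d) (p # g) (add_row p c) else [])
     [(case g of [] \<Rightarrow> 1 | r # _ \<Rightarrow> r)..<Suc m])"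

lemma defect_append: "defect g \<le> defect (xs @ g)"
  by (induction xs) auto

lemma is_partition_append: "is_partition (xs @ g) \<Longrightarrow> is_partition g"
  by (induction xs) auto

text \<open>The last entry of \<open>xs\<close> is the first row to be put on \<open>g\<close>. The
  budget \<open>b\<close> never cuts off the right branch, because each further row has nonnegative
  defect.\<close>

lemma initials_complete:
  assumes "is_partition (xs @ g)" "xs \<noteq> []" "length xs \<le> f" "part (xs @ g) 1 \<le> m"
    "part (xs @ g) 1 < length (xs @ g)" "defect (xs @ g) = defect g + b"
  shows "xs @ g \<in> set (initials m f b g (cols g))"
  using assms
proof (induction f arbitrary: xs g b)
  case (Suc f)
  obtain ys p where xs: "xs = ys @ [p]"
    using Suc.prems(2) by (cases xs rule: rev_cases) auto
  have p: "is_partition (p # g)"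
    using Suc.prems(1) is_partition_append[of ys "p # g"] by (simp add: xs)
  have "p \<le> m"
    using set_le_first[OF Suc.prems(1), of p] Suc.prems(4) by (simp add: xs)
  then have range: "p \<in> set [(case g of [] \<Rightarrow> 1 | r # _ \<Rightarrow> r)..<Suc m]"
    using p by (auto split: list.splits)
  define d where "d = row_defect p (cols g)"
  have d: "d \<le> b"
    using Suc.prems(6) defect_append[of "p # g" ys] by (simp add: xs d_def)
  have "xs @ g \<in> set ((if d = b \<and> p \<le> length g then [p # g] else []) @
      initials m f (b - d) (p # g) (add_row p (cols g)))"
  proof (cases "ys = []")
    case True
    then show ?thesis
      using Suc.prems(5,6) by (simp add: xs d_def part_Cons)
  next
    case False
    then have "ys @ (p # g) \<in> set (initials m f (b - d) (p # g) (cols (p # g)))"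
      using Suc.prems d by (intro Suc.IH) (auto simp: xs d_def)
    then show ?thesis
      by (simp add: xs)
  qed
  then show ?case
    using range d unfolding initials.simps Let_def d_def set_concat set_map by force
qed auto

text \<open>The bounds come from \<open>length_le_deficit\<close>: at most \<open>Suc k\<close>
  rows, and hence a first part of at most \<open>k\<close>.\<close>

lemma initial_in_initials:
  assumes "is_partition \<gamma>" "initial \<gamma>" "deficit \<gamma> = int k" "\<gamma> \<noteq> []"
  shows "\<gamma> \<in> set (initials k (Suc k) k [] [])"
proof -
  have "part \<gamma> 1 < length \<gamma>"
    using assms by (simp add: initial_def)
  moreover from this have "length \<gamma> \<le> Suc k"
    using length_le_deficit[OF assms(1)] assms(3) by simp
  ultimately show ?thesis
    using initials_complete[of \<gamma> "[]" "Suc k" k k] assms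
    by (simp add: deficit_eq_defect del: initials.simps)
qed

section \<open>Executable forms of \<open>\<Delta>\<close> and \<open>\<rho>\<close>\<close>

text \<open>The largest \<open>part \<gamma> i + i\<close> over the rows: a diagram fits into a
  staircase if the end of each row does. The empty partition gets 0, since it already lies in
  \<open>DP 0\<close>.\<close>

fun delta :: "nat list \<Rightarrow> nat" where
  "delta [] = 0"
| "delta (r # g) = max (Suc r) (Suc (delta g))"

lemma delta_le_iff: "delta \<gamma> \<le> n \<longleftrightarrow> (\<forall>i\<in>{1..length \<gamma>}. part \<gamma> i + i \<le> n)"
proof (induction \<gamma> arbitrary: n)
  case (Cons r g)
  have "(\<forall>i\<in>{1..length (r # g)}. part (r # g) i + i \<le> n) \<longleftrightarrow>
      Suc r \<le> n \<and> (\<forall>i\<in>{1..length g}. part g i + Suc i \<le> n)"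
  proof -
    have "{1..length (r # g)} = insert 1 (Suc ` {1..length g})"
      by auto
    then show ?thesis
      by (simp add: part_Cons del: image_Suc_atLeastAtMost)
  qed
  also have "\<dots> \<longleftrightarrow> Suc r \<le> n \<and> Suc (delta g) \<le> n"
    using Cons.IH[of "n - 1"] by (cases n) auto
  finally show ?case
    by (simp only: delta.simps max.bounded_iff)
qed auto

lemma length_staircase: "length (staircase n) = n - 1"
  by (simp add: staircase_def)

lemma part_staircase: "part (staircase n) i = (if i = 0 then 0 else n - i)"
  by (auto simp: part_def staircase_def rev_nth)

lemma DP_iff: "\<gamma> \<in> DP n \<longleftrightarrow> is_partition \<gamma> \<and> delta \<gamma> \<le> n"
proof -
  have "diagram \<gamma> \<subseteq> diagram (staircase n) \<longleftrightarrow> (\<forall>i\<in>{1..length \<gamma>}. part \<gamma> i + i \<le> n)"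
    if \<gamma>: "is_partition \<gamma>"
  proof
    assume sub: "diagram \<gamma> \<subseteq> diagram (staircase n)"
    show "\<forall>i\<in>{1..length \<gamma>}. part \<gamma> i + i \<le> n"
    proof
      fix i
      assume i: "i \<in> {1..length \<gamma>}"
      then have pos: "0 < part \<gamma> i"
        using part_pos[OF \<gamma>] by simp
      then have "(i, part \<gamma> i) \<in> diagram \<gamma>"
        using i by (simp add: diagram_def)
      then have "(i, part \<gamma> i) \<in> diagram (staircase n)"
        using sub by blast
      then show "part \<gamma> i + i \<le> n"
        using pos by (auto simp: diagram_def part_staircase split: if_splits)
    qed
  next
    assume *: "\<forall>i\<in>{1..length \<gamma>}. part \<gamma> i + i \<le> n"
    show "diagram \<gamma> \<subseteq> diagram (staircase n)"
    proof clarify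
      fix i j
      assume ij: "(i, j) \<in> diagram \<gamma>"
      then have "part \<gamma> i + i \<le> n"
        using * by (auto simp: diagram_def)
      then show "(i, j) \<in> diagram (staircase n)"
        using ij by (auto simp: diagram_def part_staircase length_staircase)
    qed
  qed
  then show ?thesis
    by (auto simp: DP_def delta_le_iff)
qed

lemma Delta_eq_delta: "is_partition \<gamma> \<Longrightarrow> Delta \<gamma> = delta \<gamma>"
  unfolding Delta_def by (rule Least_equality) (auto simp: DP_iff)

text \<open>Row \<open>i\<close> of \<open>\<gamma>\<close> becomes row \<open>i + 1\<close> of
  \<open>\<delta>\<close> with one cell less, so its value \<open>part \<gamma> i + i\<close>
  survives. Rows of length 1 disappear, but their value is at most
  \<open>length \<gamma> + 1\<close>, which the new top row exceeds.\<close>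

lemma delta_nu:
  assumes \<gamma>: "is_partition \<gamma>" and nu: "nu \<gamma> = Some \<delta>"
  shows "length \<gamma> + 2 \<le> delta \<delta>" "delta \<gamma> \<le> delta \<delta>"
proof -
  have \<delta>: "\<delta> = Suc (length \<gamma>) # strip \<gamma>"
    using nu by (simp add: nu_eq_Some_iff)
  have *: "part \<delta> i + i \<le> delta \<delta>" if "1 \<le> i" "i \<le> length \<delta>" for i
    using delta_le_iff[of \<delta> "delta \<delta>"] that by simp
  show first: "length \<gamma> + 2 \<le> delta \<delta>"
    using *[of 1] by (simp add: \<delta> part_Cons)
  show "delta \<gamma> \<le> delta \<delta>"
    unfolding delta_le_iff
  proof
    fix i
    assume i: "i \<in> {1..length \<gamma>}"
    show "part \<gamma> i + i \<le> delta \<delta>"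
    proof (cases "part \<gamma> i \<le> 1")
      case True
      then show ?thesis
        using first i by simp
    next
      case False
      have "i \<le> length (strip \<gamma>)"
      proof (rule ccontr)
        assume "\<not> i \<le> length (strip \<gamma>)"
        then have "part (strip \<gamma>) i = 0"
          by (simp add: part_eq_0)
        then show False
          using False by (simp add: part_strip[OF \<gamma>])
      qed
      then show ?thesis
        using *[of "Suc i"] i False by (simp add: \<delta> part_Cons part_strip[OF \<gamma>])
    qed
  qed
qed

lemma delta_nu_pow: "is_partition \<gamma> \<Longrightarrow> nu_pow m \<gamma> = Some \<delta> \<Longrightarrow> delta \<gamma> \<le> delta \<delta>"
proof (induction m arbitrary: \<delta>)
  case (Suc m)
  then obtain \<epsilon> where \<epsilon>: "nu_pow m \<gamma> = Some \<epsilon>" "nu \<epsilon> = Some \<delta>"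
    by (auto simp: bind_eq_Some_conv)
  then show ?case
    using Suc.IH[OF Suc.prems(1) \<epsilon>(1)] delta_nu(2)[OF is_partition_nu_pow[OF Suc.prems(1) \<epsilon>(1)] \<epsilon>(2)]
    by simp
qed simp

text \<open>The part at the maximum of \<open>H_set\<close>. The value 0 encodes that there is no
  triple, which is unambiguous for positive parts.\<close>

fun last_triple :: "nat list \<Rightarrow> nat" where
  "last_triple (x # y # z # g) =
     (let t = last_triple (y # z # g) in if t \<noteq> 0 then t else if x = y \<and> y = z then x else 0)"
| "last_triple _ = 0"

lemma finite_H_set [simp]: "finite (H_set \<gamma>)"
proof (rule finite_subset)
  show "H_set \<gamma> \<subseteq> {..length \<gamma>}"
    by (auto simp: H_set_def part_def split: if_splits)
qed simp

lemma H_set_Cons: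
  "H_set (x # y # z # g) = (if x = y \<and> y = z \<and> 0 < z then {1} else {}) \<union> Suc ` H_set (y # z # g)"
proof (intro set_eqI)
  fix j
  show "j \<in> H_set (x # y # z # g) \<longleftrightarrow>
    j \<in> (if x = y \<and> y = z \<and> 0 < z then {1} else {}) \<union> Suc ` H_set (y # z # g)"
  proof (cases j)
    case 0
    then show ?thesis by (auto simp: H_set_def)
  next
    case (Suc i)
    then show ?thesis
      by (cases i) (auto simp: H_set_def part_Cons)
  qed
qed

lemma H_set_short: "length \<gamma> \<le> 2 \<Longrightarrow> H_set \<gamma> = {}"
  by (auto simp: H_set_def part_def)

lemma last_triple_eq:
  "0 \<notin> set \<gamma> \<Longrightarrow> last_triple \<gamma> = (if H_set \<gamma> = {} then 0 else part \<gamma> (Max (H_set \<gamma>)))"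
proof (induction \<gamma> rule: last_triple.induct)
  case (1 x y z g)
  let ?H = "H_set (y # z # g)"
  have IH: "last_triple (y # z # g) = (if ?H = {} then 0 else part (y # z # g) (Max ?H))"
    using 1 by simp
  show ?case
  proof (cases "?H = {}")
    case True
    then show ?thesis
      using 1 IH by (auto simp: H_set_Cons part_Cons Let_def)
  next
    case False
    then have M: "Max ?H \<in> ?H"
      by simp
    then have pos: "1 \<le> Max ?H" "0 < part (y # z # g) (Max ?H)"
      unfolding H_set_def by auto
    have "Max (H_set (x # y # z # g)) = Suc (Max ?H)"
    proof (rule Max_eqI)
      show "Suc (Max ?H) \<in> H_set (x # y # z # g)"
        using M by (simp add: H_set_Cons)
      show "j \<le> Suc (Max ?H)" if "j \<in> H_set (x # y # z # g)" for j
        using that by (auto simp: H_set_Cons split: if_splits)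
    qed simp
    moreover have "H_set (x # y # z # g) \<noteq> {}"
      using False by (simp add: H_set_Cons)
    ultimately show ?thesis
      using False pos IH by (simp add: part_Cons Let_def)
  qed
qed (simp_all add: H_set_short)

definition rho_exec :: "nat list \<Rightarrow> nat" where
  "rho_exec \<gamma> = (if length \<gamma> + 2 < part \<gamma> 1 then 0
     else let t = last_triple \<gamma> in if t = 0 then part \<gamma> 1 else t)"

lemma rho_exec: "is_partition \<gamma> \<Longrightarrow> rho \<gamma> = rho_exec \<gamma>"
proof -
  assume \<gamma>: "is_partition \<gamma>"
  have "0 < part \<gamma> (Max (H_set \<gamma>))" if "H_set \<gamma> \<noteq> {}"
    using Max_in[OF finite_H_set that] unfolding H_set_def by auto
  then have "part \<gamma> (Max (H_set \<gamma>)) \<noteq> 0" if "H_set \<gamma> \<noteq> {}"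
    using that by simp
  moreover have "0 \<notin> set \<gamma>"
    using \<gamma> by (auto simp: is_partition_def)
  ultimately show ?thesis
    by (cases "H_set \<gamma> = {}") (simp_all add: rho_def rho_exec_def nu_eq_None_iff last_triple_eq)
qed

section \<open>The tails\<close>

text \<open>
  \<open>stair c v\<close> is the partition of a Dyck vector \<open>0, 1, \<dots>, c - 1\<close> followed by \<open>v\<close>. On such vectors
  with \<open>c = 2\<close>, \<open>\<nu>\<close> removes the first entry \<open>x \<in> {1, 2}\<close> of \<open>v\<close> and appends \<open>x - 1\<close>.
\<close>

fun stair :: "nat \<Rightarrow> nat list \<Rightarrow> nat list" where
  "stair c [] = []"
| "stair c (x # v) = stair (Suc c) v @ (if x < c then [c - x] else [])"

lemma stair_snoc: "stair c (v @ [x]) = (if x < c + length v then [c + length v - x] else []) @ stair c v"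
  by (induction v arbitrary: c) auto

lemma stair_map_Suc: "stair (Suc c) (map Suc v) = stair c v"
  by (induction v arbitrary: c) auto

lemma strip_append: "strip (xs @ ys) = strip xs @ strip ys"
  by (simp add: strip_def drop_zeros_def)

lemma strip_stair: "strip (stair (Suc c) v) = stair c v"
  by (induction v arbitrary: c) (auto simp: strip_append strip_Cons)

lemma set_stair_bound: "x \<in> set (stair c v) \<Longrightarrow> x < c + length v"
  by (induction v arbitrary: c) (fastforce split: if_splits)+

lemma length_stair: "(\<And>t. t < length v \<Longrightarrow> v ! t < c + t) \<Longrightarrow> length (stair c v) = length v"
proof (induction v arbitrary: c)
  case (Cons x v)
  have "v ! t < Suc c + t" if "t < length v" for t
    using Cons.prems[of "Suc t"] that by simp
  then show ?case
    using Cons.IH[of "Suc c"] Cons.prems[of 0] by simp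
qed simp

lemma length_stair_const: "\<forall>x\<in>set v. x < c \<Longrightarrow> length (stair c v) = length v"
  by (intro length_stair) (auto simp: trans_less_add1)

lemma dp_eq_stair:
  assumes "length v = n"
  shows "dp n v = stair 0 v"
proof -
  have *: "drop_zeros (rev (map (\<lambda>p. c + p - v ! p) [0..<length v])) = stair c v" for c v
  proof (induction v arbitrary: c)
    case (Cons x v)
    have "map (\<lambda>p. c + p - (x # v) ! p) [0..<length (x # v)] =
        (c - x) # map (\<lambda>p. Suc c + p - v ! p) [0..<length v]"
      by (simp add: upt_conv_Cons map_Suc_upt[symmetric] del: upt_Suc)
    then show ?case
      using Cons[of "Suc c"] by (simp add: drop_zeros_def)
  qed (simp add: drop_zeros_def)
  have "map (\<lambda>i. n - i - v ! (n - i)) [1..<Suc n] = rev (map (\<lambda>p. p - v ! p) [0..<n])"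
    by (rule nth_equalityI) (auto simp: rev_nth simp del: upt_Suc)
  then show ?thesis
    using *[of 0 v] assms by (simp add: dp_def del: upt_Suc)
qed

text \<open>The first letter \<open>x\<close> yields the bottom part \<open>2 - x\<close>. For
  \<open>x \<in> {1, 2}\<close> this part is 1 or absent, so nothing of it remains after deleting
  the first column, and the new top part is that of an appended letter \<open>x - 1\<close>. For
  \<open>x = 0\<close> a bottom part 1 remains; the word then keeps its first letter, gains a last
  one, and all letters rise by one to restore the base 2.\<close>

lemma
  assumes "\<forall>y\<in>set u. y \<le> 2"
  shows nu_stair: "x \<in> {1, 2} \<Longrightarrow> nu (stair 2 (x # u)) = Some (stair 2 (u @ [x - 1]))"
    and nu_stair_wrap: "nu (stair 2 (0 # u)) = Some (stair 2 (1 # map Suc u @ [1]))"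
proof -
  have len: "length (stair 3 u) = length u"
    using assms by (intro length_stair_const) auto
  have st: "strip (stair 3 u) = stair 2 u" "stair 3 (map Suc u) = stair 2 u"
    using strip_stair[of 2 u] stair_map_Suc[of 2 u] by simp_all
  have bound: "part (stair 3 u @ ys) 1 \<le> Suc (Suc (length u))" if "\<forall>y\<in>set ys. y \<le> 2" for ys
    using that by (intro part_le_bound) (auto dest!: set_stair_bound)
  show "nu (stair 2 (x # u)) = Some (stair 2 (u @ [x - 1]))" if "x \<in> {1, 2}"
    using that bound[of "[1]"] bound[of "[]"]
    by (auto simp: nu_eq_Some_iff stair_snoc strip_append strip_Cons len st)
  show "nu (stair 2 (0 # u)) = Some (stair 2 (1 # map Suc u @ [1]))"
    using bound[of "[2]"] by (simp add: nu_eq_Some_iff stair_snoc strip_append strip_Cons len st)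
qed

lemma nu_pow_stair:
  assumes "set X \<subseteq> {1, 2}" "j \<le> length X"
  shows "nu_pow j (stair 2 X) = Some (stair 2 (drop j X @ map (\<lambda>x. x - 1) (take j X)))"
  using assms(2)
proof (induction j)
  case (Suc j)
  have X: "\<forall>x\<in>set X. x \<in> {1, 2}"
    using assms(1) by auto
  have "drop j X = X ! j # drop (Suc j) X"
    using Suc.prems by (simp add: Cons_nth_drop_Suc)
  moreover have "nu (stair 2 (X ! j # drop (Suc j) X @ map (\<lambda>x. x - 1) (take j X))) =
      Some (stair 2 ((drop (Suc j) X @ map (\<lambda>x. x - 1) (take j X)) @ [X ! j - 1]))"
    using X Suc.prems by (intro nu_stair) (auto dest!: in_set_dropD in_set_takeD)
  ultimately show ?case
    using Suc by (simp add: take_Suc_conv_app_nth)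
qed simp

text \<open>A full rotation lowers every letter by one, which turns the leading 1 into 0; the
  wrapping step then raises all letters again and appends a 1. The new word satisfies the same
  hypotheses, so the rounds never end.\<close>

lemma nu_pow_stair_round:
  assumes "set X \<subseteq> {1, 2}" "X = [] \<or> hd X = 1"
  shows "nu_pow (Suc (length X)) (stair 2 X) = Some (stair 2 (X @ [1]))"
proof (cases X)
  case Nil
  then show ?thesis
    by (simp add: nu_def drop_zeros_def)
next
  case (Cons x Y)
  then have Y: "set Y \<subseteq> {1, 2}" "x = 1"
    using assms by auto
  then have "map Suc (map (\<lambda>x. x - 1) Y) = Y"
    by (auto intro!: map_idI)
  then have "nu (stair 2 (map (\<lambda>x. x - 1) X)) = Some (stair 2 (X @ [1]))"
    using Y nu_stair_wrap[of "map (\<lambda>x. x - 1) Y"] by (force simp: Cons simp del: stair.simps)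
  then show ?thesis
    using nu_pow_stair[OF assms(1), of "length X"] by simp
qed

lemma sum_list_stair:
  "set X \<subseteq> {1, 2} \<Longrightarrow> sum_list (stair 2 X) + sum_list X = (Suc (length X) choose 2) + length X"
  by (induction X rule: rev_induct) (auto simp: stair_snoc numeral_2_eq_2)

lemma delta_stair: "set X \<subseteq> {1, 2} \<Longrightarrow> delta (stair 2 X) \<le> Suc (length X)"
  by (induction X rule: rev_induct) (auto simp: stair_snoc)

lemma length_less_delta:
  assumes "is_partition \<gamma>" "\<gamma> \<noteq> []"
  shows "length \<gamma> < delta \<gamma>"
proof -
  have "1 \<le> length \<gamma>"
    using assms(2) by (simp add: Suc_le_eq)
  then show ?thesis
    using delta_le_iff[of \<gamma> "delta \<gamma>"] part_pos[OF assms(1), of "length \<gamma>"]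
    by (auto dest!: bspec[of _ _ "length \<gamma>"])
qed

lemma nu_pow_prefix:
  assumes "nu_pow n \<gamma> = Some \<epsilon>" "m \<le> n"
  obtains \<delta> where "nu_pow m \<gamma> = Some \<delta>" "nu_pow (n - m) \<delta> = Some \<epsilon>"
proof -
  have "Option.bind (nu_pow m \<gamma>) (nu_pow (n - m)) = Some \<epsilon>"
    using assms nu_pow_add[of m "n - m" \<gamma>] by simp
  then show ?thesis
    using that by (auto simp: bind_eq_Some_conv)
qed

text \<open>Iteration of the rounds. The bound \<open>m \<ge> r\<close> serves to conclude that
  every iterate of \<open>nu\<close> is defined, being a prefix of a sufficiently long run.\<close>

lemma stair_tail:
  assumes X: "set X \<subseteq> {1, 2}" "X = [] \<or> hd X = 1"
  shows "\<exists>m\<ge>r. nu_pow m (stair 2 X) = Some (stair 2 (X @ replicate r 1))"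
proof (induction r)
  case (Suc r)
  let ?Y = "X @ replicate r 1"
  obtain m where m: "m \<ge> r" "nu_pow m (stair 2 X) = Some (stair 2 ?Y)"
    using Suc by auto
  have "set ?Y \<subseteq> {1, 2}"
    using X(1) by auto
  moreover have "?Y = [] \<or> hd ?Y = 1"
    using X(2) by (cases X; cases r) auto
  ultimately have "nu_pow (Suc (length ?Y)) (stair 2 ?Y) = Some (stair 2 (?Y @ [1]))"
    by (rule nu_pow_stair_round)
  then have "nu_pow (m + Suc (length ?Y)) (stair 2 X) = Some (stair 2 (?Y @ [1]))"
    using m(2) by (simp only: nu_pow_add bind.bind_lunit)
  then show ?case
    using m(1) by (intro exI[of _ "m + Suc (length ?Y)"]) (simp add: replicate_append_same)
qed (auto intro: exI[of _ 0])

lemma stair_tail_defined: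
  assumes "set X \<subseteq> {1, 2}" "X = [] \<or> hd X = 1"
  shows "\<exists>\<delta>. nu_pow m (stair 2 X) = Some \<delta>"
proof -
  obtain m' where "m \<le> m'" "nu_pow m' (stair 2 X) = Some (stair 2 (X @ replicate m 1))"
    using stair_tail[OF assms, of m] by blast
  then show ?thesis
    using nu_pow_prefix[of m' "stair 2 X" _ m] by metis
qed

text \<open>Let \<open>e\<close> be the number of letters 2 in \<open>X\<close>. At the end of round
  \<open>r\<close>, size plus \<open>e\<close> is \<open>Suc (length X + r) choose 2\<close> and
  \<open>delta\<close> is at most \<open>Suc (length X + r)\<close>, while the next iterate has
  \<open>delta\<close> at least \<open>length X + r + 2\<close>. Since \<open>delta\<close> never
  decreases along \<open>nu\<close>, it passes each \<open>n\<close> exactly when size plus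
  \<open>e\<close> passes \<open>n choose 2\<close>.\<close>

lemma stair_tail_delta:
  assumes X: "set X \<subseteq> {1, 2}" "X = [] \<or> hd X = 1"
    and part: "is_partition (stair 2 X)" and \<delta>: "nu_pow m (stair 2 X) = Some \<delta>"
  shows "delta \<delta> \<le> n \<longleftrightarrow> sum_list \<delta> + (sum_list X - length X) \<le> n choose 2"
proof -
  define e where "e = sum_list X - length X"
  have "length X \<le> sum_list X"
    using X(1) by (induction X) auto
  then have sum_e: "sum_list X = e + length X"
    by (simp add: e_def)
  have set_r: "set (X @ replicate r 1) \<subseteq> {1, 2}" for r
    using X(1) by auto
  have sum_r: "sum_list (stair 2 (X @ replicate r 1)) + e = (Suc (length X + r) choose 2)" for r
    using sum_list_stair[OF set_r[of r]] sum_e by (simp add: sum_list_replicate)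
  have length_r: "length (stair 2 (X @ replicate r 1)) = length X + r" for r
  proof (cases "X @ replicate r 1")
    case (Cons x Y)
    have x: "x = 1"
      using X(2) Cons by (cases X; cases r) auto
    have "set Y \<subseteq> {1, 2}"
      using set_r[of r] unfolding Cons by simp
    then have Y: "\<forall>y\<in>set Y. y \<le> 2"
      by auto
    have len: "length X + r = Suc (length Y)"
      using arg_cong[OF Cons, of length] by simp
    have "length (stair (Suc 2) Y) = length Y"
      using Y by (intro length_stair_const) auto
    then show ?thesis
      unfolding Cons using x len by simp
  qed simp
  have after: "length X + r + 2 \<le> delta \<delta> \<and> (Suc (length X + r) choose 2) < sum_list \<delta> + e"
    if "nu_pow m' (stair 2 X) = Some (stair 2 (X @ replicate r 1))" "m' < m" for r m'
  proof -
    let ?\<epsilon> = "stair 2 (X @ replicate r 1)"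
    have \<epsilon>: "is_partition ?\<epsilon>"
      using is_partition_nu_pow[OF part that(1)] .
    have "nu_pow (m - m') ?\<epsilon> = Some \<delta>"
      using nu_pow_prefix[OF \<delta>, of m'] that by auto
    then have "nu_pow (Suc (m - m' - 1)) ?\<epsilon> = Some \<delta>"
      using that(2) by (simp only: Suc_diff_1 zero_less_diff)
    then obtain \<epsilon>' where \<epsilon>': "nu ?\<epsilon> = Some \<epsilon>'" "nu_pow (m - m' - 1) \<epsilon>' = Some \<delta>"
      unfolding nu_pow_Suc by (auto simp: bind_eq_Some_conv)
    have "length X + r + 2 \<le> delta \<epsilon>'"
      using delta_nu(1)[OF \<epsilon> \<epsilon>'(1)] unfolding length_r .
    also have "\<dots> \<le> delta \<delta>"
      using delta_nu_pow \<epsilon>'(2) is_partition_nu[OF \<epsilon> \<epsilon>'(1)] by blast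
    finally show ?thesis
      using sum_list_nu[OF \<epsilon> \<epsilon>'(1)] sum_list_nu_pow[OF is_partition_nu[OF \<epsilon> \<epsilon>'(1)] \<epsilon>'(2)] sum_r[of r]
      by simp
  qed
  \<comment> \<open>Values \<open>n > length X\<close> belong to the end of a round; for smaller
    \<open>n\<close> already the start violates both inequalities. The case \<open>X = []\<close>,
    \<open>n = 0\<close> is separate because \<open>0 choose 2 = 1 choose 2\<close>, so the strict
    comparison of the last case breaks down.\<close>
  consider (large) "Suc (length X) \<le> n" | (zero) "X = []" "n = 0" | (small) "X \<noteq> []" "n \<le> length X"
    by (cases "Suc (length X) \<le> n"; cases "X = []") auto
  then have "delta \<delta> \<le> n \<longleftrightarrow> sum_list \<delta> + e \<le> n choose 2"
  proof cases
    case large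
    define r where "r = n - Suc (length X)"
    have n: "n = Suc (length X + r)"
      using large by (simp add: r_def)
    obtain m' where m': "nu_pow m' (stair 2 X) = Some (stair 2 (X @ replicate r 1))"
      using stair_tail[OF X] by blast
    show ?thesis
    proof (cases "m' < m")
      case True
      then show ?thesis
        using after[OF m'] n by auto
    next
      case False
      then have m'': "nu_pow (m' - m) \<delta> = Some (stair 2 (X @ replicate r 1))"
        using nu_pow_prefix[OF m', of m] \<delta> by auto
      have "is_partition \<delta>"
        using is_partition_nu_pow[OF part \<delta>] .
      moreover have "delta (stair 2 (X @ replicate r 1)) \<le> n"
        using delta_stair[OF set_r[of r]] n by simp
      ultimately have "delta \<delta> \<le> n" "sum_list \<delta> + e \<le> n choose 2"
        using delta_nu_pow[OF _ m''] sum_list_nu_pow[OF _ m''] sum_r[of r] n by auto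
      then show ?thesis
        by simp
    qed
  next
    case zero
    show ?thesis
    proof (cases "m = 0")
      case True
      then show ?thesis
        using \<delta> zero by (simp add: e_def)
    next
      case False
      then show ?thesis
        using after[of 0 0] zero by (auto simp: numeral_2_eq_2 simp del: sum_list_eq_0_iff)
    qed
  next
    case small
    have "length (stair 2 X) = length X"
      using length_r[of 0] by simp
    then have "stair 2 X \<noteq> []"
      using small(1) by auto
    then have "n < delta (stair 2 X)"
      using length_less_delta[OF part] \<open>length (stair 2 X) = length X\<close> small(2) by simp
    moreover have "delta (stair 2 X) \<le> delta \<delta>"
      using delta_nu_pow[OF part \<delta>] .
    moreover have "n choose 2 \<le> length X choose 2"
      using small(2) by (rule lift_Suc_mono_le[rotated]) (simp add: numeral_2_eq_2)
    moreover have "length X choose 2 < Suc (length X) choose 2"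
      using small(1) by (simp add: numeral_2_eq_2)
    ultimately show ?thesis
      using sum_list_nu_pow[OF part \<delta>] sum_r[of 0] by simp
  qed
  then show ?thesis
    by (simp add: e_def)
qed

section \<open>The words of the partitions \<open>gamma_mu\<close>\<close>

definition gamma_word :: "nat list \<Rightarrow> nat list" where
  "gamma_word \<mu> = concat (map (\<lambda>j. 0 # replicate (count_list \<mu> j) 1) [1..<Suc (part \<mu> 1)])"

lemma sum_count_list:
  "(\<And>x. x \<in> set \<mu> \<Longrightarrow> 1 \<le> x \<and> x \<le> b) \<Longrightarrow> (\<Sum>j\<leftarrow>[1..<Suc b]. count_list \<mu> j) = length \<mu>"
proof (induction \<mu>)
  case (Cons x \<mu>)
  have "(\<Sum>j\<leftarrow>[1..<Suc b]. count_list (x # \<mu>) j) =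
      (\<Sum>j\<in>{1..b}. count_list \<mu> j + (if j = x then 1 else 0))"
    by (subst interv_sum_list_conv_sum_set_nat) (auto intro!: sum.cong)
  also have "\<dots> = (\<Sum>j\<in>{1..b}. count_list \<mu> j) + 1"
    using Cons.prems[of x] by (simp add: sum.distrib)
  also have "(\<Sum>j\<in>{1..b}. count_list \<mu> j) = (\<Sum>j\<leftarrow>[1..<Suc b]. count_list \<mu> j)"
    by (subst interv_sum_list_conv_sum_set_nat) (auto intro!: sum.cong)
  finally show ?case
    using Cons by simp
qed (simp add: sum_list_triv del: upt_Suc)

lemma gamma_word_sum:
  assumes "is_partition \<mu>"
  shows "length (gamma_word \<mu>) = zeta \<mu>" "sum_list (gamma_word \<mu>) = length \<mu>"
proof -
  have "(\<Sum>j\<leftarrow>[1..<Suc (part \<mu> 1)]. count_list \<mu> j) = length \<mu>"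
    using assms set_le_first[OF assms] by (intro sum_count_list) (auto simp: is_partition_def Suc_le_eq)
  moreover have "sum_list (concat xss) = (\<Sum>xs\<leftarrow>xss. sum_list xs)" for xss :: "nat list list"
    by (induction xss) auto
  ultimately show "length (gamma_word \<mu>) = zeta \<mu>" "sum_list (gamma_word \<mu>) = length \<mu>"
    by (simp_all add: gamma_word_def zeta_def length_concat comp_def sum_list_replicate
        sum_list_Suc del: upt_Suc)
qed

text \<open>Prefixing 0 to a Dyck vector and raising its old entries by one leaves the partition
  unchanged. Thus the vector \<open>0 # gamma_word \<mu>\<close> acquires the prefix 0, 1 that
  \<open>stair 2\<close> presupposes, and the remaining letters become 1 or 2.\<close>

lemma gamma_mu_eq_stair:
  assumes "is_partition \<mu>"
  shows "gamma_mu \<mu> = stair 2 (map Suc (gamma_word \<mu>))"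
proof (cases "\<mu> = []")
  case True
  then show ?thesis
    by (simp add: gamma_mu_def gamma_word_def)
next
  case False
  then have "gamma_mu \<mu> = stair 0 (0 # gamma_word \<mu>)"
    unfolding gamma_mu_def gamma_word_def[symmetric]
    by (simp add: dp_eq_stair gamma_word_sum[OF assms])
  then show ?thesis
    using stair_map_Suc[of 1 "gamma_word \<mu>"] by (simp add: numeral_2_eq_2)
qed

lemma gamma_word_shape:
  "set (map Suc (gamma_word \<mu>)) \<subseteq> {1, 2}"
  "map Suc (gamma_word \<mu>) = [] \<or> hd (map Suc (gamma_word \<mu>)) = 1"
proof -
  show "set (map Suc (gamma_word \<mu>)) \<subseteq> {1, 2}"
    by (auto simp: gamma_word_def set_replicate_conv_if split: if_splits)
  show "map Suc (gamma_word \<mu>) = [] \<or> hd (map Suc (gamma_word \<mu>)) = 1"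
    by (cases "part \<mu> 1") (auto simp: gamma_word_def upt_conv_Cons simp del: upt_Suc)
qed

lemma gamma_mu_tail_defined:
  assumes "is_partition \<mu>"
  shows "\<exists>\<delta>. nu_pow m (gamma_mu \<mu>) = Some \<delta>"
  unfolding gamma_mu_eq_stair[OF assms] by (rule stair_tail_defined[OF gamma_word_shape])

lemma delta_gamma_mu:
  assumes "is_partition \<mu>"
  shows "delta (gamma_mu \<mu>) \<le> Suc (zeta \<mu>)"
  using delta_stair[OF gamma_word_shape(1), of \<mu>] gamma_word_sum(1)[OF assms]
  by (simp add: gamma_mu_eq_stair[OF assms])

text \<open>The letters 2 of the word correspond to the parts of \<open>\<mu>\<close>, so the excess
  in \<open>stair_tail_delta\<close> is \<open>length \<mu>\<close>. This is the source of the upper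
  bound on dinv in the interval condition.\<close>

lemma gamma_mu_tail_delta:
  assumes "is_partition \<mu>" "is_partition (gamma_mu \<mu>)" "nu_pow m (gamma_mu \<mu>) = Some \<delta>"
  shows "delta \<delta> \<le> n \<longleftrightarrow> sum_list \<delta> + length \<mu> \<le> n choose 2"
proof -
  have "sum_list (map Suc (gamma_word \<mu>)) = length \<mu> + length (map Suc (gamma_word \<mu>))"
    using gamma_word_sum[OF assms(1)] by (simp add: sum_list_Suc)
  then show ?thesis
    using stair_tail_delta[OF gamma_word_shape, of \<mu> m \<delta> n] assms by (simp add: gamma_mu_eq_stair)
qed

section \<open>Dyck vectors of partitions\<close>

fun dyck_from :: "nat \<Rightarrow> nat list \<Rightarrow> nat list" where
  "dyck_from c [] = []"
| "dyck_from c (a # \<alpha>) = replicate a c @ dyck_from (Suc c) \<alpha>"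

lemma dyck_eq: "dyck \<alpha> = dyck_from 0 \<alpha>"
proof -
  have "concat (map (\<lambda>i. replicate (part \<alpha> i) (c + i - 1)) [1..<Suc (length \<alpha>)]) = dyck_from c \<alpha>" for c
  proof (induction \<alpha> arbitrary: c)
    case (Cons a \<alpha>)
    have "map (\<lambda>i. replicate (part (a # \<alpha>) i) (c + i - 1)) [1..<Suc (length (a # \<alpha>))] =
        replicate a c # map (\<lambda>i. replicate (part (a # \<alpha>) (Suc i)) (c + i)) [1..<Suc (length \<alpha>)]"
      by (simp add: upt_conv_Cons map_Suc_upt[symmetric] part_Cons comp_def del: upt_Suc)
    also have "map (\<lambda>i. replicate (part (a # \<alpha>) (Suc i)) (c + i)) [1..<Suc (length \<alpha>)] =
        map (\<lambda>i. replicate (part \<alpha> i) (Suc c + i - 1)) [1..<Suc (length \<alpha>)]"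
      by (intro map_cong refl) (auto simp: part_Cons simp del: upt_Suc)
    finally show ?case
      using Cons[of "Suc c"] by (simp del: upt_Suc)
  qed simp
  from this[of 0] show ?thesis
    by (simp add: dyck_def del: upt_Suc)
qed

lemma length_dyck_from: "length (dyck_from c \<alpha>) = sum_list \<alpha>"
  by (induction \<alpha> arbitrary: c) auto

lemma dyck_from_nth_le:
  "0 \<notin> set \<alpha> \<Longrightarrow> p < sum_list \<alpha> \<Longrightarrow> dyck_from c \<alpha> ! p \<le> c + p"
proof (induction \<alpha> arbitrary: c p)
  case (Cons a \<alpha>)
  then show ?case
    using Cons.IH[of "p - a" "Suc c"] by (cases "p < a") (auto simp: nth_append less_diff_conv2)
qed simp

lemma last_dyck_from: "0 \<notin> set \<alpha> \<Longrightarrow> \<alpha> \<noteq> [] \<Longrightarrow> Suc (last (dyck_from c \<alpha>)) = c + length \<alpha>"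
proof (induction \<alpha> arbitrary: c)
  case (Cons a \<alpha>)
  have "dyck_from (Suc c) \<alpha> \<noteq> []" if "\<alpha> \<noteq> []"
    using that Cons.prems by (cases \<alpha>) auto
  then show ?case
    using Cons.IH[of "Suc c"] Cons.prems by (cases "\<alpha> = []") auto
qed simp

text \<open>Two leading zeros keep each of the \<open>n - 1\<close> rows nonempty, and the last
  entry \<open>length \<alpha> - 1 > 0\<close> pushes the first part below \<open>n - 1\<close>. The
  partition is therefore initial, and its length is bounded in terms of the deficit.\<close>

lemma dp_dyck_shape:
  assumes \<alpha>: "\<alpha> \<in> Par n" "2 \<le> part \<alpha> 1" "2 \<le> length \<alpha>"
  shows "length (dp n (dyck \<alpha>)) = n - 1" "part (dp n (dyck \<alpha>)) 1 < n - 1" "2 \<le> n"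
proof -
  obtain b \<beta> where "\<alpha> = b # \<beta>" "2 \<le> b"
    using \<alpha>(2) by (cases \<alpha>) (auto simp: part_Cons)
  then obtain a where ab: "\<alpha> = Suc (Suc a) # \<beta>"
    by (metis add_2_eq_Suc le_Suc_ex)
  have n: "n = Suc (Suc a) + sum_list \<beta>" and pos: "0 \<notin> set \<alpha>"
    using \<alpha>(1) by (auto simp: Par_def is_partition_def ab)
  show "2 \<le> n"
    by (simp add: n)
  define w where "w = replicate a 0 @ dyck_from 1 \<beta>"
  have v: "dyck \<alpha> = 0 # 0 # w"
    by (simp add: dyck_eq ab w_def)
  have len: "length w = n - 2"
    by (simp add: w_def n length_dyck_from)
  have eq: "dp n (dyck \<alpha>) = stair 2 w @ [1]"
    using len \<open>2 \<le> n\<close> by (simp add: dp_eq_stair v numeral_2_eq_2)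
  have "w ! t < 2 + t" if "t < length w" for t
  proof (cases "t < a")
    case False
    then show ?thesis
      using dyck_from_nth_le[of \<beta> "t - a" 1] that pos
      by (auto simp: w_def nth_append length_dyck_from ab less_diff_conv2)
  qed (simp add: w_def nth_append)
  then have len_stair: "length (stair 2 w) = n - 2"
    using len by (simp add: length_stair)
  then show length: "length (dp n (dyck \<alpha>)) = n - 1"
    using \<open>2 \<le> n\<close> by (simp add: eq)
  have "\<beta> \<noteq> []"
    using \<alpha>(3) by (auto simp: ab)
  then have "dyck_from 1 \<beta> \<noteq> []"
    using pos by (cases \<beta>) (auto simp: ab)
  then have "w \<noteq> []" "last w = length \<beta>"
    using last_dyck_from[of \<beta> 1] pos \<open>\<beta> \<noteq> []\<close> by (auto simp: w_def ab)
  then obtain u where u: "w = u @ [length \<beta>]"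
    by (metis append_butlast_last_id)
  have "stair 2 w \<noteq> []"
    using len_stair len \<open>w \<noteq> []\<close> by auto
  have "length \<beta> < 2 + length u"
    using \<open>\<And>t. t < length w \<Longrightarrow> w ! t < 2 + t\<close>[of "length u"] by (simp add: u)
  then have "part (dp n (dyck \<alpha>)) 1 = 2 + length u - length \<beta>"
    by (simp add: eq u stair_snoc part_Cons)
  moreover have "length u = n - 3" "3 \<le> n"
    using len by (auto simp: u)
  moreover have "0 < length \<beta>"
    using \<open>\<beta> \<noteq> []\<close> by simp
  ultimately show "part (dp n (dyck \<alpha>)) 1 < n - 1"
    by linarith
qed

text \<open>The zero vector gives a full staircase, which ends a round on the orbit of the empty
  partition.\<close>

lemma dp_dyck_row: "dp n (dyck (if n = 0 then [] else [n])) \<in> DP_deficit 0"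
proof (cases n)
  case 0
  then show ?thesis
    by (simp add: dyck_def dp_def drop_zeros_def DP_deficit_def deficit_eq_defect)
next
  case (Suc r)
  have "dp n (dyck (if n = 0 then [] else [n])) = stair 0 (0 # replicate r 0)"
    by (simp add: Suc dyck_eq dp_eq_stair)
  also have "\<dots> = stair 2 ([] @ replicate r 1)"
    using stair_map_Suc[of 1 "replicate r 0"] by (simp add: numeral_2_eq_2)
  finally obtain m where "nu_pow m [] = Some (dp n (dyck (if n = 0 then [] else [n])))"
    using stair_tail[of "[]" r] by auto
  then show ?thesis
    using is_partition_nu_pow[of "[]"] deficit_nu_pow[of "[]"] by (auto simp: DP_deficit_def deficit_eq_defect)
qed

lemma dp_dyck_column: "dp n (dyck (replicate n 1)) \<in> DP_deficit 0"
proof -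
  have "stair c (dyck_from c (replicate n 1)) = []" for c
    by (induction n arbitrary: c) auto
  then have "dp n (dyck (replicate n 1)) = []"
    by (simp add: dyck_eq dp_eq_stair length_dyck_from sum_list_replicate)
  then show ?thesis
    by (simp add: DP_deficit_def deficit_eq_defect)
qed

lemma conjugate_row: "0 < n \<Longrightarrow> conjugate [n] = replicate n 1"
  by (subst conjugate_eq_map_col)
    (auto intro!: nth_equalityI simp: part_Cons col_Cons simp del: upt_Suc)

lemma conjugate_column: "conjugate (replicate n 1) = (if n = 0 then [] else [n])"
proof -
  have "is_partition (replicate n 1)"
    by (auto simp: is_partition_def sorted_wrt_iff_nth_less)
  then show ?thesis
    by (subst conjugate_eq_map_col) (auto simp: part_def col_def)
qed

lemma column_if_part_le_1:
  assumes "\<alpha> \<in> Par n" "part \<alpha> 1 < 2"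
  shows "\<alpha> = replicate n 1"
proof -
  have "x = 1" if "x \<in> set \<alpha>" for x
    using that assms set_le_first[of \<alpha> x] by (fastforce simp: Par_def is_partition_def)
  then have "\<alpha> = replicate (length \<alpha>) 1"
    by (simp add: replicate_length_same)
  moreover from arg_cong[OF this, of sum_list] have "n = length \<alpha>"
    using assms(1) by (simp add: Par_def sum_list_replicate)
  ultimately show ?thesis
    by simp
qed

lemma row_if_length_le_1:
  assumes "\<alpha> \<in> Par n" "length \<alpha> < 2"
  shows "\<alpha> = (if n = 0 then [] else [n])"
  using assms by (cases \<alpha>) (auto simp: Par_def)

section \<open>Chains as lists of \<open>\<nu>\<close>-fragments\<close>

fun path :: "nat list list \<Rightarrow> bool" where
  "path (x # y # zs) \<longleftrightarrow> nu x = Some y \<and> path (y # zs)"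
| "path _ \<longleftrightarrow> True"

lemma path_nu_pow: "path (x # xs) \<Longrightarrow> i \<le> length xs \<Longrightarrow> nu_pow i x = Some ((x # xs) ! i)"
proof (induction xs arbitrary: x i)
  case (Cons y ys)
  then show ?case
    by (cases i) (auto simp: nu_pow_Suc simp del: nu_pow.simps(2))
qed simp

text \<open>The fuel makes the recursion terminate on infinite orbits. That a whole orbit has been
  listed is recognized by \<open>nu\<close> being undefined at the last entry.\<close>

fun fragment :: "nat \<Rightarrow> nat list \<Rightarrow> nat list list" where
  "fragment 0 \<gamma> = [\<gamma>]"
| "fragment (Suc f) \<gamma> = \<gamma> # (case nu \<gamma> of None \<Rightarrow> [] | Some \<delta> \<Rightarrow> fragment f \<delta>)"

lemma fragment_not_Nil [simp]: "fragment f \<gamma> \<noteq> []"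
  by (cases f) auto

lemma hd_fragment [simp]: "hd (fragment f \<gamma>) = \<gamma>"
  by (cases f) auto

lemma path_fragment: "path (fragment f \<gamma>)"
proof (induction f arbitrary: \<gamma>)
  case (Suc f)
  show ?case
  proof (cases "nu \<gamma>")
    case (Some \<delta>)
    then show ?thesis
      using Suc[of \<delta>] hd_fragment[of f \<delta>] by (cases "fragment f \<delta>") auto
  qed simp
qed simp

lemma fragment_nth:
  assumes "i < length (fragment f \<gamma>)"
  shows "nu_pow i \<gamma> = Some (fragment f \<gamma> ! i)"
proof -
  obtain xs where xs: "fragment f \<gamma> = \<gamma> # xs"
    using hd_fragment[of f \<gamma>] by (cases "fragment f \<gamma>") auto
  then show ?thesis
    using path_nu_pow[of \<gamma> xs i] path_fragment[of f \<gamma>] assms by simp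
qed

lemma set_fragment:
  assumes "nu (last (fragment f \<gamma>)) = None"
  shows "set (fragment f \<gamma>) = orbit \<gamma>"
proof
  let ?o = "fragment f \<gamma>"
  show "set ?o \<subseteq> orbit \<gamma>"
    unfolding subset_iff in_set_conv_nth orbit_def using fragment_nth by blast
  show "orbit \<gamma> \<subseteq> set ?o"
  proof
    fix \<delta>
    assume "\<delta> \<in> orbit \<gamma>"
    then obtain m where m: "nu_pow m \<gamma> = Some \<delta>"
      by (auto simp: orbit_def)
    obtain q where q: "length ?o = Suc q"
      by (cases "length ?o") auto
    then have "nu_pow q \<gamma> = Some (last ?o)"
      using fragment_nth[of q f \<gamma>] by (simp add: last_conv_nth)
    then have "nu_pow (length ?o) \<gamma> = None"
      using assms q by simp
    then have "\<not> length ?o \<le> m"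
      using nu_pow_prefix[OF m, of "length ?o"] by (auto simp del: nu_pow.simps)
    then show "\<delta> \<in> set ?o"
      using fragment_nth[of m f \<gamma>] m by (simp add: not_le)
  qed
qed

text \<open>Each block is covered by the \<open>R_set\<close> of its head: single entries until
  \<open>rho\<close> reaches the end of the fragment, then the whole rest. Overlapping
  \<open>R_set\<close>s do no harm, as only their union is prescribed.\<close>

fun blocks :: "nat list list \<Rightarrow> nat list list list" where
  "blocks [] = []"
| "blocks (x # xs) = (if length xs \<le> rho_exec x then [x # xs] else [x] # blocks xs)"

lemma concat_blocks [simp]: "concat (blocks xs) = xs"
  by (induction xs) auto

lemma blocks_in_R_set:
  assumes "path xs" "\<forall>x\<in>set xs. is_partition x" "b \<in> set (blocks xs)"
  shows "b \<noteq> []" "set b \<subseteq> R_set (hd b)"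
proof -
  have "b \<noteq> [] \<and> set b \<subseteq> R_set (hd b)"
    using assms
  proof (induction xs)
    case (Cons x xs)
    have single: "x \<in> R_set x"
      by (auto simp: R_set_def intro: exI[of _ 0])
    show ?case
    proof (cases "length xs \<le> rho_exec x")
      case True
      then have b: "b = x # xs"
        using Cons.prems(3) by simp
      have "y \<in> R_set x" if y: "y \<in> set (x # xs)" for y
      proof -
        obtain i where i: "i \<le> length xs" "y = (x # xs) ! i"
          using y by (metis in_set_conv_nth length_Cons less_Suc_eq_le)
        then show ?thesis
          using path_nu_pow[OF Cons.prems(1) i(1)] True rho_exec[of x] Cons.prems(2)
          by (auto simp: R_set_def intro!: exI[of _ i])
      qed
      then show ?thesis
        by (auto simp: b)
    next
      case False
      have "path xs"
        using Cons.prems(1) by (cases xs) auto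
      then show ?thesis
        using Cons False single by auto
    qed
  qed simp
  then show "b \<noteq> []" "set b \<subseteq> R_set (hd b)"
    by auto
qed

fun valley :: "nat list \<Rightarrow> bool" where
  "valley (x # y # zs) = (if y \<le> x then valley (y # zs) else sorted (y # zs))"
| "valley _ = True"

lemma valley_bottom:
  assumes "valley V" "V \<noteq> []"
  shows "\<exists>c<length V. (\<forall>q<c. V ! Suc q \<le> V ! q) \<and> (\<forall>q\<ge>c. Suc q < length V \<longrightarrow> V ! q \<le> V ! Suc q)"
  using assms
proof (induction V rule: valley.induct)
  case (1 x y zs)
  show ?case
  proof (cases "y \<le> x")
    case True
    then obtain c where c: "c < length (y # zs)" "\<forall>q<c. (y # zs) ! Suc q \<le> (y # zs) ! q"
      "\<forall>q\<ge>c. Suc q < length (y # zs) \<longrightarrow> (y # zs) ! q \<le> (y # zs) ! Suc q"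
      using 1 by auto
    have "(x # y # zs) ! Suc q \<le> (x # y # zs) ! q" if "q < Suc c" for q
      using that c(2) True by (cases q) auto
    moreover have "(x # y # zs) ! q \<le> (x # y # zs) ! Suc q"
      if "Suc c \<le> q" "Suc q < length (x # y # zs)" for q
      using that c(3) by (cases q) auto
    ultimately show ?thesis
      using c(1) by (intro exI[of _ "Suc c"]) auto
  next
    case False
    then have "sorted (x # y # zs)"
      using 1(2) by auto
    then have "(x # y # zs) ! q \<le> (x # y # zs) ! Suc q" if "Suc q < length (x # y # zs)" for q
      using sorted_nth_mono[of "x # y # zs" q "Suc q"] that by simp
    then show ?thesis
      by (intro exI[of _ 0]) blast
  qed
qed auto

text \<open>On deficit \<open>k\<close>, dinv is size minus \<open>k\<close> and area is
  \<open>n choose 2\<close> minus size, so either equation says that the two sizes add up to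
  \<open>(n choose 2) + k\<close>. Partners are unique because sizes are injective on both
  sets.\<close>

lemma opposite_if_reflected:
  assumes A: "A \<subseteq> DP n \<inter> DP_deficit k" "inj_on sum_list A"
    and B: "B \<subseteq> DP n \<inter> DP_deficit k" "inj_on sum_list B"
    and AB: "\<And>\<gamma>. \<gamma> \<in> A \<Longrightarrow> \<exists>\<delta>\<in>B. sum_list \<gamma> + sum_list \<delta> = (n choose 2) + k"
    and BA: "\<And>\<delta>. \<delta> \<in> B \<Longrightarrow> \<exists>\<gamma>\<in>A. sum_list \<gamma> + sum_list \<delta> = (n choose 2) + k"
  shows "opposite n A B"
proof -
  have area_dinv: "area n \<gamma> = int (dinv \<delta>) \<and> int (dinv \<gamma>) = area n \<delta> \<longleftrightarrow>
      sum_list \<gamma> + sum_list \<delta> = (n choose 2) + k" if "\<gamma> \<in> A" "\<delta> \<in> B" for \<gamma> \<delta>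
  proof -
    have "deficit \<gamma> = int k" "deficit \<delta> = int k"
      using that A(1) B(1) by (auto simp: DP_deficit_def)
    then show ?thesis
      unfolding area_def deficit_def by linarith
  qed
  have eqB: "\<delta> = \<delta>'" if "\<delta> \<in> B" "\<delta>' \<in> B" "sum_list \<gamma> + sum_list \<delta> = c" "sum_list \<gamma> + sum_list \<delta>' = c" for \<gamma> \<delta> \<delta>' c
    using inj_onD[OF B(2), of \<delta> \<delta>'] that by simp
  have eqA: "\<gamma> = \<gamma>'" if "\<gamma> \<in> A" "\<gamma>' \<in> A" "sum_list \<gamma> + sum_list \<delta> = c" "sum_list \<gamma>' + sum_list \<delta> = c" for \<gamma> \<gamma>' \<delta> c
    using inj_onD[OF A(2), of \<gamma> \<gamma>'] that by simp
  obtain f where f: "\<And>\<gamma>. \<gamma> \<in> A \<Longrightarrow> f \<gamma> \<in> B \<and> sum_list \<gamma> + sum_list (f \<gamma>) = (n choose 2) + k"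
    using AB by metis
  have "bij_betw (restrict f A) A B"
    unfolding bij_betw_def
  proof
    show "inj_on (restrict f A) A"
      using f eqA by (intro inj_onI) (metis restrict_apply')
    show "restrict f A ` A = B"
    proof (intro set_eqI iffI)
      fix \<delta>
      assume \<delta>: "\<delta> \<in> B"
      then obtain \<gamma> where "\<gamma> \<in> A" "sum_list \<gamma> + sum_list \<delta> = (n choose 2) + k"
        using BA by blast
      then have "f \<gamma> = \<delta>"
        using f eqB \<delta> by blast
      then show "\<delta> \<in> restrict f A ` A"
        using \<open>\<gamma> \<in> A\<close> by force
    qed (use f in auto)
  qed
  then have "\<exists>!g. g \<in> A \<rightarrow>\<^sub>E B \<and> bij_betw g A B \<and>
      (\<forall>\<gamma>\<in>A. area n \<gamma> = int (dinv (g \<gamma>)) \<and> int (dinv \<gamma>) = area n (g \<gamma>))"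
  proof (intro ex1I[of _ "restrict f A"] conjI ballI)
    fix g
    assume g: "g \<in> A \<rightarrow>\<^sub>E B \<and> bij_betw g A B \<and>
      (\<forall>\<gamma>\<in>A. area n \<gamma> = int (dinv (g \<gamma>)) \<and> int (dinv \<gamma>) = area n (g \<gamma>))"
    have "g \<gamma> = f \<gamma>" if \<gamma>: "\<gamma> \<in> A" for \<gamma>
    proof -
      have "g \<gamma> \<in> B"
        using g \<gamma> by (auto dest: PiE_mem)
      then show ?thesis
        using area_dinv[OF \<gamma>, of "g \<gamma>"] g \<gamma> f eqB by blast
    qed
    then show "g = restrict f A"
      using g by (intro extensionalityI[of g A]) (auto simp: PiE_def)
  qed (use f area_dinv in auto)
  then show ?thesis
    using A(1) B(1) by (auto simp: opposite_def)
qed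

text \<open>Records which of the first \<open>m\<close> members of a chain lie in
  \<open>DP n\<close>, where \<open>ds\<close> lists \<open>delta\<close> on the finite orbits.
  Positions after \<open>ds\<close> belong to the tail; for the \<open>m\<close> used below, tail
  members before position \<open>m\<close> do lie in \<open>DP n\<close>, hence the padding by
  \<open>True\<close>.\<close>

definition profile :: "nat \<Rightarrow> nat \<Rightarrow> nat list \<Rightarrow> bool list" where
  "profile n m ds = map (\<lambda>d. d \<le> n) (take m ds) @ replicate (m - length ds) True"

lemma length_profile [simp]: "length (profile n m ds) = m"
  by (simp add: profile_def)

lemma profile_nth: "p < m \<Longrightarrow> profile n m ds ! p \<longleftrightarrow> (p < length ds \<longrightarrow> ds ! p \<le> n)"
  by (simp add: profile_def nth_append)

section \<open>Chains built from finite orbits and a tail\<close>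

locale chain_data =
  fixes k fuel :: nat
    and star :: "nat list \<Rightarrow> nat list"
    and starts :: "nat list \<Rightarrow> nat list list"
  assumes star_Par: "\<mu> \<in> Par k \<Longrightarrow> star \<mu> \<in> Par k"
    and star_star: "\<mu> \<in> Par k \<Longrightarrow> star (star \<mu>) = \<mu>"
    and starts: "\<mu> \<in> Par k \<Longrightarrow> \<gamma> \<in> set (starts \<mu> @ [gamma_mu \<mu>]) \<Longrightarrow>
      is_partition \<gamma> \<and> deficit \<gamma> = int k \<and> initial \<gamma>"
    and starts_disjoint: "\<mu> \<in> Par k \<Longrightarrow> \<kappa> \<in> Par k \<Longrightarrow> \<gamma> \<in> set (starts \<mu> @ [gamma_mu \<mu>]) \<Longrightarrow>
      \<gamma> \<in> set (starts \<kappa> @ [gamma_mu \<kappa>]) \<Longrightarrow> \<mu> = \<kappa>"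
    and starts_complete: "is_partition \<gamma> \<Longrightarrow> deficit \<gamma> = int k \<Longrightarrow> initial \<gamma> \<Longrightarrow>
      \<exists>\<mu>\<in>Par k. \<gamma> \<in> set (starts \<mu> @ [gamma_mu \<mu>])"
    and fragment_ends: "\<mu> \<in> Par k \<Longrightarrow> \<gamma> \<in> set (starts \<mu>) \<Longrightarrow> nu (last (fragment fuel \<gamma>)) = None"
    and sizes: "\<mu> \<in> Par k \<Longrightarrow> map sum_list (concat (map (fragment fuel) (starts \<mu>))) =
      [length (star \<mu>) + k..<sum_list (gamma_mu \<mu>)]"
    and size_gamma_mu: "\<mu> \<in> Par k \<Longrightarrow> length (star \<mu>) + k \<le> sum_list (gamma_mu \<mu>)"
    and valley: "\<mu> \<in> Par k \<Longrightarrow> valley (map (\<lambda>b. delta (hd b)) (concat (map (\<lambda>\<gamma>. blocks (fragment fuel \<gamma>)) (starts \<mu>))) @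
      [delta (gamma_mu \<mu>)])"
    and delta_bound: "\<mu> \<in> Par k \<Longrightarrow> \<gamma> \<in> set (concat (map (fragment fuel) (starts \<mu>))) \<Longrightarrow>
      delta \<gamma> \<le> max (zeta \<mu> + 2) (zeta (star \<mu>) + 2)"
    \<comment> \<open>\<open>m\<close> is the number of positions \<open>p\<close> with
      \<open>length (star \<mu>) + k + p + length \<mu> \<le> n choose 2\<close>, truncated to 0 if
      there are none. It is the same for \<open>\<mu>\<close> and \<open>star \<mu>\<close>, and
      reversal pairs position \<open>p\<close> with \<open>m - 1 - p\<close>.\<close>
    and reflection: "\<mu> \<in> Par k \<Longrightarrow> n < max (zeta \<mu> + 2) (zeta (star \<mu>) + 2) \<Longrightarrow>
      m = Suc (n choose 2) - (length \<mu> + length (star \<mu>) + k) \<Longrightarrow>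
      profile n m (map delta (concat (map (fragment fuel) (starts \<mu>)))) =
        rev (profile n m (map delta (concat (map (fragment fuel) (starts (star \<mu>)))))) \<and>
      (\<forall>d\<in>set (drop m (map delta (concat (map (fragment fuel) (starts \<mu>))))). n < d)"
    \<comment> \<open>For such \<open>\<alpha>\<close> the partition
      \<open>dp n (dyck \<alpha>)\<close> is initial with \<open>n - 1\<close> rows, so
      \<open>length_le_deficit\<close> leaves only \<open>n \<le> k + 2\<close>.\<close>
    and conj_starts: "\<mu> \<in> Par k \<Longrightarrow> n \<le> k + 2 \<Longrightarrow> \<alpha> \<in> Par n \<Longrightarrow> 2 \<le> part \<alpha> 1 \<Longrightarrow> 2 \<le> length \<alpha> \<Longrightarrow>
      dp n (dyck \<alpha>) \<in> set (starts \<mu> @ [gamma_mu \<mu>]) \<Longrightarrow>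
      dp n (dyck (conjugate \<alpha>)) \<in> set (starts (star \<mu>) @ [gamma_mu (star \<mu>)])"
begin

definition chain :: "nat list \<Rightarrow> nat list set" where
  "chain \<mu> = (\<Union>\<gamma>\<in>set (starts \<mu> @ [gamma_mu \<mu>]). orbit \<gamma>)"

definition elems :: "nat list \<Rightarrow> nat list list" where
  "elems \<mu> = concat (map (fragment fuel) (starts \<mu>))"

definition chain_blocks :: "nat list \<Rightarrow> nat list list list" where
  "chain_blocks \<mu> = concat (map (\<lambda>\<gamma>. blocks (fragment fuel \<gamma>)) (starts \<mu>))"

text \<open>The members of a chain in order of size: finite orbits first, then the tail, on which
  all iterates are defined and \<open>the\<close> is legitimate.\<close>

definition elem :: "nat list \<Rightarrow> nat \<Rightarrow> nat list" where
  "elem \<mu> p = (if p < length (elems \<mu>) then elems \<mu> ! p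
     else the (nu_pow (p - length (elems \<mu>)) (gamma_mu \<mu>)))"

lemma Par_partition: "\<mu> \<in> Par k \<Longrightarrow> is_partition \<mu>"
  by (simp add: Par_def)

lemma chain_subset: "\<mu> \<in> Par k \<Longrightarrow> chain \<mu> \<subseteq> DP_deficit k"
  unfolding chain_def orbit_def DP_deficit_def
  using starts is_partition_nu_pow deficit_nu_pow by fastforce

lemma chain_disjoint:
  assumes "\<mu> \<in> Par k" "\<kappa> \<in> Par k" "\<delta> \<in> chain \<mu>" "\<delta> \<in> chain \<kappa>"
  shows "\<mu> = \<kappa>"
proof -
  obtain \<gamma> \<gamma>' where *: "\<gamma> \<in> set (starts \<mu> @ [gamma_mu \<mu>])" "\<delta> \<in> orbit \<gamma>"
      "\<gamma>' \<in> set (starts \<kappa> @ [gamma_mu \<kappa>])" "\<delta> \<in> orbit \<gamma>'"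
    using assms(3,4) unfolding chain_def by blast
  then have "\<gamma> = \<gamma>'"
    using starts assms(1,2) by (meson orbits_eq)
  then show ?thesis
    using * starts_disjoint assms(1,2) by blast
qed

lemma DP_deficit_eq: "DP_deficit k = (\<Union>\<mu>\<in>Par k. chain \<mu>)"
proof
  show "DP_deficit k \<subseteq> (\<Union>\<mu>\<in>Par k. chain \<mu>)"
  proof
    fix \<delta>
    assume \<delta>: "\<delta> \<in> DP_deficit k"
    then obtain \<gamma> where \<gamma>: "is_partition \<gamma>" "initial \<gamma>" "\<delta> \<in> orbit \<gamma>"
      using ex_initial_orbit by (auto simp: DP_deficit_def)
    then have "deficit \<gamma> = int k"
      using \<delta> deficit_nu_pow by (auto simp: orbit_def DP_deficit_def)
    then show "\<delta> \<in> (\<Union>\<mu>\<in>Par k. chain \<mu>)"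
      using starts_complete[of \<gamma>] \<gamma> unfolding chain_def by blast
  qed
qed (use chain_subset in blast)

lemma chain_closed: "\<gamma> \<in> chain \<mu> \<Longrightarrow> nu \<gamma> = Some \<delta> \<Longrightarrow> \<delta> \<in> chain \<mu>"
  unfolding chain_def using orbit_closed by blast

lemma gamma_mu_partition: "\<mu> \<in> Par k \<Longrightarrow> is_partition (gamma_mu \<mu>)"
  using starts by simp

lemma tail_elem:
  "\<mu> \<in> Par k \<Longrightarrow> nu_pow m (gamma_mu \<mu>) = Some (elem \<mu> (length (elems \<mu>) + m))"
  using gamma_mu_tail_defined[OF Par_partition, of \<mu> m] by (auto simp: elem_def)

lemma set_elems: "\<mu> \<in> Par k \<Longrightarrow> set (elems \<mu>) = (\<Union>\<gamma>\<in>set (starts \<mu>). orbit \<gamma>)"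
  using fragment_ends set_fragment by (auto simp: elems_def)

lemma chain_eq_range:
  assumes "\<mu> \<in> Par k"
  shows "chain \<mu> = range (elem \<mu>)"
proof -
  have "orbit (gamma_mu \<mu>) = elem \<mu> ` {length (elems \<mu>)..}"
  proof (intro set_eqI iffI)
    fix \<delta>
    assume "\<delta> \<in> elem \<mu> ` {length (elems \<mu>)..}"
    then obtain p where "\<delta> = elem \<mu> p" "length (elems \<mu>) \<le> p"
      by auto
    then show "\<delta> \<in> orbit (gamma_mu \<mu>)"
      using tail_elem[OF assms, of "p - length (elems \<mu>)"] by (auto simp: orbit_def)
  qed (auto simp: orbit_def tail_elem[OF assms])
  moreover have "set (elems \<mu>) = elem \<mu> ` {..<length (elems \<mu>)}"
    by (auto simp: elem_def in_set_conv_nth image_iff)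
  ultimately have "chain \<mu> = elem \<mu> ` ({..<length (elems \<mu>)} \<union> {length (elems \<mu>)..})"
    using set_elems[OF assms] by (auto simp: chain_def)
  also have "{..<length (elems \<mu>)} \<union> {length (elems \<mu>)..} = UNIV"
    by auto
  finally show ?thesis .
qed

lemma elem_in_chain: "\<mu> \<in> Par k \<Longrightarrow> elem \<mu> p \<in> chain \<mu>"
  by (simp add: chain_eq_range)

lemma elem_partition: "\<mu> \<in> Par k \<Longrightarrow> is_partition (elem \<mu> p)"
  using elem_in_chain chain_subset by (fastforce simp: DP_deficit_def)

lemma length_elems:
  assumes "\<mu> \<in> Par k"
  shows "length (star \<mu>) + k + length (elems \<mu>) = sum_list (gamma_mu \<mu>)"
  using arg_cong[OF sizes[OF assms], of length] size_gamma_mu[OF assms] by (simp add: elems_def)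

text \<open>The finite orbits have consecutive sizes ending just below
  \<open>gamma_mu \<mu>\<close>, and the tail gains one cell per step. Position and dinv thus
  determine each other.\<close>

lemma sum_list_elem:
  assumes "\<mu> \<in> Par k"
  shows "sum_list (elem \<mu> p) = length (star \<mu>) + k + p"
proof (cases "p < length (elems \<mu>)")
  case True
  then have "sum_list (elem \<mu> p) = map sum_list (elems \<mu>) ! p"
    by (simp add: elem_def)
  also have "\<dots> = [length (star \<mu>) + k..<sum_list (gamma_mu \<mu>)] ! p"
    using sizes[OF assms] by (simp only: elems_def)
  finally show ?thesis
    using True length_elems[OF assms] by simp
next
  case False
  then show ?thesis
    using sum_list_nu_pow[OF gamma_mu_partition[OF assms] tail_elem[OF assms, of "p - length (elems \<mu>)"]]
      length_elems[OF assms] by simp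
qed

lemma dinv_elem:
  assumes "\<mu> \<in> Par k"
  shows "dinv (elem \<mu> p) = length (star \<mu>) + p"
proof -
  have "deficit (elem \<mu> p) = int k"
    using elem_in_chain chain_subset assms by (fastforce simp: DP_deficit_def)
  then show ?thesis
    using sum_list_elem[OF assms, of p] by (simp add: deficit_def)
qed

lemma chain_elem_eq:
  assumes "\<mu> \<in> Par k"
  shows "chain_elem (chain \<mu>) (length (star \<mu>) + p) = elem \<mu> p"
  unfolding chain_elem_def
  by (rule the_equality) (auto simp: chain_eq_range assms dinv_elem[OF assms])

lemma ex1_dinv:
  assumes "\<mu> \<in> Par k" "length (star \<mu>) \<le> i"
  shows "\<exists>!\<gamma>. \<gamma> \<in> chain \<mu> \<and> dinv \<gamma> = i"
proof (rule ex1I[of _ "elem \<mu> (i - length (star \<mu>))"])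
  show "elem \<mu> (i - length (star \<mu>)) \<in> chain \<mu> \<and> dinv (elem \<mu> (i - length (star \<mu>))) = i"
    using assms by (simp add: elem_in_chain dinv_elem)
  show "\<gamma> = elem \<mu> (i - length (star \<mu>))" if "\<gamma> \<in> chain \<mu> \<and> dinv \<gamma> = i" for \<gamma>
    using that assms by (auto simp: chain_eq_range dinv_elem)
qed

lemma inj_on_sum_list: "\<mu> \<in> Par k \<Longrightarrow> inj_on sum_list (chain \<mu>)"
  by (auto simp: chain_eq_range inj_on_def sum_list_elem)

lemma delta_tail_elem:
  assumes "\<mu> \<in> Par k" "length (elems \<mu>) \<le> p"
  shows "delta (elem \<mu> p) \<le> n \<longleftrightarrow> sum_list (elem \<mu> p) + length \<mu> \<le> n choose 2"
  using gamma_mu_tail_delta[OF Par_partition gamma_mu_partition tail_elem, of \<mu> "p - length (elems \<mu>)" n] assms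
  by simp

text \<open>For such \<open>n\<close> the finite orbits lie in \<open>DP n\<close> by
  \<open>delta_bound\<close>, and the inequality holds for them because it holds for
  \<open>gamma_mu \<mu>\<close>, which is larger. On the tail it is the rule for tails.\<close>

lemma delta_elem_large:
  assumes "\<mu> \<in> Par k" "max (zeta \<mu> + 2) (zeta (star \<mu>) + 2) \<le> n"
  shows "delta (elem \<mu> p) \<le> n \<longleftrightarrow> length (star \<mu>) + k + p + length \<mu> \<le> n choose 2"
proof (cases "p < length (elems \<mu>)")
  case True
  then have "elem \<mu> p \<in> set (elems \<mu>)"
    by (simp add: elem_def)
  then have "delta (elem \<mu> p) \<le> n"
    using delta_bound[OF assms(1), of "elem \<mu> p"] assms(2) by (simp add: elems_def)
  moreover have "delta (gamma_mu \<mu>) \<le> n"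
    using delta_gamma_mu[OF Par_partition[OF assms(1)]] assms(2) by simp
  then have "sum_list (gamma_mu \<mu>) + length \<mu> \<le> n choose 2"
    using gamma_mu_tail_delta[OF Par_partition[OF assms(1)] gamma_mu_partition[OF assms(1)],
        of 0 "gamma_mu \<mu>" n] by simp
  ultimately show ?thesis
    using length_elems[OF assms(1)] True by linarith
next
  case False
  then show ?thesis
    using delta_tail_elem[OF assms(1), of p n] sum_list_elem[OF assms(1), of p] by simp
qed

lemma chain_in_DP: "\<mu> \<in> Par k \<Longrightarrow> \<gamma> \<in> chain \<mu> \<Longrightarrow> \<gamma> \<in> DP n \<longleftrightarrow> delta \<gamma> \<le> n"
  using chain_subset by (auto simp: DP_iff DP_deficit_def)

text \<open>The partner of position \<open>p\<close> is the position \<open>q\<close> for which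
  \<open>p + q\<close> equals
  \<open>(n choose 2) - (length \<mu> + length (star \<mu>) + k)\<close>; then the sizes have the
  required sum. That it lies in \<open>DP n\<close> comes from the tested profiles for small
  \<open>n\<close> and from \<open>delta_elem_large\<close> otherwise.\<close>

lemma reflected:
  assumes \<mu>: "\<mu> \<in> Par k" and \<gamma>: "\<gamma> \<in> chain \<mu> \<inter> DP n"
  shows "\<exists>\<delta>\<in>chain (star \<mu>) \<inter> DP n. sum_list \<gamma> + sum_list \<delta> = (n choose 2) + k"
proof (cases "n < max (zeta \<mu> + 2) (zeta (star \<mu>) + 2)")
  case True
  note \<mu>' = star_Par[OF \<mu>]
  define m where "m = Suc (n choose 2) - (length \<mu> + length (star \<mu>) + k)"
  have refl: "profile n m (map delta (elems \<mu>)) = rev (profile n m (map delta (elems (star \<mu>))))"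
    and beyond: "\<forall>d\<in>set (drop m (map delta (elems \<mu>))). n < d"
    using reflection[OF \<mu> True m_def] unfolding elems_def by blast+
  obtain p where p: "\<gamma> = elem \<mu> p"
    using \<gamma> unfolding chain_eq_range[OF \<mu>] by blast
  have delta_p: "delta (elem \<mu> p) \<le> n"
    using \<gamma> by (simp add: p DP_iff)
  have "p < m"
  proof (cases "p < length (elems \<mu>)")
    case True
    show ?thesis
    proof (rule ccontr)
      assume "\<not> p < m"
      then have "delta (elem \<mu> p) \<in> set (drop m (map delta (elems \<mu>)))"
        using True by (auto simp: elem_def in_set_conv_nth intro!: exI[of _ "p - m"])
      then show False
        using beyond delta_p by auto
    qed
  next
    case False
    then show ?thesis
      using delta_tail_elem[OF \<mu>, of p n] delta_p sum_list_elem[OF \<mu>, of p] by (simp add: m_def)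
  qed
  define q where "q = m - Suc p"
  have q: "q < m"
    using \<open>p < m\<close> by (simp add: q_def)
  have "profile n m (map delta (elems \<mu>)) ! p"
    using \<open>p < m\<close> delta_p by (auto simp: profile_nth elem_def split: if_splits)
  then have "profile n m (map delta (elems (star \<mu>))) ! q"
    using \<open>p < m\<close> by (simp add: refl rev_nth q_def)
  then have "delta (elem (star \<mu>) q) \<le> n"
  proof (cases "q < length (elems (star \<mu>))")
    case True
    then show ?thesis
      using \<open>profile n m (map delta (elems (star \<mu>))) ! q\<close> q by (simp add: profile_nth elem_def)
  next
    case False
    then show ?thesis
      using delta_tail_elem[OF \<mu>', of q n] sum_list_elem[OF \<mu>', of q] q star_star[OF \<mu>] by (simp add: m_def)
  qed
  then have "elem (star \<mu>) q \<in> chain (star \<mu>) \<inter> DP n"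
    using chain_in_DP[OF \<mu>'] elem_in_chain[OF \<mu>'] by blast
  moreover have "sum_list \<gamma> + sum_list (elem (star \<mu>) q) = (n choose 2) + k"
    unfolding p sum_list_elem[OF \<mu>] sum_list_elem[OF \<mu>'] star_star[OF \<mu>]
    using \<open>p < m\<close> by (simp add: q_def m_def)
  ultimately show ?thesis
    by blast
next
  case False
  note \<mu>' = star_Par[OF \<mu>]
  obtain p where p: "\<gamma> = elem \<mu> p"
    using \<gamma> unfolding chain_eq_range[OF \<mu>] by blast
  have le: "length (star \<mu>) + k + p + length \<mu> \<le> n choose 2"
    using delta_elem_large[OF \<mu>, of n p] False \<gamma> by (simp add: DP_iff p not_less)
  define q where "q = (n choose 2) - (length (star \<mu>) + k + p + length \<mu>)"
  have "delta (elem (star \<mu>) q) \<le> n"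
    using delta_elem_large[OF \<mu>', of n q] False le unfolding star_star[OF \<mu>] q_def by linarith
  then have "elem (star \<mu>) q \<in> chain (star \<mu>) \<inter> DP n"
    using chain_in_DP[OF \<mu>'] elem_in_chain[OF \<mu>'] by blast
  moreover have "sum_list \<gamma> + sum_list (elem (star \<mu>) q) = (n choose 2) + k"
    unfolding p sum_list_elem[OF \<mu>] sum_list_elem[OF \<mu>'] star_star[OF \<mu>] using le by (simp add: q_def)
  ultimately show ?thesis
    by blast
qed

lemma chain_opposite:
  assumes "\<mu> \<in> Par k"
  shows "opposite n (chain \<mu> \<inter> DP n) (chain (star \<mu>) \<inter> DP n)"
proof (rule opposite_if_reflected)
  note \<mu>' = star_Par[OF assms]
  show "chain \<mu> \<inter> DP n \<subseteq> DP n \<inter> DP_deficit k" "chain (star \<mu>) \<inter> DP n \<subseteq> DP n \<inter> DP_deficit k"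
    using chain_subset[OF assms] chain_subset[OF \<mu>'] by blast+
  show "inj_on sum_list (chain \<mu> \<inter> DP n)" "inj_on sum_list (chain (star \<mu>) \<inter> DP n)"
    by (rule inj_on_subset[OF inj_on_sum_list[OF assms]] inj_on_subset[OF inj_on_sum_list[OF \<mu>']]; blast)+
  show "\<exists>\<delta>\<in>chain (star \<mu>) \<inter> DP n. sum_list \<gamma> + sum_list \<delta> = (n choose 2) + k"
    if "\<gamma> \<in> chain \<mu> \<inter> DP n" for \<gamma>
    using reflected[OF assms that] .
  show "\<exists>\<gamma>\<in>chain \<mu> \<inter> DP n. sum_list \<gamma> + sum_list \<delta> = (n choose 2) + k"
    if "\<delta> \<in> chain (star \<mu>) \<inter> DP n" for \<delta>
    using reflected[OF \<mu>' that] unfolding star_star[OF assms] by (metis add.commute)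
qed

lemma chain_interval:
  assumes \<mu>: "\<mu> \<in> Par k" and n: "max (zeta \<mu> + 2) (zeta (star \<mu>) + 2) \<le> n"
  shows "int (length (star \<mu>)) \<le> i \<and> i \<le> int (n choose 2) - int k - int (length \<mu>) \<longleftrightarrow>
    (\<exists>\<gamma>. \<gamma> \<in> chain \<mu> \<and> Delta \<gamma> \<le> n \<and> int (dinv \<gamma>) = i)" (is "?L \<longleftrightarrow> ?R")
proof
  assume L: ?L
  define p where "p = nat i - length (star \<mu>)"
  have "length (star \<mu>) \<le> nat i" "0 \<le> i"
    using L by linarith+
  then have p: "int (length (star \<mu>) + p) = i"
    by (simp add: p_def)
  then have "Delta (elem \<mu> p) \<le> n"
    using delta_elem_large[OF \<mu> n, of p] L by (simp add: Delta_eq_delta elem_partition \<mu>)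
  then show ?R
    using p elem_in_chain[OF \<mu>, of p] dinv_elem[OF \<mu>, of p] by auto
next
  assume ?R
  then obtain p where "Delta (elem \<mu> p) \<le> n" "int (dinv (elem \<mu> p)) = i"
    by (auto simp: chain_eq_range[OF \<mu>])
  then show ?L
    using delta_elem_large[OF \<mu> n, of p] by (auto simp: Delta_eq_delta elem_partition \<mu> dinv_elem)
qed

text \<open>If \<open>\<alpha>\<close> is neither a row nor a column, the partition is initial,
  hence one of the tested starts. Rows and columns are exchanged by conjugation and give deficit 0,
  where there is a single chain.\<close>

lemma dp_dyck_conjugate:
  assumes \<mu>: "\<mu> \<in> Par k" and \<alpha>: "\<alpha> \<in> Par n" and mem: "dp n (dyck \<alpha>) \<in> chain \<mu>"
  shows "dp n (dyck (conjugate \<alpha>)) \<in> chain (star \<mu>)"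
proof (cases "2 \<le> part \<alpha> 1 \<and> 2 \<le> length \<alpha>")
  case True
  let ?\<gamma> = "dp n (dyck \<alpha>)"
  have \<gamma>: "is_partition ?\<gamma>" "deficit ?\<gamma> = int k"
    using chain_subset[OF \<mu>] mem by (auto simp: DP_deficit_def)
  have first: "part ?\<gamma> 1 < length ?\<gamma>"
    using dp_dyck_shape[OF \<alpha>] True by simp
  then have "initial ?\<gamma>"
    by (simp add: initial_def)
  then have "?\<gamma> \<in> set (starts \<mu> @ [gamma_mu \<mu>])"
    using mem initial_in_orbit unfolding chain_def by blast
  moreover have "n \<le> k + 2"
    using length_le_deficit[OF \<gamma>(1) first] dp_dyck_shape[OF \<alpha>] True \<gamma>(2) by simp
  ultimately have "dp n (dyck (conjugate \<alpha>)) \<in> set (starts (star \<mu>) @ [gamma_mu (star \<mu>)])"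
    using conj_starts[OF \<mu> _ \<alpha>] True by blast
  then show ?thesis
    unfolding chain_def using orbit_self by blast
next
  case False
  let ?T = "{replicate n 1, if n = 0 then [] else [n]}"
  have "\<alpha> \<in> ?T \<and> conjugate \<alpha> \<in> ?T"
  proof (cases "part \<alpha> 1 < 2")
    case True
    then show ?thesis
      using column_if_part_le_1[OF \<alpha>] conjugate_column by simp
  next
    case 2: False
    then have eq: "\<alpha> = (if n = 0 then [] else [n])"
      using False row_if_length_le_1[OF \<alpha>] by simp
    then have "n \<noteq> 0"
      using 2 by (intro notI) simp
    then show ?thesis
      using eq conjugate_row by simp
  qed
  moreover have "\<forall>\<beta>\<in>?T. dp n (dyck \<beta>) \<in> DP_deficit 0"
    using dp_dyck_row[of n] dp_dyck_column[of n] by blast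
  ultimately have mem0: "dp n (dyck \<alpha>) \<in> DP_deficit 0" "dp n (dyck (conjugate \<alpha>)) \<in> DP_deficit 0"
    by blast+
  then have k: "k = 0"
    using chain_subset[OF \<mu>] mem by (auto simp: DP_deficit_def)
  then obtain \<kappa> where \<kappa>: "\<kappa> \<in> Par k" "dp n (dyck (conjugate \<alpha>)) \<in> chain \<kappa>"
    using DP_deficit_eq mem0(2) by blast
  have "Par 0 = {[]}"
    by (auto simp: Par_def is_partition_def) (metis last_in_set less_numeral_extra(3))
  then have "\<kappa> = star \<mu>"
    using \<kappa>(1) star_Par[OF \<mu>] k by simp
  then show ?thesis
    using \<kappa>(2) by simp
qed

text \<open>The position at which block \<open>q\<close> begins. After the last block every tail
  member forms a block of its own, which the truncated difference counts.\<close>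

definition block_pos :: "nat list \<Rightarrow> nat \<Rightarrow> nat" where
  "block_pos \<mu> q = length (concat (take q (chain_blocks \<mu>))) + (q - length (chain_blocks \<mu>))"

lemma concat_chain_blocks: "concat (chain_blocks \<mu>) = elems \<mu>"
proof -
  have "concat (concat (map (\<lambda>x. blocks (fragment fuel x)) xs)) = concat (map (fragment fuel) xs)" for xs
    by (induction xs) auto
  then show ?thesis
    by (simp add: chain_blocks_def elems_def)
qed

lemma chain_block:
  assumes "\<mu> \<in> Par k" "b \<in> set (chain_blocks \<mu>)"
  shows "b \<noteq> []" "set b \<subseteq> R_set (hd b)"
proof -
  obtain \<gamma> where \<gamma>: "\<gamma> \<in> set (starts \<mu>)" "b \<in> set (blocks (fragment fuel \<gamma>))"
    using assms(2) by (auto simp: chain_blocks_def)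
  have "\<forall>x\<in>set (fragment fuel \<gamma>). is_partition x"
    using set_fragment[OF fragment_ends[OF assms(1) \<gamma>(1)]] starts[OF assms(1), of \<gamma>] \<gamma>(1) is_partition_nu_pow
    by (auto simp: orbit_def)
  then show "b \<noteq> []" "set b \<subseteq> R_set (hd b)"
    using blocks_in_R_set[OF path_fragment _ \<gamma>(2)] by auto
qed

lemma block_pos_Suc:
  assumes "\<mu> \<in> Par k"
  shows "block_pos \<mu> q < block_pos \<mu> (Suc q)"
proof (cases "q < length (chain_blocks \<mu>)")
  case True
  then have "chain_blocks \<mu> ! q \<noteq> []"
    using chain_block(1)[OF assms] by simp
  then show ?thesis
    using True by (simp add: block_pos_def take_Suc_conv_app_nth)
qed (simp add: block_pos_def)

lemma elem_block_pos:
  assumes "\<mu> \<in> Par k" "q < length (chain_blocks \<mu>)"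
  shows "elem \<mu> (block_pos \<mu> q) = hd (chain_blocks \<mu> ! q)"
proof -
  let ?B = "chain_blocks \<mu>"
  have ne: "?B ! q \<noteq> []"
    using chain_block(1)[OF assms(1)] assms(2) by simp
  have "elems \<mu> = concat (take q ?B) @ ?B ! q @ concat (drop (Suc q) ?B)"
    using arg_cong[OF id_take_nth_drop[OF assms(2)], of concat] by (simp add: concat_chain_blocks)
  then show ?thesis
    using ne assms(2) by (simp add: elem_def block_pos_def nth_append hd_conv_nth)
qed

lemma block_pos_tail:
  "block_pos \<mu> (length (chain_blocks \<mu>) + m) = length (elems \<mu>) + m"
  by (simp add: block_pos_def concat_chain_blocks)

lemma R_set_subset:
  assumes "\<gamma> \<in> chain \<mu>"
  shows "R_set \<gamma> \<subseteq> chain \<mu>"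
proof -
  have "nu_pow m \<gamma> = Some \<delta> \<Longrightarrow> \<delta> \<in> chain \<mu>" for m \<delta>
    using assms by (induction m arbitrary: \<delta>) (auto simp: bind_eq_Some_conv intro: chain_closed)
  then show ?thesis
    by (auto simp: R_set_def)
qed

lemma chain_eq_R_sets:
  assumes "\<mu> \<in> Par k"
  shows "chain \<mu> = (\<Union>q. R_set (elem \<mu> (block_pos \<mu> q)))"
proof
  show "(\<Union>q. R_set (elem \<mu> (block_pos \<mu> q))) \<subseteq> chain \<mu>"
    using R_set_subset elem_in_chain[OF assms] by blast
  show "chain \<mu> \<subseteq> (\<Union>q. R_set (elem \<mu> (block_pos \<mu> q)))"
  proof
    fix \<gamma>
    assume "\<gamma> \<in> chain \<mu>"
    then obtain p where p: "\<gamma> = elem \<mu> p"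
      using chain_eq_range[OF assms] by blast
    show "\<gamma> \<in> (\<Union>q. R_set (elem \<mu> (block_pos \<mu> q)))"
    proof (cases "p < length (elems \<mu>)")
      case True
      then have "\<gamma> \<in> set (concat (chain_blocks \<mu>))"
        by (simp add: p elem_def concat_chain_blocks)
      then obtain b where "b \<in> set (chain_blocks \<mu>)" "\<gamma> \<in> set b"
        by auto
      moreover from this obtain q where "q < length (chain_blocks \<mu>)" "b = chain_blocks \<mu> ! q"
        by (auto simp: in_set_conv_nth)
      ultimately show ?thesis
        using chain_block(2)[OF assms, of b] elem_block_pos[OF assms, of q] by (intro UN_I[of q]) auto
    next
      case False
      then have "block_pos \<mu> (length (chain_blocks \<mu>) + (p - length (elems \<mu>))) = p"
        unfolding block_pos_tail by simp
      moreover have "\<gamma> \<in> R_set \<gamma>"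
        by (auto simp: R_set_def intro: exI[of _ 0])
      ultimately show ?thesis
        using p by (intro UN_I[of "length (chain_blocks \<mu>) + (p - length (elems \<mu>))"]) auto
    qed
  qed
qed

text \<open>Along the tail \<open>delta\<close> is weakly increasing by \<open>delta_nu\<close>, so
  a valley among the block heads up to and including \<open>gamma_mu \<mu>\<close> extends to the
  whole chain.\<close>

lemma delta_valley:
  assumes "\<mu> \<in> Par k"
  shows "\<exists>c. (\<forall>q<c. delta (elem \<mu> (block_pos \<mu> (Suc q))) \<le> delta (elem \<mu> (block_pos \<mu> q))) \<and>
    (\<forall>q\<ge>c. delta (elem \<mu> (block_pos \<mu> q)) \<le> delta (elem \<mu> (block_pos \<mu> (Suc q))))"
proof -
  let ?l = "length (chain_blocks \<mu>)"
  define V where "V = map (\<lambda>b. delta (hd b)) (chain_blocks \<mu>) @ [delta (gamma_mu \<mu>)]"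
  have "elem \<mu> (block_pos \<mu> ?l) = gamma_mu \<mu>"
    using block_pos_tail[of \<mu> 0] tail_elem[OF assms, of 0] by simp
  then have V: "V ! q = delta (elem \<mu> (block_pos \<mu> q))" if "q \<le> ?l" for q
    using that elem_block_pos[OF assms, of q] by (cases "q = ?l") (auto simp: V_def nth_append)
  have "valley V" "V \<noteq> []" "length V = Suc ?l"
    using valley[OF assms] by (auto simp: V_def chain_blocks_def)
  then obtain c where c: "c < Suc ?l" "\<And>q. q < c \<Longrightarrow> V ! Suc q \<le> V ! q"
    "\<And>q. c \<le> q \<Longrightarrow> Suc q < Suc ?l \<Longrightarrow> V ! q \<le> V ! Suc q"
    using valley_bottom[of V] by auto
  have "delta (elem \<mu> (block_pos \<mu> (Suc q))) \<le> delta (elem \<mu> (block_pos \<mu> q))" if "q < c" for q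
    using c(1) c(2)[OF that] that V[of q] V[of "Suc q"] by simp
  moreover have "delta (elem \<mu> (block_pos \<mu> q)) \<le> delta (elem \<mu> (block_pos \<mu> (Suc q)))" if "c \<le> q" for q
  proof (cases "q < ?l")
    case True
    then show ?thesis
      using c(3)[OF that] V[of q] V[of "Suc q"] by simp
  next
    case False
    define m where "m = q - ?l"
    have "nu (elem \<mu> (length (elems \<mu>) + m)) = Some (elem \<mu> (length (elems \<mu>) + Suc m))"
      using tail_elem[OF assms, of m] tail_elem[OF assms, of "Suc m"] by simp
    then show ?thesis
      using delta_nu(2)[OF elem_partition[OF assms]] False
        block_pos_tail[of \<mu> m] block_pos_tail[of \<mu> "Suc m"] by (simp add: m_def)
  qed
  ultimately show ?thesis
    by blast
qed

lemma chain_R_sets: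
  assumes \<mu>: "\<mu> \<in> Par k"
  shows "\<exists>idx :: nat \<Rightarrow> nat. strict_mono_on {1..} idx \<and> (\<forall>j\<ge>1. length (star \<mu>) \<le> idx j) \<and>
    chain \<mu> = (\<Union>j\<in>{1..}. R_set (chain_elem (chain \<mu>) (idx j))) \<and>
    (\<exists>t\<ge>1. antimono_on {1..t} (\<lambda>j. Delta (chain_elem (chain \<mu>) (idx j))) \<and>
      mono_on {t..} (\<lambda>j. Delta (chain_elem (chain \<mu>) (idx j))))"
proof -
  \<comment> \<open>Adding \<open>length (star \<mu>)\<close> turns positions into values of dinv;
    the shift by one is due to \<open>j\<close> starting at 1.\<close>
  define idx where "idx j = length (star \<mu>) + block_pos \<mu> (j - 1)" for j
  have idx: "chain_elem (chain \<mu>) (idx j) = elem \<mu> (block_pos \<mu> (j - 1))" for j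
    by (simp add: idx_def chain_elem_eq[OF \<mu>])
  define D where "D q = delta (elem \<mu> (block_pos \<mu> q))" for q
  have Delta: "Delta (chain_elem (chain \<mu>) (idx j)) = D (j - 1)" for j
    by (simp add: idx Delta_eq_delta elem_partition \<mu> D_def)
  obtain c where c: "\<And>q. q < c \<Longrightarrow> D (Suc q) \<le> D q" "\<And>q. c \<le> q \<Longrightarrow> D q \<le> D (Suc q)"
    using delta_valley[OF \<mu>] unfolding D_def by blast
  have down: "D j \<le> D i" if "i \<le> j" "j \<le> c" for i j
    using that
  proof (induction j rule: dec_induct)
    case (step n)
    then show ?case
      using c(1)[of n] by simp
  qed simp
  have up: "D i \<le> D j" if "i \<le> j" "c \<le> i" for i j
    using that
  proof (induction j rule: dec_induct)
    case (step n)
    then show ?case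
      using c(2)[of n] by simp
  qed simp
  have "strict_mono (block_pos \<mu>)"
    using block_pos_Suc[OF \<mu>] by (simp add: strict_mono_Suc_iff)
  then have "strict_mono_on {1..} idx"
    by (auto intro!: strict_mono_onI simp: idx_def strict_mono_less)
  moreover have "chain \<mu> = (\<Union>j\<in>{1..}. R_set (chain_elem (chain \<mu>) (idx j)))"
  proof -
    have "(\<Union>j\<in>{1..}. R_set (chain_elem (chain \<mu>) (idx j))) =
        (\<Union>q\<in>(\<lambda>j. j - 1) ` {1..}. R_set (elem \<mu> (block_pos \<mu> q)))"
      by (simp add: idx)
    also have "(\<lambda>j::nat. j - 1) ` {1..} = UNIV"
    proof -
      have "q \<in> (\<lambda>j. j - 1) ` {1..}" for q :: nat
        by (rule image_eqI[of _ _ "Suc q"]) auto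
      then show ?thesis
        by blast
    qed
    finally show ?thesis
      using chain_eq_R_sets[OF \<mu>] by simp
  qed
  moreover have "antimono_on {1..Suc c} (\<lambda>j. Delta (chain_elem (chain \<mu>) (idx j)))"
    unfolding Delta by (intro monotone_onI) (auto intro!: down)
  moreover have "mono_on {Suc c..} (\<lambda>j. Delta (chain_elem (chain \<mu>) (idx j)))"
    unfolding Delta by (intro monotone_onI) (auto intro!: up)
  ultimately show ?thesis
    by (intro exI[of _ idx] conjI exI[of _ "Suc c"]) (auto simp: idx_def)
qed

lemma chain_decomposition:
  "\<exists>(C :: nat list \<Rightarrow> nat list set) (Cbar :: nat list \<Rightarrow> nat list set) (star :: nat list \<Rightarrow> nat list).
    disjoint_family_on C (Par k) \<and> disjoint_family_on Cbar (Par k) \<and>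
    DP_deficit k = (\<Union>\<mu>\<in>Par k. C \<mu>) \<and> DP_deficit k = (\<Union>\<mu>\<in>Par k. Cbar \<mu>) \<and>
    (\<forall>\<mu>\<in>Par k. \<forall>m. \<exists>\<delta>. nu_pow m (gamma_mu \<mu>) = Some \<delta> \<and> \<delta> \<in> C \<mu>) \<and>
    (\<forall>\<mu>\<in>Par k. star \<mu> \<in> Par k \<and> C \<mu> = Cbar (star \<mu>) \<and> C (star \<mu>) = Cbar \<mu> \<and>
       (\<forall>\<kappa>\<in>Par k. C \<mu> = Cbar \<kappa> \<and> C \<kappa> = Cbar \<mu> \<longrightarrow> \<kappa> = star \<mu>)) \<and>
    (\<forall>\<mu>\<in>Par k.
       (\<forall>i\<ge>length (star \<mu>). \<exists>!\<gamma>. \<gamma> \<in> C \<mu> \<and> dinv \<gamma> = i) \<and>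
       (\<exists>idx :: nat \<Rightarrow> nat.
          strict_mono_on {1..} idx \<and>
          (\<forall>j\<ge>1. length (star \<mu>) \<le> idx j) \<and>
          C \<mu> = (\<Union>j\<in>{1..}. R_set (chain_elem (C \<mu>) (idx j))) \<and>
          (\<exists>t\<ge>1. antimono_on {1..t} (\<lambda>j. Delta (chain_elem (C \<mu>) (idx j))) \<and>
                  mono_on {t..} (\<lambda>j. Delta (chain_elem (C \<mu>) (idx j)))))) \<and>
    (\<forall>\<mu>\<in>Par k. \<forall>n\<ge>max (zeta \<mu> + 2) (zeta (star \<mu>) + 2). \<forall>i::int.
       (int (length (star \<mu>)) \<le> i \<and> i \<le> int (n choose 2) - int k - int (length \<mu>) \<longleftrightarrow>
          (\<exists>\<gamma>. \<gamma> \<in> C \<mu> \<and> Delta \<gamma> \<le> n \<and> int (dinv \<gamma>) = i)) \<and>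
       (\<exists>\<^sub>\<le>\<^sub>1\<gamma>. \<gamma> \<in> C \<mu> \<and> Delta \<gamma> \<le> n \<and> int (dinv \<gamma>) = i)) \<and>
    (\<forall>\<mu>\<in>Par k. \<forall>\<gamma>\<in>C \<mu>. \<forall>\<delta>. nu \<gamma> = Some \<delta> \<longrightarrow> \<delta> \<in> C \<mu>) \<and>
    (\<forall>\<mu>\<in>Par k. \<forall>n. \<forall>\<alpha>\<in>Par n. dp n (dyck \<alpha>) \<in> C \<mu> \<longrightarrow> dp n (dyck (conjugate \<alpha>)) \<in> Cbar \<mu>) \<and>
    (\<forall>\<mu>\<in>Par k. \<forall>n. opposite n (C \<mu> \<inter> DP n) (Cbar \<mu> \<inter> DP n))"
proof (rule exI[of _ chain], rule exI[of _ "\<lambda>\<mu>. chain (star \<mu>)"], rule exI[of _ star],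
    intro conjI ballI allI impI)
  show "disjoint_family_on chain (Par k)"
    unfolding disjoint_family_on_def using chain_disjoint by blast
  show "disjoint_family_on (\<lambda>\<mu>. chain (star \<mu>)) (Par k)"
  proof -
    have "\<mu> = \<kappa>" if "\<mu> \<in> Par k" "\<kappa> \<in> Par k" "\<delta> \<in> chain (star \<mu>)" "\<delta> \<in> chain (star \<kappa>)" for \<mu> \<kappa> \<delta>
      using arg_cong[OF chain_disjoint[OF star_Par[OF that(1)] star_Par[OF that(2)] that(3,4)], of star]
      unfolding star_star[OF that(1)] star_star[OF that(2)] .
    then show ?thesis
      unfolding disjoint_family_on_def by blast
  qed
  show "DP_deficit k = (\<Union>\<mu>\<in>Par k. chain \<mu>)"
    by (rule DP_deficit_eq)
  show "DP_deficit k = (\<Union>\<mu>\<in>Par k. chain (star \<mu>))"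
  proof -
    have "star ` Par k = Par k"
    proof
      show "star ` Par k \<subseteq> Par k"
        using star_Par by blast
      show "Par k \<subseteq> star ` Par k"
        using star_Par star_star by (metis imageI subsetI)
    qed
    then have "DP_deficit k = (\<Union>\<mu>\<in>star ` Par k. chain \<mu>)"
      by (simp only: DP_deficit_eq)
    then show ?thesis
      by (simp only: image_image)
  qed
next
  fix \<mu> m
  assume \<mu>: "\<mu> \<in> Par k"
  show "\<exists>\<delta>. nu_pow m (gamma_mu \<mu>) = Some \<delta> \<and> \<delta> \<in> chain \<mu>"
    using tail_elem[OF \<mu>, of m] elem_in_chain[OF \<mu>, of "length (elems \<mu>) + m"] by simp
next
  fix \<mu>
  assume \<mu>: "\<mu> \<in> Par k"
  show "star \<mu> \<in> Par k"
    using star_Par[OF \<mu>] .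
  show "chain \<mu> = chain (star (star \<mu>))"
    unfolding star_star[OF \<mu>] ..
  show "chain (star \<mu>) = chain (star \<mu>)" ..
  \<comment> \<open>Uniqueness holds because chains are nonempty and distinct chains are disjoint:
    equal chains have equal indices.\<close>
  show "\<kappa> = star \<mu>" if "\<kappa> \<in> Par k" "chain \<mu> = chain (star \<kappa>) \<and> chain \<kappa> = chain (star \<mu>)" for \<kappa>
    using chain_disjoint[OF that(1) star_Par[OF \<mu>], of "elem \<kappa> 0"] elem_in_chain[OF that(1), of 0] that(2)
    by simp
  show "\<exists>!\<gamma>. \<gamma> \<in> chain \<mu> \<and> dinv \<gamma> = i" if "length (star \<mu>) \<le> i" for i
    using ex1_dinv[OF \<mu> that] .
  show "\<exists>idx :: nat \<Rightarrow> nat. strict_mono_on {1..} idx \<and> (\<forall>j\<ge>1. length (star \<mu>) \<le> idx j) \<and>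
    chain \<mu> = (\<Union>j\<in>{1..}. R_set (chain_elem (chain \<mu>) (idx j))) \<and>
    (\<exists>t\<ge>1. antimono_on {1..t} (\<lambda>j. Delta (chain_elem (chain \<mu>) (idx j))) \<and>
      mono_on {t..} (\<lambda>j. Delta (chain_elem (chain \<mu>) (idx j))))"
    using chain_R_sets[OF \<mu>] .
next
  fix \<mu> n and i :: int
  assume \<mu>: "\<mu> \<in> Par k" and n: "max (zeta \<mu> + 2) (zeta (star \<mu>) + 2) \<le> n"
  show "int (length (star \<mu>)) \<le> i \<and> i \<le> int (n choose 2) - int k - int (length \<mu>) \<longleftrightarrow>
    (\<exists>\<gamma>. \<gamma> \<in> chain \<mu> \<and> Delta \<gamma> \<le> n \<and> int (dinv \<gamma>) = i)"
    using chain_interval[OF \<mu> n] .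
  show "\<exists>\<^sub>\<le>\<^sub>1\<gamma>. \<gamma> \<in> chain \<mu> \<and> Delta \<gamma> \<le> n \<and> int (dinv \<gamma>) = i"
    unfolding chain_eq_range[OF \<mu>] by (rule Uniq_I) (auto simp: dinv_elem[OF \<mu>])
next
  fix \<mu> \<gamma> \<delta>
  assume "\<mu> \<in> Par k" "\<gamma> \<in> chain \<mu>" "nu \<gamma> = Some \<delta>"
  then show "\<delta> \<in> chain \<mu>"
    using chain_closed by blast
next
  fix \<mu> n \<alpha>
  assume "\<mu> \<in> Par k" "\<alpha> \<in> Par n" "dp n (dyck \<alpha>) \<in> chain \<mu>"
  then show "dp n (dyck (conjugate \<alpha>)) \<in> chain (star \<mu>)"
    by (rule dp_dyck_conjugate)
next
  fix \<mu> n
  assume "\<mu> \<in> Par k"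
  then show "opposite n (chain \<mu> \<inter> DP n) (chain (star \<mu>) \<inter> DP n)"
    by (rule chain_opposite)
qed

end

section \<open>Checking chain data by evaluation\<close>

fun pars :: "nat \<Rightarrow> nat \<Rightarrow> nat list list" where
  "pars m 0 = [[]]"
| "pars 0 (Suc n) = []"
| "pars (Suc m) (Suc n) =
     (if m \<le> n then map (\<lambda>\<gamma>. Suc m # \<gamma>) (pars (Suc m) (n - m)) else []) @ pars m (Suc n)"

lemma set_pars: "set (pars m n) = {\<gamma>. is_partition \<gamma> \<and> sum_list \<gamma> = n \<and> (\<forall>x\<in>set \<gamma>. x \<le> m)}"
proof (induction m n rule: pars.induct)
  case (1 m)
  have "\<gamma> = []" if "is_partition \<gamma>" "sum_list \<gamma> = 0" for \<gamma>
    using that by (cases \<gamma>) auto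
  then show ?case
    by auto
next
  case (2 n)
  have "\<not> (is_partition \<gamma> \<and> sum_list \<gamma> = Suc n \<and> (\<forall>x\<in>set \<gamma>. x \<le> 0))" for \<gamma>
    by (cases \<gamma>) auto
  then show ?case
    by auto
next
  case (3 m n)
  show ?case
  proof (intro set_eqI iffI)
    fix \<gamma>
    assume "\<gamma> \<in> set (pars (Suc m) (Suc n))"
    then show "\<gamma> \<in> {\<gamma>. is_partition \<gamma> \<and> sum_list \<gamma> = Suc n \<and> (\<forall>x\<in>set \<gamma>. x \<le> Suc m)}"
      using 3 by (auto split: if_splits simp: le_Suc_eq)
  next
    fix \<gamma>
    assume \<gamma>: "\<gamma> \<in> {\<gamma>. is_partition \<gamma> \<and> sum_list \<gamma> = Suc n \<and> (\<forall>x\<in>set \<gamma>. x \<le> Suc m)}"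
    then obtain r g where rg: "\<gamma> = r # g"
      by (cases \<gamma>) auto
    show "\<gamma> \<in> set (pars (Suc m) (Suc n))"
    proof (cases "r = Suc m")
      case True
      then have "m \<le> n" "g \<in> set (pars (Suc m) (n - m))"
        using \<gamma> rg 3(1) by auto
      then show ?thesis
        using rg True by simp
    next
      case False
      then have "\<gamma> \<in> set (pars m (Suc n))"
        using \<gamma> rg 3(2) by fastforce
      then show ?thesis
        by simp
    qed
  qed
qed

lemma Par_eq_pars: "Par k = set (pars k k)"
  using member_le_sum_list by (fastforce simp: Par_def set_pars)

fun tri :: "nat \<Rightarrow> nat" where
  "tri 0 = 0"
| "tri (Suc n) = n + tri n"

lemma tri_eq: "tri n = n choose 2"
  by (induction n) (auto simp: numeral_2_eq_2)

text \<open>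
  A group of chain data is a list of one or two pairs of a partition \<open>\<mu>\<close> with the initial
  partitions of the finite \<open>\<nu>\<close>-fragments of \<open>\<C>\<^sub>\<mu>\<close>; it has one element if \<open>\<mu>\<^sup>* = \<mu>\<close>, and
  otherwise one for each of \<open>\<mu>\<close> and \<open>\<mu>\<^sup>*\<close>.
\<close>

type_synonym group = "(nat list \<times> nat list list) list"

definition group_entries :: "group \<Rightarrow> (nat list \<times> nat list \<times> nat list list) list" where
  "group_entries G = (case G of
     [x] \<Rightarrow> [(fst x, fst x, snd x)]
   | [x, y] \<Rightarrow> [(fst x, fst y, snd x), (fst y, fst x, snd y)]
   | _ \<Rightarrow> [])"

definition entries :: "group list \<Rightarrow> (nat list \<times> nat list \<times> nat list list) list" where
  "entries D = concat (map group_entries D)"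

definition star_of :: "group list \<Rightarrow> nat list \<Rightarrow> nat list" where
  "star_of D \<mu> = fst (the (map_of (entries D) \<mu>))"

definition starts_of :: "group list \<Rightarrow> nat list \<Rightarrow> nat list list" where
  "starts_of D \<mu> = snd (the (map_of (entries D) \<mu>))"

text \<open>
  The simplifier evaluates both arguments of a conjunction or an implication, but only the chosen
  branch of a conditional; hence the nested conditionals in the checks below.
\<close>

fun eq_exec :: "nat list \<Rightarrow> nat list \<Rightarrow> bool" where
  "eq_exec [] [] = True"
| "eq_exec (x # xs) (y # ys) = (if x = y then eq_exec xs ys else False)"
| "eq_exec _ _ = False"

fun member_exec :: "nat list \<Rightarrow> nat list list \<Rightarrow> bool" where
  "member_exec x [] = False"
| "member_exec x (y # ys) = (if eq_exec x y then True else member_exec x ys)"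

fun distinct_exec :: "nat list list \<Rightarrow> bool" where
  "distinct_exec [] = True"
| "distinct_exec (x # xs) = (if member_exec x xs then False else distinct_exec xs)"

lemma eq_exec_iff: "eq_exec xs ys \<longleftrightarrow> xs = ys"
  by (induction xs ys rule: eq_exec.induct) auto

lemma member_exec_iff: "member_exec x xs \<longleftrightarrow> x \<in> set xs"
  by (induction xs) (auto simp: eq_exec_iff)

lemma distinct_exec_iff: "distinct_exec xs \<longleftrightarrow> distinct xs"
  by (induction xs) (auto simp: member_exec_iff)

fun even_exec :: "nat \<Rightarrow> bool" where
  "even_exec 0 = True"
| "even_exec (Suc n) = (if even_exec n then False else True)"

text \<open>Splitting by the parities of the parts with the given indices keeps the lists short.\<close>

fun distinct_split :: "nat list \<Rightarrow> nat list list \<Rightarrow> bool" where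
  "distinct_split [] xs = distinct_exec xs"
| "distinct_split (i # ps) xs \<longleftrightarrow> distinct_split ps (filter (\<lambda>\<gamma>. even_exec (part \<gamma> i)) xs) \<and>
     distinct_split ps (filter (\<lambda>\<gamma>. \<not> even_exec (part \<gamma> i)) xs)"

lemma distinct_if_distinct_filter:
  "distinct (filter P xs) \<Longrightarrow> distinct (filter (\<lambda>x. \<not> P x) xs) \<Longrightarrow> distinct xs"
  by (induction xs) (auto split: if_splits)

lemma distinct_if_distinct_split: "distinct_split ps xs \<Longrightarrow> distinct xs"
  by (induction ps arbitrary: xs) (auto simp: distinct_exec_iff intro: distinct_if_distinct_filter)

definition keys_check :: "nat list list \<Rightarrow> nat list list \<Rightarrow> bool" where
  "keys_check K P \<longleftrightarrow> distinct_exec K \<and> list_all (\<lambda>\<mu>. member_exec \<mu> P) K \<and> list_all (\<lambda>\<mu>. member_exec \<mu> K) P"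

definition starts_check :: "nat \<Rightarrow> nat list list \<Rightarrow> bool" where
  "starts_check k S \<longleftrightarrow> distinct_split [1, 2, 3, 4] S \<and>
     list_all (\<lambda>\<gamma>. is_partition \<gamma> \<and> defect \<gamma> = k \<and> initial \<gamma>) S \<and>
     length (filter (\<lambda>\<gamma>. \<gamma> \<noteq> []) S) = length (initials k (Suc k) k [] [])"

definition sizes_check :: "nat \<Rightarrow> nat \<Rightarrow> nat list list list \<Rightarrow> nat \<Rightarrow> bool" where
  "sizes_check k l os a \<longleftrightarrow> l + k \<le> a \<and> list_all (\<lambda>xs. nu (last xs) = None) os \<and>
     map sum_list (concat os) = [l + k..<a]"

definition delta_check :: "nat list list list \<Rightarrow> nat \<Rightarrow> nat \<Rightarrow> bool" where
  "delta_check os d b \<longleftrightarrow>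
     valley (map (\<lambda>b. delta (hd b)) (concat (map blocks os)) @ [d]) \<and>
     list_all (\<lambda>\<gamma>. delta \<gamma> \<le> b) (concat os)"

definition profile_check :: "nat \<Rightarrow> nat \<Rightarrow> nat list \<Rightarrow> nat list \<Rightarrow> bool" where
  "profile_check n m ds ds' \<longleftrightarrow>
     profile n m ds = rev (profile n m ds') \<and> list_all (\<lambda>d. n < d) (drop m ds)"

definition profiles_check :: "nat \<Rightarrow> nat \<Rightarrow> nat list \<Rightarrow> nat list \<Rightarrow> bool" where
  "profiles_check N l ds ds' \<longleftrightarrow> list_all (\<lambda>n. profile_check n (Suc (tri n) - l) ds ds') [0..<N]"

definition pair_check ::
  "nat \<Rightarrow> nat \<Rightarrow> nat list \<times> nat list list \<Rightarrow> nat list \<times> nat list list \<Rightarrow> bool" where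
  "pair_check fuel k x y \<longleftrightarrow>
     sizes_check k (length (fst y)) (map (fragment fuel) (snd x)) (sum_list (gamma_mu (fst x))) \<and>
     delta_check (map (fragment fuel) (snd x)) (delta (gamma_mu (fst x)))
       (max (zeta (fst x) + 2) (zeta (fst y) + 2)) \<and>
     profiles_check (max (zeta (fst x) + 2) (zeta (fst y) + 2)) (length (fst x) + length (fst y) + k)
       (map delta (concat (map (fragment fuel) (snd x)))) (map delta (concat (map (fragment fuel) (snd y))))"

definition group_check :: "nat \<Rightarrow> nat \<Rightarrow> group \<Rightarrow> bool" where
  "group_check fuel k G \<longleftrightarrow> (case G of
     [x] \<Rightarrow> pair_check fuel k x x
   | [x, y] \<Rightarrow> pair_check fuel k x y \<and> pair_check fuel k y x
   | _ \<Rightarrow> False)"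

definition conjugate_exec :: "nat list \<Rightarrow> nat list" where
  "conjugate_exec \<alpha> = map (col \<alpha>) [1..<Suc (part \<alpha> 1)]"

definition conjugate_pair :: "nat \<Rightarrow> nat \<Rightarrow> nat list \<Rightarrow> (nat list \<times> nat list) list" where
  "conjugate_pair k n \<alpha> =
     (if 2 \<le> part \<alpha> 1 then if 2 \<le> length \<alpha> then if defect (dp n (dyck \<alpha>)) = k
      then [(dp n (dyck \<alpha>), dp n (dyck (conjugate_exec \<alpha>)))] else [] else [] else [])"

definition conjugate_pairs :: "nat \<Rightarrow> (nat list \<times> nat list) list" where
  "conjugate_pairs k = concat (map (\<lambda>n. concat (map (conjugate_pair k n) (pars n n))) [0..<k + 3])"

lemma in_conjugate_pairs:
  "n < k + 3 \<Longrightarrow> \<alpha> \<in> set (pars n n) \<Longrightarrow> x \<in> set (conjugate_pair k n \<alpha>) \<Longrightarrow> x \<in> set (conjugate_pairs k)"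
  unfolding conjugate_pairs_def set_concat set_map set_upt by fastforce

definition conjugate_pairs_check ::
  "(nat list \<times> nat list) list \<Rightarrow> nat list list \<Rightarrow> nat list list \<Rightarrow> bool" where
  "conjugate_pairs_check Q S T \<longleftrightarrow>
     list_all (\<lambda>q. if member_exec (fst q) S then member_exec (snd q) T else True) Q"

lemma conjugate_pairs_checkD:
  assumes "conjugate_pairs_check Q S T" "(a, b) \<in> set Q" "a \<in> set S"
  shows "b \<in> set T"
  using bspec[OF assms(1)[unfolded conjugate_pairs_check_def list_all_iff] assms(2)] assms(3)
  by (simp add: member_exec_iff)

definition all_starts :: "nat list \<times> nat list list \<Rightarrow> nat list list" where
  "all_starts x = snd x @ [gamma_mu (fst x)]"

definition conjugate_check :: "(nat list \<times> nat list) list \<Rightarrow> group \<Rightarrow> bool" where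
  "conjugate_check Q G \<longleftrightarrow> (case G of
     [x] \<Rightarrow> conjugate_pairs_check Q (all_starts x) (all_starts x)
   | [x, y] \<Rightarrow> conjugate_pairs_check Q (all_starts x) (all_starts y) \<and>
       conjugate_pairs_check Q (all_starts y) (all_starts x)
   | _ \<Rightarrow> False)"

lemma distinct_concat_mapD:
  "distinct (concat (map f xs)) \<Longrightarrow> a \<in> set xs \<Longrightarrow> b \<in> set xs \<Longrightarrow> x \<in> set (f a) \<Longrightarrow> x \<in> set (f b) \<Longrightarrow> a = b"
  by (induction xs) auto

lemma group_cases:
  assumes "group_check fuel k G"
  obtains x where "G = [x]" | x y where "G = [x, y]"
  using assms by (auto simp: group_check_def split: list.splits)

lemma map_fst_entries:
  "list_all (group_check fuel k) D \<Longrightarrow> map fst (entries D) = map fst (concat D)"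
proof (induction D)
  case (Cons G D)
  from Cons.prems have "group_check fuel k G"
    by simp
  then show ?case
    using Cons by (cases rule: group_cases) (auto simp: entries_def group_entries_def)
qed (simp add: entries_def)

text \<open>Gathers what the checks yield for \<open>\<mu>\<close> together with its partner; in a
  group of one element the partner is the entry itself.\<close>

lemma entry_partner:
  assumes groups: "list_all (group_check fuel k) D" and conj: "list_all (conjugate_check Q) D"
    and e: "(\<mu>, \<kappa>, gs) \<in> set (entries D)"
  obtains hs where "(\<kappa>, \<mu>, hs) \<in> set (entries D)" "pair_check fuel k (\<mu>, gs) (\<kappa>, hs)"
    "conjugate_pairs_check Q (all_starts (\<mu>, gs)) (all_starts (\<kappa>, hs))"
    "(\<mu>, gs) \<in> set (concat D)"
proof -
  obtain G where G: "G \<in> set D" "(\<mu>, \<kappa>, gs) \<in> set (group_entries G)"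
    using e by (auto simp: entries_def)
  have sub: "set (group_entries G) \<subseteq> set (entries D)" "set G \<subseteq> set (concat D)"
    using G(1) by (auto simp: entries_def)
  have check: "group_check fuel k G" "conjugate_check Q G"
    using groups conj G(1) by (auto simp: list_all_iff)
  from check(1) show ?thesis
  proof (cases rule: group_cases)
    case (1 x)
    then show ?thesis
      using that[of gs] G sub check by (cases x) (auto simp: group_entries_def group_check_def conjugate_check_def simp del: set_concat)
  next
    case (2 x y)
    obtain a as b bs where xy: "x = (a, as)" "y = (b, bs)"
      by (cases x; cases y)
    from G(2) consider "\<mu> = a" "\<kappa> = b" "gs = as" | "\<mu> = b" "\<kappa> = a" "gs = bs"
      by (auto simp: 2 xy group_entries_def)
    then show ?thesis
      using that[of bs] that[of as] G(1) sub check
      by cases (auto simp: 2 xy group_entries_def group_check_def conjugate_check_def simp del: set_concat)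
  qed
qed

lemma chain_data_if_checked:
  assumes keys: "keys_check (map fst (concat D)) (pars k k)"
    and S: "starts_check k (concat (map all_starts (concat D)))"
    and groups: "list_all (group_check fuel k) D"
    and conj: "list_all (conjugate_check (conjugate_pairs k)) D"
  shows "chain_data k fuel (star_of D) (starts_of D)"
proof -
  have dist: "distinct (map fst (entries D))" and Par: "set (map fst (entries D)) = Par k"
    using keys unfolding map_fst_entries[OF groups]
    by (auto simp: keys_check_def distinct_exec_iff list_all_iff member_exec_iff Par_eq_pars)
  have entry: "star_of D \<mu> = \<kappa> \<and> starts_of D \<mu> = gs" if "(\<mu>, \<kappa>, gs) \<in> set (entries D)" for \<mu> \<kappa> gs
    using map_of_is_SomeI[OF dist that] by (simp add: star_of_def starts_of_def)
  have partner: "star_of D \<mu> \<in> Par k \<and> star_of D (star_of D \<mu>) = \<mu> \<and>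
      pair_check fuel k (\<mu>, starts_of D \<mu>) (star_of D \<mu>, starts_of D (star_of D \<mu>)) \<and>
      conjugate_pairs_check (conjugate_pairs k) (all_starts (\<mu>, starts_of D \<mu>))
        (all_starts (star_of D \<mu>, starts_of D (star_of D \<mu>))) \<and>
      (\<mu>, starts_of D \<mu>) \<in> set (concat D)" if "\<mu> \<in> Par k" for \<mu>
  proof -
    obtain \<kappa> gs where e: "(\<mu>, \<kappa>, gs) \<in> set (entries D)"
      using \<open>\<mu> \<in> Par k\<close> unfolding Par[symmetric] by auto
    obtain hs where hs: "(\<kappa>, \<mu>, hs) \<in> set (entries D)" "pair_check fuel k (\<mu>, gs) (\<kappa>, hs)"
      "conjugate_pairs_check (conjugate_pairs k) (all_starts (\<mu>, gs)) (all_starts (\<kappa>, hs))"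
      "(\<mu>, gs) \<in> set (concat D)"
      using entry_partner[OF groups conj e] .
    have "\<kappa> \<in> Par k"
      using hs(1) unfolding Par[symmetric] by force
    then show ?thesis
      using hs entry[OF e] entry[OF hs(1)] by simp
  qed
  have mem_S: "\<gamma> \<in> set (concat (map all_starts (concat D)))"
    if "\<mu> \<in> Par k" "\<gamma> \<in> set (all_starts (\<mu>, starts_of D \<mu>))" for \<mu> \<gamma>
    using partner[OF that(1)] that(2) by force
  have dist_S: "distinct (concat (map all_starts (concat D)))"
    using S distinct_if_distinct_split unfolding starts_check_def by blast
  have S_initial: "is_partition \<gamma> \<and> defect \<gamma> = k \<and> initial \<gamma>"
    if "\<gamma> \<in> set (concat (map all_starts (concat D)))" for \<gamma>
    using S that unfolding starts_check_def list_all_iff by blast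
  show ?thesis
  proof
    fix \<mu>
    assume \<mu>: "\<mu> \<in> Par k"
    have mem: "\<gamma> \<in> set (concat (map all_starts (concat D)))"
      if "\<gamma> \<in> set (starts_of D \<mu> @ [gamma_mu \<mu>])" for \<gamma>
      using mem_S[OF \<mu>] that by (simp add: all_starts_def)
    show "star_of D \<mu> \<in> Par k" "star_of D (star_of D \<mu>) = \<mu>"
      using partner[OF \<mu>] by auto
    show "is_partition \<gamma> \<and> deficit \<gamma> = int k \<and> initial \<gamma>"
      if "\<gamma> \<in> set (starts_of D \<mu> @ [gamma_mu \<mu>])" for \<gamma>
      using S_initial[OF mem[OF that]] by (simp add: deficit_eq_defect)
    show "\<mu> = \<kappa>" if "\<kappa> \<in> Par k" "\<gamma> \<in> set (starts_of D \<mu> @ [gamma_mu \<mu>])"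
      "\<gamma> \<in> set (starts_of D \<kappa> @ [gamma_mu \<kappa>])" for \<kappa> \<gamma>
      using distinct_concat_mapD[OF dist_S, of "(\<mu>, starts_of D \<mu>)" "(\<kappa>, starts_of D \<kappa>)" \<gamma>]
        partner[OF \<mu>] partner[OF that(1)] that(2,3) by (simp add: all_starts_def)
    have checks: "sizes_check k (length (star_of D \<mu>)) (map (fragment fuel) (starts_of D \<mu>)) (sum_list (gamma_mu \<mu>))"
      "delta_check (map (fragment fuel) (starts_of D \<mu>)) (delta (gamma_mu \<mu>))
         (max (zeta \<mu> + 2) (zeta (star_of D \<mu>) + 2))"
      "profiles_check (max (zeta \<mu> + 2) (zeta (star_of D \<mu>) + 2)) (length \<mu> + length (star_of D \<mu>) + k)
         (map delta (concat (map (fragment fuel) (starts_of D \<mu>))))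
         (map delta (concat (map (fragment fuel) (starts_of D (star_of D \<mu>)))))"
      using partner[OF \<mu>] unfolding pair_check_def fst_conv snd_conv by blast+
    show "nu (last (fragment fuel \<gamma>)) = None" if "\<gamma> \<in> set (starts_of D \<mu>)" for \<gamma>
      using checks(1) that by (auto simp: sizes_check_def list_all_iff)
    show "map sum_list (concat (map (fragment fuel) (starts_of D \<mu>))) =
        [length (star_of D \<mu>) + k..<sum_list (gamma_mu \<mu>)]"
      "length (star_of D \<mu>) + k \<le> sum_list (gamma_mu \<mu>)"
      using checks(1) by (simp_all add: sizes_check_def)
    show "valley (map (\<lambda>b. delta (hd b)) (concat (map (\<lambda>\<gamma>. blocks (fragment fuel \<gamma>)) (starts_of D \<mu>))) @
        [delta (gamma_mu \<mu>)])"
      using checks(2) by (simp add: delta_check_def comp_def)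
    show "delta \<gamma> \<le> max (zeta \<mu> + 2) (zeta (star_of D \<mu>) + 2)"
      if "\<gamma> \<in> set (concat (map (fragment fuel) (starts_of D \<mu>)))" for \<gamma>
      using checks(2) that unfolding delta_check_def list_all_iff by blast
    show "profile n m (map delta (concat (map (fragment fuel) (starts_of D \<mu>)))) =
        rev (profile n m (map delta (concat (map (fragment fuel) (starts_of D (star_of D \<mu>)))))) \<and>
      (\<forall>d\<in>set (drop m (map delta (concat (map (fragment fuel) (starts_of D \<mu>))))). n < d)"
      if "n < max (zeta \<mu> + 2) (zeta (star_of D \<mu>) + 2)"
        and m: "m = Suc (n choose 2) - (length \<mu> + length (star_of D \<mu>) + k)" for n m
    proof -
      have "n \<in> set [0..<max (zeta \<mu> + 2) (zeta (star_of D \<mu>) + 2)]"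
        using that(1) by (simp only: set_upt atLeastLessThan_iff le0 simp_thms)
      then show ?thesis
        using checks(3) unfolding m tri_eq[symmetric] profiles_check_def profile_check_def list_all_iff
        by blast
    qed
    show "dp n (dyck (conjugate \<alpha>)) \<in> set (starts_of D (star_of D \<mu>) @ [gamma_mu (star_of D \<mu>)])"
      if n: "n \<le> k + 2" and \<alpha>: "\<alpha> \<in> Par n" "2 \<le> part \<alpha> 1" "2 \<le> length \<alpha>"
        and start: "dp n (dyck \<alpha>) \<in> set (starts_of D \<mu> @ [gamma_mu \<mu>])" for n \<alpha>
    proof -
      have "conjugate_exec \<alpha> = conjugate \<alpha>"
        using \<alpha>(1) by (simp only: conjugate_exec_def conjugate_eq_map_col Par_def mem_Collect_eq)
      moreover have "defect (dp n (dyck \<alpha>)) = k"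
        using S_initial[OF mem[OF start]] by simp
      ultimately have "(dp n (dyck \<alpha>), dp n (dyck (conjugate \<alpha>))) \<in> set (conjugate_pair k n \<alpha>)"
        using \<alpha>(2,3) by (simp add: conjugate_pair_def)
      then have pair: "(dp n (dyck \<alpha>), dp n (dyck (conjugate \<alpha>))) \<in> set (conjugate_pairs k)"
        using in_conjugate_pairs[of n k \<alpha>] \<alpha>(1) n by (simp add: Par_eq_pars)
      have "conjugate_pairs_check (conjugate_pairs k) (all_starts (\<mu>, starts_of D \<mu>))
          (all_starts (star_of D \<mu>, starts_of D (star_of D \<mu>)))"
        using partner[OF \<mu>] by blast
      from conjugate_pairs_checkD[OF this pair] show ?thesis
        using start by (simp only: all_starts_def fst_conv snd_conv)
    qed
  next
    fix \<gamma>
    assume \<gamma>: "is_partition \<gamma>" "deficit \<gamma> = int k" "initial \<gamma>"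
    show "\<exists>\<mu>\<in>Par k. \<gamma> \<in> set (starts_of D \<mu> @ [gamma_mu \<mu>])"
    proof (cases "\<gamma> = []")
      case True
      then have "k = 0"
        using \<gamma>(2) by (simp add: deficit_eq_defect)
      then show ?thesis
        using True by (intro bexI[of _ "[]"]) (auto simp: Par_def gamma_mu_def)
    next
      case False
      let ?T = "filter (\<lambda>\<gamma>. \<gamma> \<noteq> []) (concat (map all_starts (concat D)))"
      let ?I = "initials k (Suc k) k [] []"
      have "set ?T \<subseteq> set ?I"
        using S_initial initial_in_initials by (auto simp: deficit_eq_defect simp del: initials.simps)
      \<comment> \<open>\<open>?T\<close> has no repetitions and lies in \<open>?I\<close>; equal
        lengths then force equal sets, even if \<open>?I\<close> should contain repetitions.\<close>
      moreover have "card (set ?I) \<le> card (set ?T)"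
      proof -
        have "card (set ?T) = length ?T"
          using dist_S by (intro distinct_card distinct_filter)
        also have "\<dots> = length ?I"
          using S unfolding starts_check_def by blast
        finally show ?thesis
          using card_length[of ?I] by simp
      qed
      ultimately have "set ?T = set ?I"
        by (intro card_seteq) auto
      then have "\<gamma> \<in> set ?T"
        using initial_in_initials[OF \<gamma>(1) \<gamma>(3) \<gamma>(2) False] by (simp only:)
      then have "\<gamma> \<in> set (concat (map all_starts (concat D)))"
        by (simp only: set_filter mem_Collect_eq)
      then obtain \<mu> gs where x: "(\<mu>, gs) \<in> set (concat D)" "\<gamma> \<in> set (all_starts (\<mu>, gs))"
        unfolding set_concat[of "map all_starts _"] set_map by auto
      then have "\<mu> \<in> set (map fst (concat D))"
        by force
      then have \<mu>: "\<mu> \<in> Par k"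
        unfolding Par[symmetric] map_fst_entries[OF groups] .
      have "distinct (map fst (concat D))"
        using dist unfolding map_fst_entries[OF groups] .
      then have "gs = starts_of D \<mu>"
        using x(1) partner[OF \<mu>] by (meson eq_key_imp_eq_value)
      then show ?thesis
        using \<mu> x(2) by (auto simp: all_starts_def)
    qed
  qed
qed

section \<open>The chains\<close>

text \<open>
  The finite orbits were distributed over the chains by a SAT solver; any distribution that passes
  the checks would do. The number 40 bounds the lengths of the finite orbits.
\<close>

definition chains_0 :: "group list" where
  "chains_0 = [
    [([], [])]]"

definition chains_1 :: "group list" where
  "chains_1 = [
    [([1], [])]]"

definition chains_2 :: "group list" where
  "chains_2 = [
    [([2], [[1, 1, 1]])],
    [([1, 1], [])]]"

definition chains_3 :: "group list" where
  "chains_3 = [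
    [([3], [[1, 1, 1, 1], [2, 2, 2]])],
    [([2, 1], [[3, 1, 1, 1]]), ([1, 1, 1], [[2, 1, 1, 1]])]]"

definition chains_4 :: "group list" where
  "chains_4 = [
    [([4], [[1, 1, 1, 1, 1], [2, 2, 2, 1], [3, 3, 3, 1]])],
    [([3, 1], [[2, 2, 1, 1]]), ([2, 2], [[2, 1, 1, 1, 1]])],
    [([2, 1, 1], [[3, 2, 1, 1, 1], [4, 3, 1, 1, 1]]), ([1, 1, 1, 1], [[3, 1, 1, 1, 1],
      [4, 2, 1, 1, 1]])]]"

definition chains_5 :: "group list" where
  "chains_5 = [
    [([5], [[1, 1, 1, 1, 1, 1], [2, 2, 2, 2], [3, 3, 3, 2], [4, 4, 4, 2, 1]])],
    [([4, 1], [[4, 1, 1, 1, 1], [3, 3, 2, 2]]), ([2, 2, 1], [[2, 1, 1, 1, 1, 1], [3, 2, 2, 2]])],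
    [([3, 2], [[2, 2, 1, 1, 1], [3, 3, 1, 1, 1], [4, 4, 1, 1, 1]])],
    [([3, 1, 1], [[3, 1, 1, 1, 1, 1], [4, 2, 2, 1, 1]])],
    [([2, 1, 1, 1], [[3, 2, 1, 1, 1, 1], [4, 3, 1, 1, 1, 1], [5, 3, 2, 1, 1, 1],
      [5, 4, 3, 1, 1, 1]])],
    [([1, 1, 1, 1, 1], [[4, 2, 1, 1, 1, 1], [4, 3, 2, 1, 1, 1], [5, 4, 2, 1, 1, 1]])]]"

definition chains_6 :: "group list" where
  "chains_6 = [
    [([6], [[1, 1, 1, 1, 1, 1, 1], [2, 2, 2, 2, 1], [3, 3, 3, 2, 1], [4, 4, 4, 3, 1],
      [5, 5, 5, 3, 2, 1]])],
    [([5, 1], [[3, 1, 1, 1, 1, 1, 1], [3, 3, 3, 1, 1], [4, 4, 3, 3, 1]]),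
      ([4, 1, 1], [[2, 1, 1, 1, 1, 1, 1], [3, 3, 2, 1, 1]])],
    [([4, 2], [[2, 2, 2, 1, 1], [4, 2, 2, 2, 1], [4, 4, 4, 1, 1]]), ([3, 3], [[2, 2, 1, 1, 1, 1],
      [3, 2, 2, 2, 1]])],
    [([3, 2, 1], [[3, 2, 1, 1, 1, 1, 1], [5, 3, 1, 1, 1, 1], [5, 3, 3, 1, 1, 1],
      [5, 5, 3, 1, 1, 1]]), ([3, 1, 1, 1], [[4, 1, 1, 1, 1, 1], [4, 2, 2, 1, 1, 1],
      [4, 4, 2, 1, 1, 1], [5, 4, 2, 2, 1, 1]])],
    [([2, 2, 2], [[3, 3, 1, 1, 1, 1]]), ([2, 2, 1, 1], [[3, 2, 2, 1, 1]])],
    [([2, 1, 1, 1, 1], [[4, 2, 1, 1, 1, 1, 1], [4, 3, 2, 1, 1, 1, 1], [5, 4, 2, 1, 1, 1, 1],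
      [5, 4, 3, 2, 1, 1, 1], [6, 5, 3, 2, 1, 1, 1], [6, 5, 4, 3, 1, 1, 1]])],
    [([1, 1, 1, 1, 1, 1], [[4, 3, 1, 1, 1, 1, 1], [5, 3, 2, 1, 1, 1, 1], [5, 4, 3, 1, 1, 1, 1],
      [6, 4, 3, 2, 1, 1, 1], [6, 5, 4, 2, 1, 1, 1]])]]"

definition chains_7 :: "group list" where
  "chains_7 = [
    [([7], [[1, 1, 1, 1, 1, 1, 1, 1], [2, 2, 2, 2, 2], [3, 3, 3, 3, 1], [4, 4, 4, 3, 2],
      [5, 5, 5, 4, 2, 1], [6, 6, 6, 4, 3, 2, 1]])],
    [([6, 1], [[2, 2, 2, 1, 1, 1], [3, 3, 2, 1, 1, 1], [4, 3, 2, 2, 2], [4, 4, 4, 2, 2],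
      [5, 5, 4, 4, 2, 1]]), ([4, 3], [[2, 1, 1, 1, 1, 1, 1, 1], [3, 2, 2, 2, 2], [4, 4, 2, 2, 2],
      [5, 5, 4, 1, 1, 1]])],
    [([5, 2], [[2, 2, 1, 1, 1, 1, 1], [3, 3, 2, 2, 1], [5, 5, 5, 3, 1, 1]])],
    [([5, 1, 1], [[5, 2, 1, 1, 1, 1], [5, 4, 1, 1, 1, 1], [4, 4, 3, 2, 2]]),
      ([2, 2, 2, 1], [[3, 1, 1, 1, 1, 1, 1, 1], [4, 2, 2, 2, 2], [5, 5, 2, 1, 1, 1]])],
    [([4, 2, 1], [[4, 2, 2, 1, 1, 1, 1], [4, 4, 3, 1, 1, 1], [5, 5, 2, 2, 1, 1]]),
      ([2, 2, 1, 1, 1], [[4, 1, 1, 1, 1, 1, 1], [4, 4, 1, 1, 1, 1], [5, 3, 2, 2, 1, 1]])],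
    [([4, 1, 1, 1], [[3, 2, 1, 1, 1, 1, 1, 1], [4, 3, 3, 1, 1, 1], [5, 3, 3, 2, 1, 1]])],
    [([3, 3, 1], [[5, 1, 1, 1, 1, 1], [5, 2, 2, 1, 1, 1], [4, 3, 3, 3, 1]]),
      ([3, 2, 2], [[3, 2, 2, 1, 1, 1], [3, 3, 3, 3], [5, 4, 4, 1, 1, 1]])],
    [([3, 2, 1, 1], [[4, 2, 1, 1, 1, 1, 1, 1], [4, 4, 2, 1, 1, 1, 1], [5, 4, 2, 2, 1, 1, 1],
      [5, 5, 3, 2, 1, 1, 1], [6, 5, 3, 3, 1, 1, 1], [6, 6, 4, 3, 1, 1, 1]]),
      ([3, 1, 1, 1, 1], [[3, 3, 1, 1, 1, 1, 1], [5, 3, 1, 1, 1, 1, 1], [5, 3, 3, 1, 1, 1, 1],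
      [6, 4, 3, 1, 1, 1, 1], [6, 4, 4, 2, 1, 1, 1], [6, 5, 4, 2, 2, 1, 1]])],
    [([2, 1, 1, 1, 1, 1], [[4, 3, 2, 1, 1, 1, 1, 1], [5, 4, 2, 1, 1, 1, 1, 1],
      [5, 4, 3, 2, 1, 1, 1, 1], [6, 5, 3, 2, 1, 1, 1, 1], [6, 5, 4, 3, 1, 1, 1, 1],
      [7, 5, 4, 3, 2, 1, 1, 1], [7, 6, 5, 3, 2, 1, 1, 1], [7, 6, 5, 4, 3, 1, 1, 1]]),
      ([1, 1, 1, 1, 1, 1, 1], [[4, 3, 1, 1, 1, 1, 1, 1], [5, 3, 2, 1, 1, 1, 1, 1],
      [5, 4, 3, 1, 1, 1, 1, 1], [6, 4, 3, 2, 1, 1, 1, 1], [6, 5, 4, 2, 1, 1, 1, 1],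
      [6, 5, 4, 3, 2, 1, 1, 1], [7, 6, 4, 3, 2, 1, 1, 1], [7, 6, 5, 4, 2, 1, 1, 1]])]]"

definition chains_8 :: "group list" where
  "chains_8 = [
    [([8], [[5, 2, 1, 1, 1, 1, 1], [3, 3, 3, 3, 2], [4, 4, 4, 3, 2, 1], [5, 5, 5, 4, 3, 1],
      [6, 6, 6, 5, 3, 2, 1], [7, 7, 7, 5, 4, 3, 2, 1]]),
      ([3, 3, 1, 1], [[1, 1, 1, 1, 1, 1, 1, 1, 1], [2, 2, 2, 2, 2, 1], [4, 3, 3, 2, 2]])],
    [([7, 1], [[2, 2, 2, 1, 1, 1, 1], [3, 2, 2, 2, 2, 1], [4, 4, 4, 1, 1, 1], [4, 4, 4, 3, 1, 1],
      [5, 5, 5, 3, 3, 1], [6, 6, 5, 5, 3, 2, 1]]), ([5, 3], [[2, 1, 1, 1, 1, 1, 1, 1, 1],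
      [3, 3, 3, 1, 1, 1], [4, 3, 2, 2, 2, 1], [5, 5, 2, 2, 2, 1], [5, 5, 5, 2, 2, 1]])],
    [([6, 2], [[3, 2, 1, 1, 1, 1, 1, 1, 1], [5, 5, 1, 1, 1, 1], [4, 4, 3, 3, 2],
      [6, 6, 6, 4, 3, 1, 1]]), ([5, 1, 1, 1], [[2, 2, 1, 1, 1, 1, 1, 1], [3, 3, 2, 2, 2],
      [4, 4, 3, 2, 1, 1]])],
    [([6, 1, 1], [[3, 1, 1, 1, 1, 1, 1, 1, 1], [5, 2, 2, 2, 1, 1], [4, 4, 4, 2, 1, 1],
      [5, 5, 4, 3, 3, 1]])],
    [([5, 2, 1], [[3, 3, 2, 1, 1, 1, 1], [4, 3, 3, 1, 1, 1, 1], [5, 3, 3, 3, 1, 1],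
      [5, 5, 4, 4, 1, 1]]), ([3, 2, 2, 1], [[4, 1, 1, 1, 1, 1, 1, 1], [4, 3, 2, 2, 1, 1],
      [6, 5, 5, 3, 1, 1, 1]])],
    [([4, 4], [[4, 2, 2, 2, 1, 1], [4, 3, 3, 3, 2]]), ([2, 2, 2, 2], [[2, 2, 2, 2, 1, 1],
      [3, 3, 3, 2, 2]])],
    [([4, 3, 1], [[3, 2, 2, 1, 1, 1, 1], [5, 2, 2, 1, 1, 1, 1], [5, 3, 2, 2, 1, 1, 1],
      [6, 4, 2, 2, 1, 1, 1], [5, 5, 4, 2, 1, 1, 1], [6, 6, 4, 2, 1, 1, 1],
      [6, 6, 5, 3, 1, 1, 1]])],
    [([4, 2, 2], [[5, 1, 1, 1, 1, 1, 1], [4, 2, 2, 2, 2, 1], [5, 4, 2, 2, 2, 1],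
      [5, 5, 5, 2, 1, 1]])],
    [([4, 2, 1, 1], [[5, 3, 1, 1, 1, 1, 1, 1], [5, 3, 3, 2, 1, 1, 1], [5, 4, 4, 2, 1, 1, 1],
      [6, 4, 4, 3, 1, 1, 1], [6, 6, 4, 2, 2, 1, 1]]),
      ([2, 2, 1, 1, 1, 1], [[3, 3, 1, 1, 1, 1, 1, 1], [5, 4, 1, 1, 1, 1, 1],
      [6, 4, 2, 1, 1, 1, 1], [6, 5, 3, 1, 1, 1, 1], [6, 5, 3, 2, 2, 1, 1]])],
    [([4, 1, 1, 1, 1], [[4, 2, 1, 1, 1, 1, 1, 1, 1], [4, 4, 3, 1, 1, 1, 1],
      [5, 5, 3, 1, 1, 1, 1], [6, 4, 3, 3, 1, 1, 1], [6, 5, 3, 3, 2, 1, 1]])],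
    [([3, 3, 2], [[4, 4, 1, 1, 1, 1, 1], [5, 3, 2, 2, 2, 1]]),
      ([2, 2, 2, 1, 1], [[3, 2, 2, 2, 1, 1], [4, 4, 2, 2, 1, 1]])],
    [([3, 2, 1, 1, 1], [[4, 2, 2, 1, 1, 1, 1, 1], [4, 4, 2, 1, 1, 1, 1, 1],
      [5, 4, 2, 2, 1, 1, 1, 1], [5, 5, 3, 2, 1, 1, 1, 1], [6, 5, 3, 3, 1, 1, 1, 1],
      [7, 5, 4, 3, 1, 1, 1, 1], [7, 5, 5, 3, 2, 1, 1, 1], [7, 6, 5, 3, 3, 1, 1, 1],
      [7, 7, 5, 4, 3, 1, 1, 1]])],
    [([3, 1, 1, 1, 1, 1], [[4, 3, 1, 1, 1, 1, 1, 1, 1], [5, 3, 3, 1, 1, 1, 1, 1],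
      [6, 4, 3, 1, 1, 1, 1, 1], [6, 4, 4, 2, 1, 1, 1, 1], [6, 5, 4, 2, 2, 1, 1, 1],
      [6, 6, 4, 3, 2, 1, 1, 1], [7, 6, 4, 4, 2, 1, 1, 1], [7, 6, 5, 4, 2, 2, 1, 1]])],
    [([2, 1, 1, 1, 1, 1, 1], [[5, 3, 2, 1, 1, 1, 1, 1, 1], [5, 4, 3, 1, 1, 1, 1, 1, 1],
      [6, 4, 3, 2, 1, 1, 1, 1, 1], [6, 5, 4, 2, 1, 1, 1, 1, 1], [6, 5, 4, 3, 2, 1, 1, 1, 1],
      [7, 6, 4, 3, 2, 1, 1, 1, 1], [7, 6, 5, 4, 2, 1, 1, 1, 1], [7, 6, 5, 4, 3, 2, 1, 1, 1],
      [8, 7, 5, 4, 3, 2, 1, 1, 1], [8, 7, 6, 5, 3, 2, 1, 1, 1], [8, 7, 6, 5, 4, 3, 1, 1, 1]]),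
      ([1, 1, 1, 1, 1, 1, 1, 1], [[4, 3, 2, 1, 1, 1, 1, 1, 1], [5, 4, 2, 1, 1, 1, 1, 1, 1],
      [5, 4, 3, 2, 1, 1, 1, 1, 1], [6, 5, 3, 2, 1, 1, 1, 1, 1], [6, 5, 4, 3, 1, 1, 1, 1, 1],
      [7, 5, 4, 3, 2, 1, 1, 1, 1], [7, 6, 5, 3, 2, 1, 1, 1, 1], [7, 6, 5, 4, 3, 1, 1, 1, 1],
      [8, 6, 5, 4, 3, 2, 1, 1, 1], [8, 7, 6, 4, 3, 2, 1, 1, 1], [8, 7, 6, 5, 4, 2, 1, 1, 1]])]]"

definition chains_9 :: "group list" where
  "chains_9 = [
    [([9], [[4, 4, 1, 1, 1, 1, 1, 1], [5, 3, 2, 2, 1, 1, 1, 1], [5, 4, 3, 3, 1, 1, 1],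
      [5, 5, 4, 3, 1, 1, 1], [6, 5, 4, 4, 1, 1, 1], [5, 5, 5, 4, 3, 2], [6, 6, 6, 5, 4, 2, 1],
      [7, 7, 7, 6, 4, 3, 2, 1], [8, 8, 8, 6, 5, 4, 3, 2, 1]]),
      ([3, 3, 1, 1, 1], [[1, 1, 1, 1, 1, 1, 1, 1, 1, 1], [2, 2, 2, 2, 2, 2],
      [6, 4, 1, 1, 1, 1, 1], [5, 5, 2, 2, 1, 1, 1], [6, 4, 3, 2, 2, 1, 1],
      [7, 6, 6, 4, 3, 1, 1, 1]])],
    [([8, 1], [[3, 2, 2, 1, 1, 1, 1, 1], [3, 3, 3, 3, 1, 1], [4, 4, 4, 4, 2], [5, 5, 5, 4, 2, 2],
      [6, 6, 6, 4, 4, 2, 1], [7, 7, 6, 6, 4, 3, 2, 1]]),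
      ([5, 2, 2], [[2, 1, 1, 1, 1, 1, 1, 1, 1, 1], [3, 2, 2, 2, 2, 2], [5, 3, 3, 2, 2, 1],
      [6, 6, 6, 4, 2, 1, 1]])],
    [([7, 2], [[2, 2, 1, 1, 1, 1, 1, 1, 1], [3, 3, 3, 2, 1, 1], [4, 4, 4, 2, 2, 1],
      [5, 5, 4, 4, 3, 1], [7, 7, 7, 5, 4, 3, 1, 1]])],
    [([7, 1, 1], [[6, 3, 1, 1, 1, 1, 1], [5, 3, 2, 2, 2, 2], [5, 5, 3, 2, 2, 2],
      [5, 5, 5, 3, 2, 2], [6, 6, 5, 4, 4, 2, 1]]),
      ([2, 2, 2, 2, 1], [[3, 1, 1, 1, 1, 1, 1, 1, 1, 1], [4, 2, 2, 2, 2, 2], [5, 4, 2, 2, 2, 2],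
      [5, 5, 4, 2, 2, 2]])],
    [([6, 3], [[4, 1, 1, 1, 1, 1, 1, 1, 1], [5, 2, 2, 2, 2, 1], [5, 3, 3, 3, 2, 1],
      [5, 5, 5, 4, 1, 1], [6, 6, 6, 4, 2, 2, 1]]), ([6, 2, 1], [[2, 2, 2, 1, 1, 1, 1, 1],
      [3, 3, 2, 2, 2, 1], [4, 4, 3, 3, 1, 1], [6, 6, 5, 5, 3, 1, 1]])],
    [([6, 1, 1, 1], [[3, 3, 2, 2, 1, 1], [5, 5, 4, 3, 2, 2]]),
      ([3, 3, 3], [[3, 2, 1, 1, 1, 1, 1, 1, 1, 1], [4, 3, 2, 2, 2, 2]])],
    [([5, 4], [[2, 2, 2, 2, 1, 1, 1], [4, 2, 2, 2, 1, 1, 1], [3, 3, 3, 3, 2, 1],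
      [4, 4, 4, 4, 2, 1], [6, 6, 5, 4, 1, 1, 1]])],
    [([5, 3, 1], [[3, 3, 2, 1, 1, 1, 1, 1], [4, 3, 3, 1, 1, 1, 1, 1], [6, 3, 3, 2, 1, 1, 1],
      [5, 5, 3, 3, 1, 1, 1], [6, 5, 5, 2, 1, 1, 1], [6, 6, 5, 2, 2, 1, 1]]),
      ([4, 2, 2, 1], [[5, 1, 1, 1, 1, 1, 1, 1], [5, 2, 2, 2, 1, 1, 1], [6, 3, 3, 1, 1, 1, 1],
      [6, 4, 4, 1, 1, 1, 1], [6, 4, 4, 2, 2, 1, 1], [7, 7, 6, 4, 3, 1, 1, 1]])],
    [([5, 2, 1, 1], [[3, 3, 1, 1, 1, 1, 1, 1, 1], [6, 3, 2, 1, 1, 1, 1], [4, 4, 4, 4, 1],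
      [6, 6, 3, 3, 2, 1, 1]])],
    [([5, 1, 1, 1, 1], [[4, 2, 1, 1, 1, 1, 1, 1, 1, 1], [4, 4, 3, 2, 1, 1, 1],
      [5, 4, 3, 2, 2, 2], [6, 4, 4, 3, 2, 1, 1]])],
    [([4, 4, 1], [[5, 2, 1, 1, 1, 1, 1, 1], [4, 4, 2, 2, 1, 1, 1], [5, 4, 4, 1, 1, 1, 1],
      [6, 5, 4, 1, 1, 1, 1], [6, 6, 3, 3, 1, 1, 1], [6, 6, 4, 4, 1, 1, 1]]),
      ([4, 3, 1, 1], [[3, 2, 2, 2, 1, 1, 1], [4, 3, 2, 2, 1, 1, 1], [5, 5, 2, 1, 1, 1, 1],
      [6, 5, 2, 2, 1, 1, 1], [6, 6, 3, 2, 1, 1, 1], [6, 5, 5, 2, 2, 1, 1]])],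
    [([4, 3, 2], [[5, 2, 2, 1, 1, 1, 1, 1], [4, 3, 3, 3, 2, 1], [5, 4, 4, 4, 2, 1]]),
      ([3, 2, 2, 1, 1], [[6, 1, 1, 1, 1, 1, 1], [4, 3, 3, 2, 1, 1]])],
    [([4, 2, 1, 1, 1], [[4, 3, 1, 1, 1, 1, 1, 1, 1, 1], [5, 3, 3, 2, 1, 1, 1, 1],
      [6, 5, 3, 1, 1, 1, 1, 1], [6, 5, 3, 2, 2, 1, 1, 1], [6, 6, 4, 3, 1, 1, 1, 1],
      [7, 5, 4, 4, 2, 1, 1, 1], [7, 6, 4, 4, 3, 1, 1, 1], [7, 7, 5, 4, 2, 2, 1, 1]]),
      ([4, 1, 1, 1, 1, 1], [[4, 2, 2, 1, 1, 1, 1, 1, 1], [4, 4, 3, 1, 1, 1, 1, 1],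
      [6, 4, 2, 2, 1, 1, 1, 1], [5, 5, 4, 2, 1, 1, 1, 1], [6, 5, 3, 3, 2, 1, 1, 1],
      [6, 5, 5, 3, 2, 1, 1, 1], [7, 5, 5, 4, 2, 1, 1, 1], [7, 6, 5, 3, 3, 2, 1, 1]])],
    [([3, 3, 2, 1], [[6, 2, 1, 1, 1, 1, 1], [4, 4, 2, 2, 2, 1], [5, 5, 5, 1, 1, 1],
      [5, 5, 3, 3, 3, 1]])],
    [([3, 2, 2, 2], [[3, 3, 3, 1, 1, 1, 1], [4, 3, 3, 3, 1, 1], [5, 4, 4, 4, 1, 1]])],
    [([3, 2, 1, 1, 1, 1], [[5, 3, 1, 1, 1, 1, 1, 1, 1], [5, 3, 3, 1, 1, 1, 1, 1, 1],
      [6, 4, 3, 1, 1, 1, 1, 1, 1], [6, 4, 4, 2, 1, 1, 1, 1, 1], [6, 5, 4, 2, 2, 1, 1, 1, 1],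
      [6, 6, 4, 3, 2, 1, 1, 1, 1], [7, 6, 4, 4, 2, 1, 1, 1, 1], [7, 6, 5, 4, 2, 2, 1, 1, 1],
      [7, 7, 5, 4, 3, 2, 1, 1, 1], [8, 7, 5, 5, 3, 2, 1, 1, 1], [8, 7, 6, 5, 3, 3, 1, 1, 1],
      [8, 8, 6, 5, 4, 3, 1, 1, 1]])],
    [([3, 1, 1, 1, 1, 1, 1], [[4, 3, 2, 1, 1, 1, 1, 1, 1, 1], [5, 4, 2, 2, 1, 1, 1, 1, 1],
      [5, 5, 3, 2, 1, 1, 1, 1, 1], [6, 5, 3, 3, 1, 1, 1, 1, 1], [7, 5, 4, 3, 1, 1, 1, 1, 1],
      [7, 5, 5, 3, 2, 1, 1, 1, 1], [7, 6, 5, 3, 3, 1, 1, 1, 1], [8, 6, 5, 4, 3, 1, 1, 1, 1],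
      [8, 6, 6, 4, 3, 2, 1, 1, 1], [8, 7, 6, 4, 4, 2, 1, 1, 1], [8, 7, 6, 5, 4, 2, 2, 1, 1]])],
    [([2, 2, 2, 1, 1, 1], [[4, 4, 2, 1, 1, 1, 1, 1, 1], [5, 5, 3, 1, 1, 1, 1, 1],
      [6, 4, 3, 3, 1, 1, 1, 1], [7, 5, 4, 2, 1, 1, 1, 1], [7, 6, 4, 3, 1, 1, 1, 1],
      [7, 6, 4, 3, 3, 1, 1, 1], [7, 7, 5, 4, 2, 1, 1, 1]]),
      ([2, 2, 1, 1, 1, 1, 1], [[5, 4, 1, 1, 1, 1, 1, 1], [6, 4, 2, 1, 1, 1, 1, 1],
      [5, 4, 4, 2, 1, 1, 1, 1], [6, 4, 4, 3, 1, 1, 1, 1], [7, 5, 4, 2, 2, 1, 1, 1],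
      [6, 6, 5, 3, 2, 1, 1, 1], [7, 6, 5, 3, 2, 2, 1, 1]])],
    [([2, 1, 1, 1, 1, 1, 1, 1], [[5, 3, 2, 1, 1, 1, 1, 1, 1, 1], [5, 4, 3, 1, 1, 1, 1, 1, 1, 1],
      [6, 4, 3, 2, 1, 1, 1, 1, 1, 1], [6, 5, 4, 2, 1, 1, 1, 1, 1, 1],
      [6, 5, 4, 3, 2, 1, 1, 1, 1, 1], [7, 6, 4, 3, 2, 1, 1, 1, 1, 1],
      [7, 6, 5, 4, 2, 1, 1, 1, 1, 1], [7, 6, 5, 4, 3, 2, 1, 1, 1, 1],
      [8, 7, 5, 4, 3, 2, 1, 1, 1, 1], [8, 7, 6, 5, 3, 2, 1, 1, 1, 1],
      [8, 7, 6, 5, 4, 3, 1, 1, 1, 1], [9, 7, 6, 5, 4, 3, 2, 1, 1, 1],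
      [9, 8, 7, 5, 4, 3, 2, 1, 1, 1], [9, 8, 7, 6, 5, 3, 2, 1, 1, 1],
      [9, 8, 7, 6, 5, 4, 3, 1, 1, 1]])],
    [([1, 1, 1, 1, 1, 1, 1, 1, 1], [[5, 4, 2, 1, 1, 1, 1, 1, 1, 1],
      [5, 4, 3, 2, 1, 1, 1, 1, 1, 1], [6, 5, 3, 2, 1, 1, 1, 1, 1, 1],
      [6, 5, 4, 3, 1, 1, 1, 1, 1, 1], [7, 5, 4, 3, 2, 1, 1, 1, 1, 1],
      [7, 6, 5, 3, 2, 1, 1, 1, 1, 1], [7, 6, 5, 4, 3, 1, 1, 1, 1, 1],
      [8, 6, 5, 4, 3, 2, 1, 1, 1, 1], [8, 7, 6, 4, 3, 2, 1, 1, 1, 1],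
      [8, 7, 6, 5, 4, 2, 1, 1, 1, 1], [8, 7, 6, 5, 4, 3, 2, 1, 1, 1],
      [9, 8, 6, 5, 4, 3, 2, 1, 1, 1], [9, 8, 7, 6, 4, 3, 2, 1, 1, 1],
      [9, 8, 7, 6, 5, 4, 2, 1, 1, 1]])]]"

section \<open>Evaluation of the checks for each deficit\<close>

lemma chain_data_0: "chain_data 0 40 (star_of chains_0) (starts_of chains_0)"
  by (rule chain_data_if_checked) code_simp+

lemma chain_data_1: "chain_data 1 40 (star_of chains_1) (starts_of chains_1)"
  by (rule chain_data_if_checked) code_simp+

lemma chain_data_2: "chain_data 2 40 (star_of chains_2) (starts_of chains_2)"
  by (rule chain_data_if_checked) code_simp+

lemma chain_data_3: "chain_data 3 40 (star_of chains_3) (starts_of chains_3)"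
  by (rule chain_data_if_checked) code_simp+

lemma chain_data_4: "chain_data 4 40 (star_of chains_4) (starts_of chains_4)"
  by (rule chain_data_if_checked) code_simp+

lemma chain_data_5: "chain_data 5 40 (star_of chains_5) (starts_of chains_5)"
  by (rule chain_data_if_checked) code_simp+

lemma chain_data_6: "chain_data 6 40 (star_of chains_6) (starts_of chains_6)"
  by (rule chain_data_if_checked) code_simp+

lemma chain_data_7: "chain_data 7 40 (star_of chains_7) (starts_of chains_7)"
  by (rule chain_data_if_checked) code_simp+

lemma chain_data_8: "chain_data 8 40 (star_of chains_8) (starts_of chains_8)"
  by (rule chain_data_if_checked) code_simp+

lemma chain_data_9: "chain_data 9 40 (star_of chains_9) (starts_of chains_9)"
  by (rule chain_data_if_checked) code_simp+

theorem theorem4p10: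
  fixes k :: nat
  assumes "k \<le> 9"
  shows "\<exists>(C :: nat list \<Rightarrow> nat list set) (Cbar :: nat list \<Rightarrow> nat list set) (star :: nat list \<Rightarrow> nat list).
    \<comment> \<open>(1)\<close>
    disjoint_family_on C (Par k) \<and> disjoint_family_on Cbar (Par k) \<and>
    \<comment> \<open>(2)\<close>
    DP_deficit k = (\<Union>\<mu>\<in>Par k. C \<mu>) \<and> DP_deficit k = (\<Union>\<mu>\<in>Par k. Cbar \<mu>) \<and>
    \<comment> \<open>(3)\<close>
    (\<forall>\<mu>\<in>Par k. \<forall>m. \<exists>\<delta>. nu_pow m (gamma_mu \<mu>) = Some \<delta> \<and> \<delta> \<in> C \<mu>) \<and>
    \<comment> \<open>(4)\<close>
    (\<forall>\<mu>\<in>Par k. star \<mu> \<in> Par k \<and> C \<mu> = Cbar (star \<mu>) \<and> C (star \<mu>) = Cbar \<mu> \<and>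
       (\<forall>\<kappa>\<in>Par k. C \<mu> = Cbar \<kappa> \<and> C \<kappa> = Cbar \<mu> \<longrightarrow> \<kappa> = star \<mu>)) \<and>
    \<comment> \<open>(5)\<close>
    (\<forall>\<mu>\<in>Par k.
       (\<forall>i\<ge>length (star \<mu>). \<exists>!\<gamma>. \<gamma> \<in> C \<mu> \<and> dinv \<gamma> = i) \<and>
       (\<exists>idx :: nat \<Rightarrow> nat.
          strict_mono_on {1..} idx \<and>
          (\<forall>j\<ge>1. length (star \<mu>) \<le> idx j) \<and>
          C \<mu> = (\<Union>j\<in>{1..}. R_set (chain_elem (C \<mu>) (idx j))) \<and>
          (\<exists>t\<ge>1. antimono_on {1..t} (\<lambda>j. Delta (chain_elem (C \<mu>) (idx j))) \<and>
                  mono_on {t..} (\<lambda>j. Delta (chain_elem (C \<mu>) (idx j)))))) \<and>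
    \<comment> \<open>(6)\<close>
    (\<forall>\<mu>\<in>Par k. \<forall>n\<ge>max (zeta \<mu> + 2) (zeta (star \<mu>) + 2). \<forall>i::int.
       (int (length (star \<mu>)) \<le> i \<and> i \<le> int (n choose 2) - int k - int (length \<mu>) \<longleftrightarrow>
          (\<exists>\<gamma>. \<gamma> \<in> C \<mu> \<and> Delta \<gamma> \<le> n \<and> int (dinv \<gamma>) = i)) \<and>
       (\<exists>\<^sub>\<le>\<^sub>1\<gamma>. \<gamma> \<in> C \<mu> \<and> Delta \<gamma> \<le> n \<and> int (dinv \<gamma>) = i)) \<and>
    \<comment> \<open>(7)\<close>
    (\<forall>\<mu>\<in>Par k. \<forall>\<gamma>\<in>C \<mu>. \<forall>\<delta>. nu \<gamma> = Some \<delta> \<longrightarrow> \<delta> \<in> C \<mu>) \<and>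
    \<comment> \<open>(8)\<close>
    (\<forall>\<mu>\<in>Par k. \<forall>n. \<forall>\<alpha>\<in>Par n. dp n (dyck \<alpha>) \<in> C \<mu> \<longrightarrow> dp n (dyck (conjugate \<alpha>)) \<in> Cbar \<mu>) \<and>
    \<comment> \<open>(9)\<close>
    (\<forall>\<mu>\<in>Par k. \<forall>n. opposite n (C \<mu> \<inter> DP n) (Cbar \<mu> \<inter> DP n))"
proof -
  have "k = 0 \<or> k = 1 \<or> k = 2 \<or> k = 3 \<or> k = 4 \<or> k = 5 \<or> k = 6 \<or> k = 7 \<or> k = 8 \<or> k = 9"
    using assms by arith
  then have "\<exists>star starts. chain_data k 40 star starts"
    using chain_data_0 chain_data_1 chain_data_2 chain_data_3 chain_data_4
      chain_data_5 chain_data_6 chain_data_7 chain_data_8 chain_data_9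
    by metis
  then obtain star starts where "chain_data k 40 star starts"
    by blast
  then show ?thesis
    by (rule chain_data.chain_decomposition)
qed

end
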